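(* Let $\Phi$ be an irreducible root system of type $A_\ell$, $B_\ell$ or $C_\ell$ in $\mathbb{R}^\ell$, with a fixed positive system $\Phi^+$ and base $\Delta=\{\alpha_1,\dots,\alpha_\ell\}$, and let $\mathcal{I}\subseteq\Phi^+$ be an ideal. Then the toric arrangement $\mathscr{A}_{\mathcal{I}}$ (with respect to the root lattice) is inductive.
   Context: Order $\Phi^+$ by $\beta_1\ge\beta_2$ iff $\beta_1-\beta_2$ is a nonnegative integer combination of $\Delta$; an ideal is a subset $\mathcal{I}\subseteq\Phi^+$ with $\beta_1\ge\beta_2$, $\beta_1\in\mathcal{I}$, $\beta_2\in\Phi^+$ implying $\beta_2\in\mathcal{I}$. For $\beta=\sum_i s_i\alpha_i\in\mathcal{I}$ let $H_\beta=\{t\in(\mathbb{S}^1)^\ell : t_1^{s_1}\cdots t_\ell^{s_\ell}=1\}$; $\mathscr{A}_{\mathcal{I}}$ is the set of connected components of the $H_\beta$, $\beta\in\mathcal{I}$. More generally (abelian arrangements with $G=\mathbb{S}^1$): with $\Gamma\cong\mathbb{Z}^\ell$, $T=\operatorname{Hom}(\Gamma,\mathbb{S}^1)\cong(\mathbb{S}^1)^\ell$, and for $\alpha\in\Gamma\setminus\{0\}$, $c\in\mathbb{S}^1$, $H_{\alpha,c}=\{\varphi\in T:\varphi(\alpha)=c\}$, an arrangement is the set of connected components of $H_{\alpha,c}$ for $(\alpha,c)$ in a finite set; $\varnothing_\ell$ is the empty arrangement in $T$. Its poset of layers $L(\mathscr{A})$ consists of the connected components of nonempty intersections of subsets of $\mathscr{A}$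 (the empty intersection being $T$), ordered by reverse inclusion, with rank given by codimension. $\chi_{\mathscr{A}}(t)=\sum_{X\in L(\mathscr{A})}\mu(T,X)t^{\dim X}$. For $H\in\mathscr{A}$: deletion $\mathscr{A}'=\mathscr{A}\setminus\{H\}$ (in $T$), restriction $\mathscr{A}''=$ the set of connected components of nonempty $K\cap H$, $K\in\mathscr{A}'$, regarded as an arrangement in $H\cong(\mathbb{S}^1)^{\ell-1}$. The class of inductive arrangements is the smallest class such that $\varnothing_\ell$ is inductive for all $\ell\ge1$, and $\mathscr{A}$ is inductive whenever there exists $H\in\mathscr{A}$ with $\mathscr{A}''$, $\mathscr{A}'$ inductive and $\chi_{\mathscr{A}'}(t)=(t-d)\chi_{\mathscr{A}''}(t)$ for some $d\in\mathbb{Z}$.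
   Formalization: The empty arrangement is taken to be inductive also in the 0-dimensional torus (ℓ = 0), not only for ℓ ≥ 1; otherwise the claim fails already for A_1 with 𝓘 = {α_1}, whose restriction is the empty arrangement in a point. *)

theory Defs
  imports "HOL-Analysis.Analysis" "HOL-Computational_Algebra.Polynomial"
    "HOL-Combinatorics.Permutations"
begin

text \<open>Points of the torus (S^1)^l are modelled as functions nat => complex whose
values at indices i < l lie on the unit circle and which are 1 at indices >= l.
The type nat => complex carries the product topology (HOL-Analysis Function_Topology),
whose subspace topology on this set is the usual topology of (S^1)^l.
Elements of the lattice Gamma = Z^l are functions nat => int vanishing at indices >= l.\<close>

type_synonym pt = "nat \<Rightarrow> complex"
type_synonym lat = "nat \<Rightarrow> int"

definition torus :: "nat \<Rightarrow> pt set" where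
  "torus l = {t. (\<forall>i<l. cmod (t i) = 1) \<and> (\<forall>i\<ge>l. t i = 1)}"

definition in_lattice :: "nat \<Rightarrow> lat \<Rightarrow> bool" where
  "in_lattice l a \<longleftrightarrow> (\<forall>i\<ge>l. a i = 0)"

definition chr :: "nat \<Rightarrow> lat \<Rightarrow> pt \<Rightarrow> complex" where
  "chr l a t = (\<Prod>i<l. t i powi a i)"

definition hyp :: "nat \<Rightarrow> lat \<Rightarrow> complex \<Rightarrow> pt set" where
  "hyp l a c = {t \<in> torus l. chr l a t = c}"

text \<open>An arrangement is given by its ambient torus X (the whole torus, or a layer
regarded as a torus in its own right) and a finite set A of hypertori in X.
Layers: connected components of the nonempty intersections of subsets of A;
the empty intersection is the ambient X.\<close>
definition layers :: "pt set \<Rightarrow> pt set set \<Rightarrow> pt set set" where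
  "layers X A = (\<Union>B\<in>Pow A. components (X \<inter> \<Inter>B))"

definition int_indep :: "lat set \<Rightarrow> bool" where
  "int_indep F \<longleftrightarrow> (\<forall>c :: lat \<Rightarrow> int. (\<forall>i. (\<Sum>v\<in>F. c v * v i) = 0) \<longrightarrow> (\<forall>v\<in>F. c v = 0))"

definition lrank :: "lat set \<Rightarrow> nat" where
  "lrank S = Max {card F | F. F \<subseteq> S \<and> finite F \<and> int_indep F}"

text \<open>Dimension of a layer Y (a coset of a subtorus of (S^1)^l): l minus the rank of
the lattice of characters that are constant on Y.\<close>
definition tdim :: "nat \<Rightarrow> pt set \<Rightarrow> nat" where
  "tdim l Y = l - lrank {a. in_lattice l a \<and> (\<forall>s\<in>Y. \<forall>t\<in>Y. chr l a s = chr l a t)}"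

function mob :: "pt set set \<Rightarrow> pt set \<Rightarrow> pt set \<Rightarrow> int" where
  "mob L amb X =
     (if \<not> finite L then 0
      else if X = amb then 1
      else - (\<Sum>Y\<in>{Y\<in>L. X \<subset> Y \<and> Y \<subseteq> amb}. mob L amb Y))"
  by auto
termination
proof (relation "Wellfounded.measure (\<lambda>(L, amb, X). card {Z\<in>L. X \<subset> Z})", goal_cases)
  case 1 show ?case by simp
next
  case (2 L amb X Y)
  then have "{Z\<in>L. Y \<subset> Z} \<subset> {Z\<in>L. X \<subset> Z}" by auto
  then show ?case using 2 by (simp add: psubset_card_mono)
qed

declare mob.simps [simp del]

definition chi :: "nat \<Rightarrow> pt set \<Rightarrow> pt set set \<Rightarrow> int poly" where
  "chi l X A = (\<Sum>Y\<in>layers X A. monom (mob (layers X A) X Y) (tdim l Y))"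

definition restr :: "pt set set \<Rightarrow> pt set \<Rightarrow> pt set set" where
  "restr A H = (\<Union>K\<in>A - {H}. components (K \<inter> H))"

inductive inductive_arr :: "nat \<Rightarrow> pt set \<Rightarrow> pt set set \<Rightarrow> bool" for l where
  empty: "inductive_arr l X {}"
| step: "\<lbrakk> H \<in> A; inductive_arr l X (A - {H}); inductive_arr l H (restr A H);
           chi l X (A - {H}) = [:- of_int d, 1:] * chi l H (restr A H) \<rbrakk>
         \<Longrightarrow> inductive_arr l X A"

text \<open>Simple roots are indexed 0..l-1 (alpha_{i+1} has index i). seg i j = alpha_{i+1}+...+alpha_j.\<close>
definition seg :: "nat \<Rightarrow> nat \<Rightarrow> lat" where
  "seg i j = (\<lambda>k. if i \<le> k \<and> k < j then 1 else 0)"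

datatype rtype = TA | TB | TC

text \<open>Positive roots (Bourbaki numbering; in B_l alpha_l is short, in C_l alpha_l is long).\<close>
fun pos_roots :: "rtype \<Rightarrow> nat \<Rightarrow> lat set" where
  "pos_roots TA l = {seg i j | i j. i < j \<and> j \<le> l}"
| "pos_roots TB l = {seg i j | i j. i < j \<and> j \<le> l}
                    \<union> {(\<lambda>k. seg i j k + 2 * seg j l k) | i j. i < j \<and> j < l}"
| "pos_roots TC l = {seg i j | i j. i < j \<and> j < l}
                    \<union> {(\<lambda>k. 2 * seg i (l - 1) k + seg (l - 1) l k) | i. i < l}
                    \<union> {(\<lambda>k. seg i j k + 2 * seg j (l - 1) k + seg (l - 1) l k) | i j. i < j \<and> j < l}"

text \<open>Positive roots when the simple roots are labelled via a permutation s of 0..l-1.\<close>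
definition pos_roots_lab :: "rtype \<Rightarrow> nat \<Rightarrow> (nat \<Rightarrow> nat) \<Rightarrow> lat set" where
  "pos_roots_lab T l s = (\<lambda>b. b \<circ> s) ` pos_roots T l"

definition root_le :: "lat \<Rightarrow> lat \<Rightarrow> bool" where
  "root_le b2 b1 \<longleftrightarrow> (\<forall>i. b2 i \<le> b1 i)"

definition is_ideal :: "lat set \<Rightarrow> lat set \<Rightarrow> bool" where
  "is_ideal P I \<longleftrightarrow> I \<subseteq> P \<and> (\<forall>b1\<in>I. \<forall>b2\<in>P. root_le b2 b1 \<longrightarrow> b2 \<in> I)"

definition toric_arr :: "nat \<Rightarrow> lat set \<Rightarrow> pt set set" where
  "toric_arr l I = (\<Union>b\<in>I. components (hyp l b 1))"

end

theory Submission
  imports Defs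
begin

text \<open>Every layer is a monomially embedded torus, so it contains \<open>q ^ d\<close> points with \<open>q\<close>-th roots of unity as
coordinates when \<open>q\<close> is divisible enough and \<open>d\<close> is its dimension. By Moebius inversion the characteristic polynomial
counts such points in the complement, hence obeys deletion-restriction.

In coordinates \<open>\<epsilon>\<^sub>i\<close>, numbered from the end of the Dynkin diagram, the last coordinate can be split off whenever its
hypertori are sections over the remaining torus that meet only over hypertori already present; each section adds one to
the corresponding exponent. Roots \<open>\<epsilon>\<^sub>i - \<epsilon>\<^sub>j\<close> alone always split off this way, and ideals of type A are ideals
of type B. The only obstruction in type B is that \<open>x\<close> and \<open>1/x\<close> also meet at \<open>x = -1\<close>. One then deletes the top
hypertorus \<open>x\<^sub>n x\<^sub>k = 1\<close>; restricting to it removes \<open>x\<^sub>n\<close> and adds the hypertorus \<open>x\<^sub>k = -1\<close>, which stays in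
the class of shifted graphs with some hypertori \<open>x\<^sub>i = -1\<close>. In type C the obstruction disappears, and restricting to the
hypertorus of \<open>2 \<epsilon>\<^sub>n\<close> gives the full arrangement \<open>x\<^sub>i = \<plusminus>1\<close>, \<open>x\<^sub>i = x\<^sub>j\<^bsup>\<plusminus>1\<^esup>\<close>.\<close>

section \<open>Monomial maps between tori\<close>

text \<open>An induction step needs the polynomial of the deletion to be a linear multiple of that
  of the restriction, so the exponents of two different arrangements must match. For this reason
  polynomials are carried along and given by an explicit recursion, \<open>sh_poly\<close>. The
  delicate match is in type B. Once enough edges at the last vertex are deleted, the deletion splits
  over a base with \<open>s\<close> hypertori \<open>x i = -1\<close>, while the restriction is a
  base with \<open>s + 1\<close> of them. The two agree up to linear factors because the vertices up
  to \<open>s\<close> are then adjacent to all others (\<open>sh_poly_identity\<close>). In type C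
  the hypertorus of \<open>2 \<epsilon>\<^sub>n\<close> meets each fibre over the remaining
  coordinates twice, so it is no section and is added last. Its restriction is a full arrangement
  because an ideal with this root contains every root on the vertices up to \<open>n\<close>.
  Coefficients of monomials are roots of unity: components of \<open>x ^ k = 1\<close> force such
  translates, and any other translate could miss all points of finite order, leaving nothing to
  count.\<close>

definition torsion :: "complex \<Rightarrow> bool" where
  "torsion c \<longleftrightarrow> (\<exists>N::nat. N > 0 \<and> c ^ N = 1)"

lemma torsion_1 [simp]: "torsion 1" by (auto simp: torsion_def intro: exI[of _ 1])
lemma torsion_minus_1 [simp]: "torsion (-1)" by (auto simp: torsion_def intro: exI[of _ 2])

lemma torsion_norm: "torsion c \<Longrightarrow> cmod c = 1"
  by (metis torsion_def norm_ge_zero norm_one norm_power power_eq_1_iff abs_of_nonneg less_irrefl real_norm_def)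

lemma torsion_nonzero: "torsion c \<Longrightarrow> c \<noteq> 0"
  using torsion_norm by fastforce

lemma torsion_mult: assumes "torsion c" "torsion d" shows "torsion (c * d)"
proof -
  obtain M N where "M > 0" "c ^ M = 1" "N > 0" "d ^ N = 1" using assms by (auto simp: torsion_def)
  then have "(c * d) ^ (M * N) = 1" by (simp add: power_mult_distrib power_mult) (metis mult.commute power_mult power_one)
  then show ?thesis using \<open>M > 0\<close> \<open>N > 0\<close> by (auto simp: torsion_def intro!: exI[of _ "M * N"])
qed

lemma torsion_inverse: "torsion c \<Longrightarrow> torsion (inverse c)"
  by (auto simp: torsion_def power_inverse)

lemma torsion_power: "torsion c \<Longrightarrow> torsion (c ^ k)"
  by (induction k) (auto intro: torsion_mult)

lemma torsion_powi: "torsion c \<Longrightarrow> torsion (c powi k)"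
  by (auto simp: power_int_def intro: torsion_power torsion_inverse)

lemma torsion_root: assumes "torsion c" "k > 0" "z ^ k = c" shows "torsion z"
proof -
  obtain N where "N > 0" "c ^ N = 1" using assms by (auto simp: torsion_def)
  then have "z ^ (k * N) = 1" using assms by (simp add: power_mult)
  then show ?thesis using \<open>N > 0\<close> \<open>k > 0\<close> by (auto simp: torsion_def intro!: exI[of _ "k * N"])
qed

lemma torus_norm: "t \<in> torus n \<Longrightarrow> cmod (t i) = 1"
  by (cases "i < n") (auto simp: torus_def)

lemma torus_nonzero: "t \<in> torus n \<Longrightarrow> t i \<noteq> 0"
  using torus_norm[of t n i] by auto

lemma torus_outside: "t \<in> torus n \<Longrightarrow> i \<ge> n \<Longrightarrow> t i = 1"
  by (auto simp: torus_def)

lemma torus_one [simp]: "(\<lambda>_. 1) \<in> torus n"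
  by (auto simp: torus_def)

lemma torus_ne [simp]: "torus n \<noteq> {}"
  using torus_one by blast

lemma torus_upd: "t \<in> torus n \<Longrightarrow> i < n \<Longrightarrow> cmod z = 1 \<Longrightarrow> t(i := z) \<in> torus n"
  by (auto simp: torus_def)

lemma torus_mono: "t \<in> torus m \<Longrightarrow> m \<le> n \<Longrightarrow> t \<in> torus n"
  by (auto simp: torus_def not_less) (metis norm_one not_less)

lemma chr_add: "t \<in> torus n \<Longrightarrow> chr n (\<lambda>i. a i + b i) t = chr n a t * chr n b t"
  by (simp add: chr_def power_int_add torus_nonzero prod.distrib)

lemma prod_powi: "finite A \<Longrightarrow> (\<Prod>i\<in>A. f i :: complex) powi k = (\<Prod>i\<in>A. f i powi k)"
  by (induction A rule: finite_induct) (auto simp: power_int_mult_distrib)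

lemma chr_scale: "chr n (\<lambda>i. k * a i) t = chr n a t powi k"
  by (simp add: chr_def prod_powi power_int_mult mult.commute[of k])

lemma chr_zero: "chr n (\<lambda>i. 0) t = 1"
  by (simp add: chr_def)

lemma chr_coord: "i < n \<Longrightarrow> chr n (\<lambda>j. if j = i then 1 else 0) t = t i"
  by (simp add: chr_def if_distrib[of "\<lambda>k. _ powi k"] prod.delta cong: if_cong)

lemma chr_norm: "t \<in> torus n \<Longrightarrow> cmod (chr n a t) = 1"
  by (simp add: chr_def prod_norm[symmetric] norm_power_int torus_norm)

text \<open>A monomial function has a root of unity as coefficient, so it maps torsion points to torsion points.\<close>

definition mon :: "nat \<Rightarrow> (pt \<Rightarrow> complex) \<Rightarrow> bool" where
  "mon n f \<longleftrightarrow> (\<exists>c a. torsion c \<and> in_lattice n a \<and> (\<forall>t\<in>torus n. f t = c * chr n a t))"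

lemma mon_cong: "mon n f \<Longrightarrow> (\<And>t. t \<in> torus n \<Longrightarrow> f t = g t) \<Longrightarrow> mon n g"
  unfolding mon_def by metis

lemma mon_const: "torsion c \<Longrightarrow> mon n (\<lambda>_. c)"
  unfolding mon_def by (intro exI[of _ c] exI[of _ "\<lambda>_. 0"]) (auto simp: chr_zero in_lattice_def)

lemma mon_1 [simp]: "mon n (\<lambda>_. 1)" and mon_minus_1 [simp]: "mon n (\<lambda>_. -1)"
  by (auto intro: mon_const)

lemma mon_mult: assumes "mon n f" "mon n g" shows "mon n (\<lambda>t. f t * g t)"
proof -
  obtain c a where 1: "torsion c" "in_lattice n a" "\<forall>t\<in>torus n. f t = c * chr n a t" using assms by (auto simp: mon_def)
  obtain d b where 2: "torsion d" "in_lattice n b" "\<forall>t\<in>torus n. g t = d * chr n b t" using assms by (auto simp: mon_def)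
  show ?thesis unfolding mon_def
    by (intro exI[of _ "c * d"] exI[of _ "\<lambda>i. a i + b i"])
      (use 1 2 in \<open>auto simp: chr_add in_lattice_def intro: torsion_mult\<close>)
qed

lemma mon_powi: assumes "mon n f" shows "mon n (\<lambda>t. f t powi k)"
proof -
  obtain c a where 1: "torsion c" "in_lattice n a" "\<forall>t\<in>torus n. f t = c * chr n a t" using assms by (auto simp: mon_def)
  show ?thesis unfolding mon_def
    by (intro exI[of _ "c powi k"] exI[of _ "\<lambda>i. k * a i"])
      (use 1 in \<open>auto simp: chr_scale in_lattice_def power_int_mult_distrib intro: torsion_powi\<close>)
qed

lemma mon_inverse: "mon n f \<Longrightarrow> mon n (\<lambda>t. inverse (f t))"
  using mon_powi[of n f "-1"] by simp

lemma mon_divide: "mon n f \<Longrightarrow> mon n g \<Longrightarrow> mon n (\<lambda>t. f t / g t)"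
  by (simp add: divide_inverse mon_mult mon_inverse)

lemma mon_coord: "mon n (\<lambda>t. t i)"
proof (cases "i < n")
  case True
  show ?thesis unfolding mon_def
    by (intro exI[of _ 1] exI[of _ "\<lambda>j. if j = i then 1 else 0"])
      (use True in \<open>auto simp: chr_coord in_lattice_def\<close>)
next
  case False
  show ?thesis by (rule mon_cong[OF mon_1]) (use False in \<open>auto simp: torus_outside\<close>)
qed

lemma mon_prod: "finite A \<Longrightarrow> (\<And>i. i \<in> A \<Longrightarrow> mon n (f i)) \<Longrightarrow> mon n (\<lambda>t. \<Prod>i\<in>A. f i t)"
  by (induction A rule: finite_induct) (auto intro: mon_mult)

lemma mon_norm: "mon n f \<Longrightarrow> t \<in> torus n \<Longrightarrow> cmod (f t) = 1"
  by (auto simp: mon_def norm_mult chr_norm torsion_norm)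

lemma chr_continuous: "continuous_on (torus n) (chr n a)"
  unfolding chr_def
  by (intro continuous_on_prod continuous_on_power_int continuous_on_subset[OF continuous_on_product_coordinates])
    (auto simp: torus_nonzero)

lemma mon_continuous: "mon n f \<Longrightarrow> continuous_on (torus n) f"
proof -
  assume "mon n f"
  then obtain c a where "\<forall>t\<in>torus n. f t = c * chr n a t" by (auto simp: mon_def)
  then show ?thesis using continuous_on_mult[OF continuous_on_const chr_continuous]
    by (subst continuous_on_cong[OF refl]) auto
qed

section \<open>Points whose coordinates are roots of unity\<close>

definition root_pts :: "nat \<Rightarrow> pt set" where
  "root_pts q = {t. \<forall>i. t i ^ q = 1}"

lemma powi_root: "(z::complex) ^ q = 1 \<Longrightarrow> (z powi k) ^ q = 1"
  by (metis mult.commute power_int_1_left power_int_mult power_int_of_nat)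

text \<open>A character preserves \<open>q\<close>-th roots of unity for every \<open>q\<close>;
  \<open>N\<close> only has to absorb the coefficient.\<close>

lemma mon_root_pts: assumes "mon n f"
  shows "\<exists>N>0. \<forall>q. N dvd q \<longrightarrow> (\<forall>t\<in>torus n \<inter> root_pts q. f t ^ q = 1)"
proof -
  obtain c a where 1: "torsion c" "\<forall>t\<in>torus n. f t = c * chr n a t" using assms by (auto simp: mon_def)
  obtain N where N: "N > 0" "c ^ N = 1" using 1 by (auto simp: torsion_def)
  have "chr n a t ^ q = 1" if "t \<in> root_pts q" for t q
    using that by (simp add: chr_def root_pts_def prod_power_distrib powi_root)
  moreover have "c ^ q = 1" if "N dvd q" for q using that N by (metis dvd_def power_mult power_one)
  ultimately show ?thesis using N 1 by (intro exI[of _ N]) (auto simp: power_mult_distrib)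
qed

definition mmap :: "nat \<Rightarrow> nat \<Rightarrow> (pt \<Rightarrow> pt) \<Rightarrow> bool" where
  "mmap n l g \<longleftrightarrow> (\<forall>t\<in>torus n. g t \<in> torus l) \<and> (\<forall>i. mon n (\<lambda>t. g t i))"

lemma mmapI:
  assumes "\<And>i. i < l \<Longrightarrow> mon n (\<lambda>t. g t i)" "\<And>t i. t \<in> torus n \<Longrightarrow> i \<ge> l \<Longrightarrow> g t i = 1"
  shows "mmap n l g"
proof -
  have "mon n (\<lambda>t. g t i)" for i
    by (cases "i < l") (use assms in \<open>auto intro: mon_cong[OF mon_1]\<close>)
  then show ?thesis using assms(2) mon_norm[of n "\<lambda>t. g t _"] by (auto simp: mmap_def torus_def[of l])
qed

lemma mmap_in: "mmap n l g \<Longrightarrow> t \<in> torus n \<Longrightarrow> g t \<in> torus l"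
  by (auto simp: mmap_def)

lemma mmap_mon: "mmap n l g \<Longrightarrow> mon n (\<lambda>t. g t i)"
  by (auto simp: mmap_def)

lemma mon_comp: assumes "mmap n l g" "mon l f" shows "mon n (\<lambda>t. f (g t))"
proof -
  obtain c a where 1: "torsion c" "\<forall>t\<in>torus l. f t = c * chr l a t" using assms by (auto simp: mon_def)
  have "mon n (\<lambda>t. c * (\<Prod>i<l. g t i powi a i))"
    by (intro mon_mult mon_const mon_prod mon_powi mmap_mon[OF assms(1)] 1) auto
  then show ?thesis by (rule mon_cong) (use 1 assms in \<open>auto simp: chr_def mmap_in\<close>)
qed

lemma mmap_comp: "mmap n m g \<Longrightarrow> mmap m l f \<Longrightarrow> mmap n l (f \<circ> g)"
  using mon_comp[of n m g "\<lambda>t. f t _"] by (auto simp: mmap_def)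

lemma mmap_continuous: "mmap n l g \<Longrightarrow> continuous_on (torus n) g"
  by (rule continuous_on_coordinatewise_then_product) (rule mon_continuous, rule mmap_mon)

lemma mmap_root_pts: assumes "mmap n l g"
  shows "\<exists>N>0. \<forall>q. N dvd q \<longrightarrow> (\<forall>t\<in>torus n \<inter> root_pts q. g t \<in> root_pts q)"
proof -
  have "\<forall>i. \<exists>N>0. \<forall>q. N dvd q \<longrightarrow> (\<forall>t\<in>torus n \<inter> root_pts q. g t i ^ q = 1)"
    using mon_root_pts[OF mmap_mon[OF assms]] by auto
  then obtain N where N: "\<And>i. N i > 0" "\<And>i q t. N i dvd q \<Longrightarrow> t\<in>torus n \<inter> root_pts q \<Longrightarrow> g t i ^ q = 1"
    by metis
  show ?thesis
  proof (intro exI[of _ "\<Prod>i<l. N i"] conjI allI impI ballI)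
    show "0 < (\<Prod>i<l. N i)" using N by (simp add: prod_pos)
    fix q t assume *: "(\<Prod>i<l. N i) dvd q" "t \<in> torus n \<inter> root_pts q"
    have "g t i ^ q = 1" for i
    proof (cases "i < l")
      case True
      then have "N i dvd q" using *(1) by (meson dvd_prodI dvd_trans finite_lessThan lessThan_iff)
      then show ?thesis using N * by auto
    next
      case False then show ?thesis using mmap_in[OF assms] *(2) torus_outside[of "g t" l i] by simp
    qed
    then show "g t \<in> root_pts q" by (simp add: root_pts_def)
  qed
qed

text \<open>The left inverse is demanded to be monomial as well, so that the embedding splits
  algebraically. Injectivity, equations for the image, its dimension and its point count all come
  from this inverse.\<close>

definition emb :: "nat \<Rightarrow> nat \<Rightarrow> (pt \<Rightarrow> pt) \<Rightarrow> bool" where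
  "emb n l \<phi> \<longleftrightarrow> mmap n l \<phi> \<and> (\<exists>\<psi>. mmap l n \<psi> \<and> (\<forall>t\<in>torus n. \<psi> (\<phi> t) = t))"

lemma embI: "mmap n l \<phi> \<Longrightarrow> mmap l n \<psi> \<Longrightarrow> (\<And>t. t \<in> torus n \<Longrightarrow> \<psi> (\<phi> t) = t) \<Longrightarrow> emb n l \<phi>"
  by (auto simp: emb_def)

lemma emb_comp: assumes "emb n m g" "emb m l f" shows "emb n l (f \<circ> g)"
proof -
  obtain g' f' where "mmap m n g'" "\<forall>t\<in>torus n. g' (g t) = t" "mmap l m f'" "\<forall>t\<in>torus m. f' (f t) = t"
    using assms by (auto simp: emb_def)
  then show ?thesis using assms
    by (intro embI[where \<psi> = "g' \<circ> f'"] mmap_comp[of n m] mmap_comp[of l m]) (auto simp: emb_def mmap_in)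
qed

lemma mmap_id: "mmap n n (\<lambda>t. t)"
  by (auto simp: mmap_def mon_coord)

lemma emb_id: "emb n n (\<lambda>t. t)"
  by (rule embI[OF mmap_id mmap_id]) auto

lemma emb_mmap: "emb n l \<phi> \<Longrightarrow> mmap n l \<phi>" by (simp add: emb_def)

lemma emb_in: "emb n l \<phi> \<Longrightarrow> t \<in> torus n \<Longrightarrow> \<phi> t \<in> torus l"
  using mmap_in emb_mmap by blast

lemma emb_inj: "emb n l \<phi> \<Longrightarrow> inj_on \<phi> (torus n)"
  unfolding emb_def by (metis inj_on_inverseI)

text \<open>These are the translates of subtori by points of finite order, the shape of every layer
  that occurs.\<close>

definition tor :: "nat \<Rightarrow> pt set \<Rightarrow> bool" where
  "tor l Y \<longleftrightarrow> (\<exists>d \<phi>. emb d l \<phi> \<and> Y = \<phi> ` torus d)"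

lemma tor_image: "emb n l \<phi> \<Longrightarrow> tor n Y \<Longrightarrow> tor l (\<phi> ` Y)"
  unfolding tor_def using emb_comp by (metis image_comp)

lemma emb_tor: "emb n l \<phi> \<Longrightarrow> tor l (\<phi> ` torus n)"
  unfolding tor_def by blast

lemma tor_torus: "tor n (torus n)"
  using emb_tor[OF emb_id[of n]] by simp

lemma tor_ne: "tor n Y \<Longrightarrow> Y \<noteq> {}" unfolding tor_def by auto
lemma tor_sub: "tor n Y \<Longrightarrow> Y \<subseteq> torus n" unfolding tor_def using emb_in by blast

section \<open>Topology of torus cosets\<close>

lemma torus_connected: "connected (torus n)"
proof -
  have "path_component (torus n) (\<lambda>_. 1) t" if t: "t \<in> torus n" for t
  proof -
    \<comment> \<open>Scaling all arguments by \<open>s\<close> joins the identity to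
      \<open>t\<close>.\<close>
    define g where "g = (\<lambda>s::real. \<lambda>i. cis (s * Arg (t i)))"
    have "path g" unfolding path_def g_def
      by (intro continuous_on_coordinatewise_then_product continuous_intros)
    moreover have "g s \<in> torus n" for s
      using t by (auto simp: torus_def g_def)
    moreover have "g 0 = (\<lambda>_. 1)" by (simp add: g_def)
    moreover have "g 1 = t"
    proof
      fix i show "g 1 i = t i" using torus_norm[OF t, of i] torus_nonzero[OF t, of i]
        by (simp add: g_def cis_Arg sgn_div_norm)
    qed
    ultimately show ?thesis unfolding path_component_def
      by (intro exI[of _ g]) (auto simp: path_image_def pathstart_def pathfinish_def)
  qed
  then have "path_connected (torus n)"
    unfolding path_connected_component by (meson path_component_sym path_component_trans)
  then show ?thesis by (rule path_connected_imp_connected)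
qed

lemma tor_connected: "tor l Y \<Longrightarrow> connected Y"
  unfolding tor_def using connected_continuous_image[OF mmap_continuous torus_connected] emb_mmap by blast

text \<open>\<open>\<phi> \<circ> \<psi>\<close> is a retraction onto the image, so the image is cut
  out by monomial equations. Both closedness and the computation of intersections rest on
  this.\<close>

lemma tor_fix: assumes "emb d l \<phi>" "mmap l d \<psi>" "\<forall>t\<in>torus d. \<psi> (\<phi> t) = t"
  shows "\<phi> ` torus d = {t \<in> torus l. \<phi> (\<psi> t) = t}"
proof -
  have "t \<in> \<phi> ` torus d" if "t \<in> torus l" "\<phi> (\<psi> t) = t" for t
    using that mmap_in[OF assms(2)] by (metis image_eqI)
  then show ?thesis using assms emb_in by auto
qed

lemma torus_closed: "closed (torus n)"
proof -
  have "torus n = (\<Inter>i\<in>{..<n}. {t. cmod (t i) = 1}) \<inter> (\<Inter>i\<in>{n..}. {t. t i = 1})"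
    by (auto simp: torus_def)
  moreover have "closed {t::pt. cmod (t i) = 1}" for i
    by (intro closed_Collect_eq continuous_intros continuous_on_product_coordinates)
  moreover have "closed {t::pt. t i = 1}" for i
    by (intro closed_Collect_eq continuous_intros continuous_on_product_coordinates)
  ultimately show ?thesis by (auto intro!: closed_Int closed_INT)
qed

lemma tor_closed: assumes "tor l Y" shows "closed Y"
proof -
  obtain d \<phi> where 1: "emb d l \<phi>" "Y = \<phi> ` torus d" using assms by (auto simp: tor_def)
  obtain \<psi> where 2: "mmap l d \<psi>" "\<forall>t\<in>torus d. \<psi> (\<phi> t) = t" using 1 by (auto simp: emb_def)
  have c: "continuous_on (torus l) (\<lambda>t. (\<phi> \<circ> \<psi>) t i)" for i
    by (rule mon_continuous[OF mmap_mon[OF mmap_comp[OF 2(1) emb_mmap[OF 1(1)]]]])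
  have "Y = (\<Inter>i. {t \<in> torus l. (\<phi> \<circ> \<psi>) t i = t i})"
    using tor_fix[OF 1(1) 2] 1(2) by (auto simp: fun_eq_iff)
  moreover have "closed {t \<in> torus l. (\<phi> \<circ> \<psi>) t i = t i}" for i
  proof -
    have "closed {t \<in> torus l. (\<phi> \<circ> \<psi>) t i - t i = 0}"
      by (rule continuous_closed_preimage_constant[OF _ torus_closed])
        (intro continuous_intros c continuous_on_subset[OF continuous_on_product_coordinates] subset_UNIV)
    then show ?thesis by simp
  qed
  ultimately show ?thesis by auto
qed

text \<open>By finiteness the union of the remaining pieces is closed too, so a connected set that
  meets one piece cannot reach another.\<close>

lemma components_disjoint_Union:
  fixes F :: "'a::topological_space set set"
  assumes "finite F" "disjoint F" "\<And>C. C \<in> F \<Longrightarrow> closed C \<and> connected C \<and> C \<noteq> {}"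
  shows "components (\<Union>F) = F"
proof -
  have *: "connected_component_set (\<Union>F) x = C" if C: "C \<in> F" "x \<in> C" for C x
  proof
    show "C \<subseteq> connected_component_set (\<Union>F) x"
      using C assms by (intro connected_component_maximal) auto
    let ?Z = "connected_component_set (\<Union>F) x"
    have Z: "?Z \<subseteq> \<Union>F" by (rule connected_component_subset)
    have 1: "closed C" "closed (\<Union>(F - {C}))" using assms C by auto
    have 2: "C \<inter> \<Union>(F - {C}) = {}" using assms(2) C by (auto simp: disjoint_def)
    have "?Z \<inter> \<Union>(F - {C}) = {}"
    proof (rule ccontr)
      assume "?Z \<inter> \<Union>(F - {C}) \<noteq> {}"
      moreover have "x \<in> C \<inter> ?Z" using C by auto
      ultimately show False
        using connected_closedD[OF connected_connected_component, of C "\<Union>(F - {C})" "\<Union>F" x] 1 2 Z by blast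
    qed
    then show "?Z \<subseteq> C" using Z by blast
  qed
  show ?thesis
  proof
    show "components (\<Union>F) \<subseteq> F" using * by (auto simp: components_def)
    show "F \<subseteq> components (\<Union>F)"
    proof
      fix C assume C: "C \<in> F"
      then obtain x where "x \<in> C" using assms(3) by blast
      then show "C \<in> components (\<Union>F)" using *[OF C] C by (auto simp: components_def)
    qed
  qed
qed

lemma components_disjoint_torsion:
  "finite F \<Longrightarrow> disjoint F \<Longrightarrow> (\<And>C. C \<in> F \<Longrightarrow> tor n C) \<Longrightarrow> components (\<Union>F) = F"
  by (rule components_disjoint_Union) (auto intro: tor_closed tor_connected dest: tor_ne)

lemma components_tor: "tor n C \<Longrightarrow> components C = {C}"
  using components_disjoint_torsion[of "{C}" n] by (simp add: disjoint_def)

section \<open>Dimension of an embedded torus\<close>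

text \<open>More vectors than coordinates are dependent. This is Gaussian elimination without
  fractions: a pivot \<open>p\<close> clears the coordinate \<open>x\<close>, multiplying by
  \<open>v p x\<close> instead of dividing by it.\<close>

lemma int_relation:
  fixes v :: "'a \<Rightarrow> 'c \<Rightarrow> int"
  assumes "finite C" "finite F" "card C < card F"
  shows "\<exists>c. (\<exists>f\<in>F. c f \<noteq> 0) \<and> (\<forall>i\<in>C. (\<Sum>f\<in>F. c f * v f i) = 0)"
  using assms
proof (induction C arbitrary: F v rule: finite_induct)
  case empty
  then have "F \<noteq> {}" by auto
  then show ?case by (intro exI[of _ "\<lambda>_. 1"]) auto
next
  case (insert x C)
  show ?case
  proof (cases "\<forall>f\<in>F. v f x = 0")
    case True
    have "card C < card F" using insert by simp
    from insert.IH[OF insert.prems(1) this, of v] True show ?thesis by auto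
  next
    case False
    then obtain p where p: "p \<in> F" "v p x \<noteq> 0" by auto
    define w where "w f i = v p x * v f i - v f x * v p i" for f i
    have "card C < card (F - {p})" using insert p by (simp add: card_Diff_singleton)
    from insert.IH[OF _ this, of w] insert.prems obtain c where
      c: "\<exists>f\<in>F - {p}. c f \<noteq> 0" "\<forall>i\<in>C. (\<Sum>f\<in>F - {p}. c f * w f i) = 0" by auto
    define c' where "c' f = (if f = p then - (\<Sum>f\<in>F - {p}. c f * v f x) else v p x * c f)" for f
    have eq: "(\<Sum>f\<in>F. c' f * v f i) = (\<Sum>f\<in>F - {p}. c f * w f i)" for i
    proof -
      have "(\<Sum>f\<in>F. c' f * v f i) = c' p * v p i + (\<Sum>f\<in>F - {p}. c' f * v f i)"
        using insert.prems p by (simp add: sum.remove)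
      also have "(\<Sum>f\<in>F - {p}. c' f * v f i) = (\<Sum>f\<in>F - {p}. v p x * c f * v f i)"
        by (rule sum.cong) (auto simp: c'_def)
      also have "c' p * v p i + (\<Sum>f\<in>F - {p}. v p x * c f * v f i) = (\<Sum>f\<in>F - {p}. c f * w f i)"
        by (simp add: c'_def w_def sum_distrib_left sum_subtractf algebra_simps)
      finally show ?thesis .
    qed
    have "(\<Sum>f\<in>F. c' f * v f x) = 0" unfolding eq by (simp add: w_def mult.commute)
    moreover have "\<exists>f\<in>F. c' f \<noteq> 0" using c(1) p by (auto simp: c'_def)
    ultimately show ?thesis using c(2) eq by (intro exI[of _ c']) auto
  qed
qed

lemma chr_unique:
  assumes "in_lattice n a" "in_lattice n b" "\<And>t. t \<in> torus n \<Longrightarrow> chr n a t = c * chr n b t"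
  shows "a = b"
proof
  fix i
  have c: "c = 1" using assms(3)[OF torus_one] by (simp add: chr_def)
  show "a i = b i"
  proof (cases "i < n")
    case True
    define k where "k = a i - b i"
    \<comment> \<open>Chosen so that \<open>w powi k = -1\<close> whenever
      \<open>k \<noteq> 0\<close>; for \<open>k = 0\<close> the quotient is 0 by convention and
      \<open>w = 1\<close>.\<close>
    define w where "w = cis (pi / of_int k)"
    have w0: "w \<noteq> 0" by (simp add: w_def)
    define t :: pt where "t = (\<lambda>_. 1)(i := w)"
    have t: "t \<in> torus n" unfolding t_def by (rule torus_upd) (use True in \<open>auto simp: w_def\<close>)
    have e: "chr n a t = w powi a i" for a
    proof -
      have "chr n a t = (\<Prod>j<n. if j = i then w powi a i else 1)"
        unfolding chr_def by (rule prod.cong) (auto simp: t_def)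
      then show ?thesis using True by simp
    qed
    have "w powi a i = w powi b i"
      using assms(3)[OF t] c by (simp add: e)
    moreover have "w powi a i = w powi k * w powi b i"
      using w0 power_int_add[of w k "b i"] by (simp add: k_def)
    ultimately have 1: "w powi k = 1" using w0 by simp
    have "k = 0"
    proof (rule ccontr)
      assume "k \<noteq> 0"
      then have "w powi k = -1" by (simp add: cis_power_int w_def)
      then show False using 1 by simp
    qed
    then show ?thesis by (simp add: k_def)
  qed (use assms in \<open>auto simp: in_lattice_def\<close>)
qed

lemma chr_sum: "finite A \<Longrightarrow> t \<in> torus n \<Longrightarrow> chr n (\<lambda>j. \<Sum>i\<in>A. f i j) t = (\<Prod>i\<in>A. chr n (f i) t)"
  by (induction A rule: finite_induct) (auto simp: chr_zero chr_add)

lemma chr_pull: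
  assumes "t \<in> torus d" "\<And>i. i < l \<Longrightarrow> \<phi> t i = z i * chr d (M i) t"
  shows "chr l a (\<phi> t) = (\<Prod>i<l. z i powi a i) * chr d (\<lambda>j. \<Sum>i<l. a i * M i j) t"
  using assms by (simp add: chr_def[of l] chr_sum chr_scale power_int_mult_distrib prod.distrib)

text \<open>The characters constant on the image form the kernel of \<open>pull\<close>, which
  restricts exponents along \<open>\<phi>\<close> to \<open>torus d\<close>. The exponents
  \<open>N j\<close> of the left inverse are preimages of the unit vectors under
  \<open>pull\<close>, so the kernel has rank \<open>l - d\<close>.\<close>

lemma tdim_emb: assumes "emb d l \<phi>" shows "tdim l (\<phi> ` torus d) = d"
proof -
  obtain \<psi> where \<psi>: "mmap l d \<psi>" "\<And>t. t\<in>torus d \<Longrightarrow> \<psi> (\<phi> t) = t" using assms by (auto simp: emb_def)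
  have "\<forall>i. \<exists>z m. torsion z \<and> in_lattice d m \<and> (\<forall>t\<in>torus d. \<phi> t i = z * chr d m t)"
    using mmap_mon[OF emb_mmap[OF assms]] unfolding mon_def by blast
  then obtain z M where M: "\<And>i. torsion (z i)" "\<And>i. in_lattice d (M i)"
    "\<And>i t. t \<in> torus d \<Longrightarrow> \<phi> t i = z i * chr d (M i) t" by metis
  have "\<forall>j. \<exists>z m. torsion z \<and> in_lattice l m \<and> (\<forall>t\<in>torus l. \<psi> t j = z * chr l m t)"
    using mmap_mon[OF \<psi>(1)] unfolding mon_def by blast
  then obtain w N where N: "\<And>j. torsion (w j)" "\<And>j. in_lattice l (N j)"
    "\<And>j t. t \<in> torus l \<Longrightarrow> \<psi> t j = w j * chr l (N j) t" by metis
  define pull where "pull a = (\<lambda>j. \<Sum>i<l. a i * M i j)" for a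
  define Z where "Z a = (\<Prod>i<l. z i powi a i)" for a
  have chrp: "chr l a (\<phi> t) = Z a * chr d (pull a) t" if "t \<in> torus d" for a t
    unfolding Z_def pull_def by (rule chr_pull) (use that M in auto)
  have Z0: "Z a \<noteq> 0" for a unfolding Z_def using M(1) torsion_nonzero by (simp add: power_int_eq_0_iff)
  have pl: "in_lattice d (pull a)" for a using M(2) by (simp add: in_lattice_def pull_def)
  \<comment> \<open>The identity \<open>\<psi> (\<phi> t) = t\<close> read on exponents.\<close>
  have NM: "pull (N j) k = (if k = j then 1 else 0)" if "j < d" for j k
  proof -
    have "(\<lambda>k. if k = j then 1 else 0) = pull (N j)"
    proof (rule chr_unique)
      fix t assume t: "t \<in> torus d"
      have "t j = w j * chr l (N j) (\<phi> t)" using \<psi>(2)[OF t] N(3)[OF emb_in[OF assms t], of j] by simp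
      then show "chr d (\<lambda>k. if k = j then 1 else 0) t = (w j * Z (N j)) * chr d (pull (N j)) t"
        using that by (simp add: chr_coord chrp[OF t])
    qed (use that pl in \<open>auto simp: in_lattice_def\<close>)
    from fun_cong[OF this, of k] show ?thesis by simp
  qed
  define Lam where "Lam = {a. in_lattice l a \<and> (\<forall>s\<in>\<phi> ` torus d. \<forall>t\<in>\<phi> ` torus d. chr l a s = chr l a t)}"
  have \<Lambda>: "a \<in> Lam \<longleftrightarrow> in_lattice l a \<and> pull a = (\<lambda>_. 0)" for a
  proof
    assume a: "a \<in> Lam"
    note a = a[unfolded Lam_def]
    have "pull a = (\<lambda>_. 0)"
    proof (rule chr_unique[OF pl, where c = 1])
      fix t assume t: "t \<in> torus d"
      have "chr l a (\<phi> t) = chr l a (\<phi> (\<lambda>_. 1))" using a t torus_one by blast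
      then have "chr d (pull a) t = chr d (pull a) (\<lambda>_. 1)" using t Z0 by (simp add: chrp)
      then show "chr d (pull a) t = 1 * chr d (\<lambda>_. 0) t" by (simp add: chr_def)
    qed (auto simp: in_lattice_def)
    then show "in_lattice l a \<and> pull a = (\<lambda>_. 0)" using a by blast
  next
    assume "in_lattice l a \<and> pull a = (\<lambda>_. 0)"
    moreover from this have "chr l a (\<phi> t) = Z a" if "t \<in> torus d" for t using chrp[OF that] by (simp add: chr_zero)
    ultimately show "a \<in> Lam" by (simp add: Lam_def image_iff)
  qed
  have upper: "card F + d \<le> l" if F: "F \<subseteq> Lam" "finite F" "int_indep F" for F
  proof (rule ccontr)
    assume "\<not> ?thesis"
    then have "card {..<l} < card (F <+> {..<d})" using F by (simp add: card_Plus)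
    from int_relation[OF _ _ this, of "case_sum (\<lambda>f. f) N"] F(2) obtain c where
      c: "\<exists>x\<in>F <+> {..<d}. c x \<noteq> 0"
        "\<forall>i<l. (\<Sum>x\<in>F <+> {..<d}. c x * case_sum (\<lambda>f. f) N x i) = 0" by auto
    have FL: "\<forall>f\<in>F. in_lattice l f \<and> pull f = (\<lambda>_. 0)" using F(1) \<Lambda> by blast
    have eq: "(\<Sum>f\<in>F. c (Inl f) * f i) + (\<Sum>j<d. c (Inr j) * N j i) = 0" if "i < l" for i
      using c(2) that F by (simp add: sum.Plus)
    \<comment> \<open>Applying \<open>pull\<close> to the relation kills the members of
      \<open>F\<close> and isolates the coefficient of \<open>N k\<close>.\<close>
    have r0: "c (Inr k) = 0" if "k < d" for k
    proof -
      have "0 = (\<Sum>i<l. ((\<Sum>f\<in>F. c (Inl f) * f i) + (\<Sum>j<d. c (Inr j) * N j i)) * M i k)"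
        using eq by simp
      also have "\<dots> = (\<Sum>i<l. \<Sum>f\<in>F. c (Inl f) * (f i * M i k)) + (\<Sum>i<l. \<Sum>j<d. c (Inr j) * (N j i * M i k))"
        by (simp add: sum.distrib distrib_right sum_distrib_right mult.assoc)
      also have "(\<Sum>i<l. \<Sum>f\<in>F. c (Inl f) * (f i * M i k)) = (\<Sum>f\<in>F. c (Inl f) * pull f k)"
        by (subst sum.swap) (simp add: pull_def sum_distrib_left)
      also have "(\<Sum>i<l. \<Sum>j<d. c (Inr j) * (N j i * M i k)) = (\<Sum>j<d. c (Inr j) * pull (N j) k)"
        by (subst sum.swap) (simp add: pull_def sum_distrib_left)
      also have "(\<Sum>f\<in>F. c (Inl f) * pull f k) = 0"
        using FL by (intro sum.neutral) auto
      also have "(\<Sum>j<d. c (Inr j) * pull (N j) k) = (\<Sum>j<d. if j = k then c (Inr k) else 0)"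
        by (rule sum.cong) (auto simp: NM)
      finally show ?thesis using that by simp
    qed
    have "(\<Sum>f\<in>F. c (Inl f) * f i) = 0" for i
    proof (cases "i < l")
      case True then show ?thesis using eq[OF True] r0 by simp
    next
      case False then show ?thesis using FL by (intro sum.neutral) (auto simp: in_lattice_def)
    qed
    then have "\<forall>f\<in>F. c (Inl f) = 0" using F(3)[unfolded int_indep_def, rule_format, of "\<lambda>f. c (Inl f)"] by auto
    then show False using c(1) r0 by auto
  qed
  let ?S = "{card F | F. F \<subseteq> Lam \<and> finite F \<and> int_indep F}"
  have S: "finite ?S"
  proof (rule finite_subset)
    show "?S \<subseteq> {..l}"
    proof
      fix x assume "x \<in> ?S"
      then obtain F where "x = card F" "F \<subseteq> Lam" "finite F" "int_indep F" by blast
      then show "x \<in> {..l}" using upper[of F] by simp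
    qed
  qed simp
  have "0 \<in> ?S" by (auto intro!: exI[of _ "{}"] simp: int_indep_def)
  then have "Max ?S \<in> ?S" using S Max_in by blast
  then obtain F where F: "F \<subseteq> Lam" "finite F" "int_indep F" "card F = Max ?S" by auto
  have "l \<le> card F + d"
  proof (rule ccontr)
    assume "\<not> ?thesis"
    then have lt: "card F + d < l" by simp
    \<comment> \<open>The projection of the \<open>i\<close>-th unit vector to the kernel along the
      \<open>N j\<close>.\<close>
    define u where "u i = (\<lambda>k. (if k = i then 1 else 0) - (\<Sum>j<d. M i j * N j k))" for i
    have "u i \<in> Lam" if "i < l" for i
    proof -
      have "in_lattice l (u i)" using N(2) that by (auto simp: in_lattice_def u_def)
      moreover have "pull (u i) k = 0" for k
      proof -
        have "pull (u i) k = (\<Sum>x<l. (if x = i then M x k else 0)) - (\<Sum>x<l. \<Sum>j<d. M i j * (N j x * M x k))"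
          by (simp add: pull_def u_def left_diff_distrib sum_subtractf sum_distrib_right mult.assoc if_distrib[of "\<lambda>y. y * _"] cong: if_cong)
        also have "(\<Sum>x<l. \<Sum>j<d. M i j * (N j x * M x k)) = (\<Sum>j<d. M i j * pull (N j) k)"
          by (subst sum.swap) (simp add: pull_def sum_distrib_left)
        also have "\<dots> = (\<Sum>j<d. if j = k then M i k else 0)"
          by (rule sum.cong) (auto simp: NM)
        finally show ?thesis using that M(2)[of i] by (auto simp: in_lattice_def)
      qed
      ultimately show ?thesis using \<Lambda> by blast
    qed
    note u = this
    \<comment> \<open>Since \<open>F\<close> is independent of maximal size in the kernel, some
      nonzero multiple of each \<open>u i\<close> is an integer combination of
      \<open>F\<close>.\<close>
    have "\<exists>k c. k \<noteq> 0 \<and> (\<forall>x. k * u i x = (\<Sum>f\<in>F. c f * f x))" if i: "i < l" for i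
    proof (cases "u i \<in> F")
      case True
      have "(\<Sum>f\<in>F. (if f = u i then 1 else 0) * f x) = u i x" for x
        using True F(2) by (simp add: if_distrib[of "\<lambda>y. y * _"] cong: if_cong)
      then show ?thesis by (intro exI[of _ 1] exI[of _ "\<lambda>f. if f = u i then 1 else 0"]) simp
    next
      case False
      have "\<not> int_indep (insert (u i) F)"
      proof
        assume "int_indep (insert (u i) F)"
        then have "card (insert (u i) F) \<in> ?S" using F u[OF i] by blast
        then have "card (insert (u i) F) \<le> Max ?S" using S Max_ge by blast
        then show False using False F by simp
      qed
      then obtain c where c: "\<forall>x. (\<Sum>v\<in>insert (u i) F. c v * v x) = 0" "\<exists>v\<in>insert (u i) F. c v \<noteq> 0"
        by (auto simp: int_indep_def)
      have 1: "c (u i) * u i x + (\<Sum>f\<in>F. c f * f x) = 0" for x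
        using c(1) False F(2) by simp
      have "c (u i) \<noteq> 0"
      proof
        assume "c (u i) = 0"
        then have "\<forall>x. (\<Sum>f\<in>F. c f * f x) = 0" using 1 by simp
        then have "\<forall>f\<in>F. c f = 0" using F(3)[unfolded int_indep_def] by blast
        then show False using c(2) \<open>c (u i) = 0\<close> by auto
      qed
      moreover have "c (u i) * u i x = (\<Sum>f\<in>F. (- c f) * f x)" for x
        using 1[of x] by (simp add: sum_negf)
      ultimately show ?thesis by (intro exI[of _ "c (u i)"] exI[of _ "\<lambda>f. - c f"]) auto
    qed
    then obtain k c where k: "\<And>i. i < l \<Longrightarrow> k i \<noteq> 0"
      and kc: "\<And>i x. i < l \<Longrightarrow> k i * u i x = (\<Sum>f\<in>F. c i f * f x)" by metis
    have "card (F <+> {..<d}) < card {..<l}" using lt F(2) by (simp add: card_Plus)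
    \<comment> \<open>The columns record the coordinates of \<open>k i * u i\<close> in
      \<open>F\<close> and its defect on the \<open>N j\<close>. Together they determine
      \<open>k i\<close> times the \<open>i\<close>-th unit vector, so a relation among them would
      be one among the unit vectors.\<close>
    from int_relation[OF _ _ this, of "\<lambda>i. case_sum (c i) (\<lambda>j. k i * M i j)"] F(2)
    obtain b where b: "\<exists>i<l. b i \<noteq> 0"
      "\<forall>x\<in>F <+> {..<d}. (\<Sum>i<l. b i * case_sum (c i) (\<lambda>j. k i * M i j) x) = 0" by auto
    have b1: "(\<Sum>i<l. b i * c i f) = 0" if "f \<in> F" for f using b(2)[rule_format, of "Inl f"] that by auto
    have b2: "(\<Sum>i<l. b i * (k i * M i j)) = 0" if "j < d" for j using b(2)[rule_format, of "Inr j"] that by auto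
    have "b x = 0" if x: "x < l" for x
    proof -
      have "(\<Sum>i<l. b i * (k i * u i x)) = (\<Sum>i<l. \<Sum>f\<in>F. b i * c i f * f x)"
        by (rule sum.cong) (auto simp: kc sum_distrib_left mult.assoc)
      also have "\<dots> = (\<Sum>f\<in>F. (\<Sum>i<l. b i * c i f) * f x)"
        by (subst sum.swap) (simp add: sum_distrib_right)
      also have "\<dots> = 0" using b1 by simp
      finally have A: "(\<Sum>i<l. b i * (k i * u i x)) = 0" .
      have "(\<Sum>i<l. b i * (k i * (\<Sum>j<d. M i j * N j x))) = (\<Sum>i<l. \<Sum>j<d. b i * (k i * M i j) * N j x)"
        by (simp add: sum_distrib_left mult.assoc)
      also have "\<dots> = (\<Sum>j<d. (\<Sum>i<l. b i * (k i * M i j)) * N j x)"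
        by (subst sum.swap) (simp add: sum_distrib_right)
      also have "\<dots> = 0" using b2 by simp
      finally have B: "(\<Sum>i<l. b i * (k i * (\<Sum>j<d. M i j * N j x))) = 0" .
      have "0 = (\<Sum>i<l. b i * (k i * (u i x + (\<Sum>j<d. M i j * N j x))))"
        using A B by (simp add: distrib_left sum.distrib)
      also have "\<dots> = (\<Sum>i<l. if i = x then b x * k x else 0)"
        by (rule sum.cong) (auto simp: u_def)
      also have "\<dots> = b x * k x" using x by simp
      finally show ?thesis using k[OF x] by simp
    qed
    then show False using b(1) by blast
  qed
  then have "Max ?S = l - d" "d \<le> l" using upper[OF F(1-3)] F(4) by auto
  then show ?thesis by (simp add: tdim_def lrank_def Lam_def)
qed

section \<open>Intersections of embedded tori\<close>

lemma mmap_reindex: assumes "\<And>j. j \<ge> n \<Longrightarrow> \<tau> j \<ge> m" shows "mmap m n (\<lambda>u. u \<circ> \<tau>)"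
  by (rule mmapI) (use assms in \<open>auto simp: mon_coord torus_outside\<close>)

text \<open>The other coordinates parametrise this set; exchanging \<open>i\<close> with the last
  index turns them into a point of a torus of one dimension less.\<close>

lemma tor_solve:
  assumes i: "i < n" and f: "mon n f"
    and ind: "\<And>x z. x \<in> torus n \<Longrightarrow> cmod z = 1 \<Longrightarrow> f (x(i := z)) = f x"
  shows "tor n {x \<in> torus n. x i = f x}"
proof -
  obtain m where n: "n = Suc m" using i by (cases n) auto
  define \<tau> where "\<tau> = Transposition.transpose i m"
  have \<tau>\<tau>: "\<tau> (\<tau> j) = j" for j by (simp add: \<tau>_def)
  have \<tau>i: "\<tau> j = i \<longleftrightarrow> j = m" for j unfolding \<tau>_def by (auto simp: transpose_eq_iff)
  have \<tau>o: "\<tau> j = j" if "j \<ge> n" for j unfolding \<tau>_def using i n that by (auto simp: transpose_def)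
  define \<phi> where "\<phi> u = (u \<circ> \<tau>)(i := f (u \<circ> \<tau>))" for u
  define \<psi> where "\<psi> x = (x(i := 1)) \<circ> \<tau>" for x :: pt
  have r: "mmap m n (\<lambda>u. u \<circ> \<tau>)" by (rule mmap_reindex) (use \<tau>o n in auto)
  have 1: "mmap m n \<phi>"
  proof (rule mmapI)
    fix j show "mon m (\<lambda>t. \<phi> t j)"
      using mon_comp[OF r f] mon_coord by (cases "j = i") (auto simp: \<phi>_def)
  next
    fix t j assume "t \<in> torus m" "n \<le> j"
    then show "\<phi> t j = 1" using i n by (auto simp: \<phi>_def \<tau>o torus_outside)
  qed
  have 2: "mmap n m \<psi>"
  proof (rule mmapI)
    fix j show "mon n (\<lambda>t. \<psi> t j)" by (cases "\<tau> j = i") (auto simp: \<psi>_def mon_coord)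
  next
    fix t j assume "t \<in> torus n" "m \<le> j"
    then show "\<psi> t j = 1" using \<tau>i[of j] \<tau>o[of j] n by (cases "j = m") (auto simp: \<psi>_def torus_outside)
  qed
  have 3: "\<psi> (\<phi> u) = u" if "u \<in> torus m" for u
  proof
    fix j show "\<psi> (\<phi> u) j = u j"
      using that by (cases "j = m") (auto simp: \<psi>_def \<phi>_def \<tau>i \<tau>\<tau> torus_outside)
  qed
  have "\<phi> ` torus m = {x \<in> torus n. x i = f x}"
  proof safe
    fix u assume u: "u \<in> torus m"
    have v: "u \<circ> \<tau> \<in> torus n" using mmap_in[OF r u] .
    show "\<phi> u \<in> torus n" using mmap_in[OF 1 u] .
    show "\<phi> u i = f (\<phi> u)" unfolding \<phi>_def using ind[OF v] mon_norm[OF f v] by simp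
  next
    fix x assume x: "x \<in> torus n" "x i = f x"
    have "\<psi> x \<circ> \<tau> = x(i := 1)" by (auto simp: \<psi>_def \<tau>\<tau> fun_eq_iff)
    then have "\<phi> (\<psi> x) = x" using x ind[of x 1] by (simp add: \<phi>_def) (metis fun_upd_triv fun_upd_upd)
    then show "x \<in> \<phi> ` torus m" using mmap_in[OF 2 x(1)] by (metis image_eqI)
  qed
  then show ?thesis using emb_tor[OF embI[OF 1 2 3]] by simp
qed

text \<open>Euclid's algorithm on the exponents, each step being the automorphism that multiplies one
coordinate by a power of another.\<close>

lemma chr_normal_form:
  assumes "in_lattice n a" "a i0 \<noteq> 0"
  shows "\<exists>g g' k i. i < n \<and> k \<noteq> 0 \<and> mmap n n g \<and> mmap n n g' \<and>
    (\<forall>t\<in>torus n. g (g' t) = t \<and> g' (g t) = t \<and> chr n a (g t) = t i powi k)"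
  using assms
proof (induction "\<Sum>i<n. nat \<bar>a i\<bar>" arbitrary: a i0 rule: less_induct)
  case less
  have i0: "i0 < n" using less.prems by (metis in_lattice_def not_less)
  show ?case
  proof (cases "\<exists>j. j \<noteq> i0 \<and> a j \<noteq> 0")
    case False
    have "chr n a t = t i0 powi a i0" for t
    proof -
      have "chr n a t = (\<Prod>j<n. if j = i0 then t i0 powi a i0 else 1)"
        unfolding chr_def by (rule prod.cong) (use False in auto)
      then show ?thesis using i0 by simp
    qed
    then show ?thesis using i0 less.prems
      by (intro exI[of _ "\<lambda>t. t"] exI[of _ "a i0"] exI[of _ i0]) (auto simp: mmap_id)
  next
    case True
    then obtain j where j: "j \<noteq> i0" "a j \<noteq> 0" by auto
    have "\<exists>p r. p \<noteq> r \<and> a p \<noteq> 0 \<and> a r \<noteq> 0 \<and> \<bar>a r\<bar> \<le> \<bar>a p\<bar>"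
      using j less.prems(2) by (cases "\<bar>a j\<bar> \<le> \<bar>a i0\<bar>") (metis, metis linear)
    then obtain p r where pr: "p \<noteq> r" "a p \<noteq> 0" "a r \<noteq> 0" "\<bar>a r\<bar> \<le> \<bar>a p\<bar>" by auto
    have prn: "p < n" "r < n" using pr less.prems(1) by (metis in_lattice_def not_less)+
    \<comment> \<open>The sign for which \<open>a p + e * a r\<close> has absolute value
      \<open>\<bar>a p\<bar> - \<bar>a r\<bar>\<close>. A single subtraction suffices, as the
      measure is the sum of absolute values.\<close>
    define e where "e = - sgn (a p) * sgn (a r)"
    define b where "b = a(p := a p + e * a r)"
    have dec: "\<bar>b p\<bar> < \<bar>a p\<bar>" using pr by (auto simp: b_def e_def sgn_if split: if_splits)
    define h where "h k t = (t(r := t r * t p powi k) :: pt)" for k t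
    have mh: "mmap n n (h k)" for k
    proof (rule mmapI)
      fix i show "mon n (\<lambda>t. h k t i)"
        using mon_mult[OF mon_coord mon_powi[OF mon_coord], of n r p k] mon_coord by (cases "i = r") (auto simp: h_def)
    qed (use prn in \<open>auto simp: h_def torus_outside\<close>)
    have hh: "h k (h (-k) t) = t" if "t \<in> torus n" for k t
      using pr torus_nonzero[OF that, of p] by (auto simp: h_def fun_eq_iff power_int_minus)
    have chb: "chr n a (h e t) = chr n b t" if t: "t \<in> torus n" for t
    proof -
      have "chr n a (h e t) = (\<Prod>i<n. t i powi a i * (if i = r then t p powi (e * a r) else 1))"
        unfolding chr_def by (rule prod.cong) (auto simp: h_def power_int_mult_distrib power_int_mult)
      also have "\<dots> = chr n a t * t p powi (e * a r)"
        using prn by (simp add: prod.distrib chr_def)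
      also have "\<dots> = (\<Prod>i<n. t i powi a i * (if i = p then t p powi (e * a r) else 1))"
        using prn by (simp add: prod.distrib chr_def)
      also have "\<dots> = chr n b t"
        unfolding chr_def by (rule prod.cong) (auto simp: b_def power_int_add torus_nonzero[OF t])
      finally show ?thesis .
    qed
    have "(\<Sum>i<n. nat \<bar>b i\<bar>) < (\<Sum>i<n. nat \<bar>a i\<bar>)"
    proof (rule sum_strict_mono_ex1)
      show "\<forall>i\<in>{..<n}. nat \<bar>b i\<bar> \<le> nat \<bar>a i\<bar>" using dec by (auto simp: b_def)
      show "\<exists>i\<in>{..<n}. nat \<bar>b i\<bar> < nat \<bar>a i\<bar>" using dec prn by (intro bexI[of _ p]) auto
    qed auto
    moreover have "in_lattice n b" using less.prems(1) prn by (auto simp: in_lattice_def b_def)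
    moreover have "b r \<noteq> 0" using pr by (simp add: b_def)
    ultimately obtain g g' k i where g: "i < n" "k \<noteq> 0" "mmap n n g" "mmap n n g'"
      "\<forall>t\<in>torus n. g (g' t) = t \<and> g' (g t) = t \<and> chr n b (g t) = t i powi k"
      using less.hyps[of b r] by blast
    show ?thesis
      using g hh[of _ e] hh[of _ "-e"] chb mmap_comp[OF g(3) mh] mmap_comp[OF mh g(4)] mmap_in[OF g(3)] mmap_in[OF mh, of _ "-e"]
      by (intro exI[of _ "h e \<circ> g"] exI[of _ "g' \<circ> h (-e)"] exI[of _ k] exI[of _ i]) auto
  qed
qed

section \<open>Finite disjoint unions of torus cosets\<close>

definition tor_union :: "nat \<Rightarrow> pt set \<Rightarrow> bool" where
  "tor_union l S \<longleftrightarrow> (\<exists>F. finite F \<and> disjoint F \<and> (\<forall>C\<in>F. tor l C) \<and> S = \<Union>F)"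

lemma tor_union_empty: "tor_union l {}" unfolding tor_union_def by (intro exI[of _ "{}"]) (auto simp: disjoint_def)

lemma tor_union_tor: "tor l S \<Longrightarrow> tor_union l S" unfolding tor_union_def by (intro exI[of _ "{S}"]) (auto simp: disjoint_def)

text \<open>Disjointness of the pieces pays off here: they are the components themselves.\<close>

lemma tor_union_components: "tor_union l S \<Longrightarrow> finite (components S) \<and> (\<forall>C\<in>components S. tor l C)"
  unfolding tor_union_def using components_disjoint_torsion by metis

lemma disjoint_image_emb:
  assumes "inj_on \<phi> T" "disjoint F" "\<Union>F \<subseteq> T" shows "disjoint ((`) \<phi> ` F)"
  using assms unfolding disjoint_def by (smt (verit) Sup_upper image_empty image_iff inj_on_image_Int subset_trans)

lemma tor_union_image: assumes "emb d l \<phi>" "tor_union d S" shows "tor_union l (\<phi> ` S)"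
proof -
  obtain F where F: "finite F" "disjoint F" "\<forall>C\<in>F. tor d C" "S = \<Union>F" using assms(2) by (auto simp: tor_union_def)
  have "disjoint ((`) \<phi> ` F)" by (rule disjoint_image_emb[OF emb_inj[OF assms(1)] F(2)]) (use F tor_sub in blast)
  then show ?thesis using F tor_image[OF assms(1)] unfolding tor_union_def
    by (intro exI[of _ "(`) \<phi> ` F"]) auto
qed

lemma tor_union_Union: assumes "finite J" "disjoint_family_on G J" "\<And>j. j \<in> J \<Longrightarrow> tor_union l (G j)"
  shows "tor_union l (\<Union>j\<in>J. G j)"
proof -
  from assms(3) obtain F where F: "\<And>j. j \<in> J \<Longrightarrow> finite (F j) \<and> disjoint (F j) \<and> (\<forall>C\<in>F j. tor l C) \<and> G j = \<Union>(F j)"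
    unfolding tor_union_def by metis
  have "disjoint (\<Union>j\<in>J. F j)"
    unfolding disjoint_def
  proof (intro ballI impI)
    fix a b assume "a \<in> (\<Union>j\<in>J. F j)" "b \<in> (\<Union>j\<in>J. F j)" and ne: "a \<noteq> b"
    then obtain i j where ij: "i \<in> J" "a \<in> F i" "j \<in> J" "b \<in> F j" by auto
    show "a \<inter> b = {}"
    proof (cases "i = j")
      case True then show ?thesis using ij F[of i] ne by (auto simp: disjoint_def)
    next
      case False
      then have "G i \<inter> G j = {}" using assms(2) ij by (auto simp: disjoint_family_on_def)
      then show ?thesis using F[of i] F[of j] ij by auto
    qed
  qed
  then show ?thesis unfolding tor_union_def using F assms(1) by (intro exI[of _ "\<Union>j\<in>J. F j"]) auto
qed

lemma finite_powi_roots: "k \<noteq> 0 \<Longrightarrow> finite {z::complex. z powi k = c}"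
proof -
  assume k: "k \<noteq> 0"
  have "{z. z powi k = c} \<subseteq> {z. z ^ nat \<bar>k\<bar> = c} \<union> {z. z ^ nat \<bar>k\<bar> = inverse c}"
    by (cases "k \<ge> 0") (auto simp: power_int_def power_inverse)
  moreover have "finite ({z. z ^ nat \<bar>k\<bar> = c} \<union> {z. z ^ nat \<bar>k\<bar> = inverse c})"
    using k finite_nth_roots[of "nat \<bar>k\<bar>"] by simp
  ultimately show ?thesis by (rule finite_subset)
qed

text \<open>After the change of coordinates the equation becomes
  \<open>t i powi k = inverse c\<close>, which splits into finitely many equations
  \<open>t i = z\<close> with \<open>z\<close> a root of unity.\<close>

lemma tor_union_mon: assumes "mon n f" shows "tor_union n {t \<in> torus n. f t = 1}"
proof -
  obtain c a where ca: "torsion c" "in_lattice n a" "\<And>t. t\<in>torus n \<Longrightarrow> f t = c * chr n a t"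
    using assms by (auto simp: mon_def)
  have c0: "c \<noteq> 0" using ca torsion_nonzero by blast
  show ?thesis
  proof (cases "\<exists>i. a i \<noteq> 0")
    case False
    then have "a = (\<lambda>_. 0)" by auto
    then have "{t \<in> torus n. f t = 1} = (if c = 1 then torus n else {})" using ca by (auto simp: chr_zero)
    then show ?thesis using tor_union_empty tor_union_tor tor_torus by auto
  next
    case True
    then obtain g g' k i where g: "i < n" "k \<noteq> 0" "mmap n n g" "mmap n n g'"
      "\<forall>t\<in>torus n. g (g' t) = t \<and> g' (g t) = t \<and> chr n a (g t) = t i powi k"
      using chr_normal_form[OF ca(2)] by blast
    have e: "emb n n g" using g by (intro embI[of _ _ g g']) auto
    let ?Z = "{z. z powi k = inverse c}"
    have tz: "torsion z" if "z \<in> ?Z" for z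
    proof -
      have "z ^ nat \<bar>k\<bar> = inverse c \<or> z ^ nat \<bar>k\<bar> = c" using that
        by (cases "k \<ge> 0") (auto simp: power_int_def power_inverse)
      then show ?thesis using ca(1) torsion_root[of _ "nat \<bar>k\<bar>" z] torsion_inverse g(2) by force
    qed
    have "tor_union n (\<Union>z\<in>?Z. {t \<in> torus n. t i = z})"
    proof (rule tor_union_Union)
      show "finite ?Z" by (rule finite_powi_roots[OF g(2)])
      show "disjoint_family_on (\<lambda>z. {t \<in> torus n. t i = z}) ?Z" by (auto simp: disjoint_family_on_def)
      fix z assume "z \<in> ?Z"
      then show "tor_union n {t \<in> torus n. t i = z}"
        using tz by (intro tor_union_tor tor_solve g(1) mon_const) auto
    qed
    then have "tor_union n (g ` (\<Union>z\<in>?Z. {t \<in> torus n. t i = z}))" by (rule tor_union_image[OF e])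
    moreover have "g ` (\<Union>z\<in>?Z. {t \<in> torus n. t i = z}) = {t \<in> torus n. f t = 1}"
    proof safe
      fix t assume t: "t \<in> torus n" "t i powi k = inverse c"
      show "g t \<in> torus n" using mmap_in[OF g(3) t(1)] .
      then show "f (g t) = 1" using g(5) t ca(3) c0 by simp
    next
      fix t assume t: "t \<in> torus n" "f t = 1"
      have g't: "g' t \<in> torus n" using mmap_in[OF g(4) t(1)] .
      have "c * g' t i powi k = 1" using ca(3)[OF t(1)] t g(5) g't by metis
      then have "g' t i powi k = inverse c" using c0 by (simp add: field_simps)
      then show "t \<in> g ` (\<Union>z\<in>?Z. {t \<in> torus n. t i = z})" using g't g(5) t(1)
        by (intro image_eqI[of _ _ "g' t"]) auto
    qed
    ultimately show ?thesis by simp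
  qed
qed

lemma tor_union_cut: assumes "tor_union l S" "mon l f" shows "tor_union l {t \<in> S. f t = 1}"
proof -
  obtain F where F: "finite F" "disjoint F" "\<forall>C\<in>F. tor l C" "S = \<Union>F" using assms by (auto simp: tor_union_def)
  have "tor_union l (\<Union>C\<in>F. {t \<in> C. f t = 1})"
  proof (rule tor_union_Union[OF F(1)])
    show "disjoint_family_on (\<lambda>C. {t \<in> C. f t = 1}) F" using F(2) by (auto simp: disjoint_family_on_def disjoint_def)
    fix C assume "C \<in> F"
    then obtain d \<phi> where C: "emb d l \<phi>" "C = \<phi> ` torus d" using F(3) by (auto simp: tor_def)
    have "tor_union l (\<phi> ` {t \<in> torus d. f (\<phi> t) = 1})"
      by (rule tor_union_image[OF C(1) tor_union_mon[OF mon_comp[OF emb_mmap[OF C(1)] assms(2)]]])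
    moreover have "\<phi> ` {t \<in> torus d. f (\<phi> t) = 1} = {t \<in> C. f t = 1}" using C(2) by auto
    ultimately show "tor_union l {t \<in> C. f t = 1}" by simp
  qed
  moreover have "(\<Union>C\<in>F. {t \<in> C. f t = 1}) = {t \<in> S. f t = 1}" using F(4) by auto
  ultimately show ?thesis by simp
qed

text \<open>Lying on \<open>Y\<close> means being fixed by its retraction. Each coordinate of that
  condition is one monomial equation, so \<open>S\<close> is cut by \<open>l\<close> of them in
  turn.\<close>

lemma tor_union_Int_tor: assumes "tor_union l S" "tor l Y" shows "tor_union l (S \<inter> Y)"
proof -
  obtain d \<phi> where C: "emb d l \<phi>" "Y = \<phi> ` torus d" using assms by (auto simp: tor_def)
  obtain \<psi> where \<psi>: "mmap l d \<psi>" "\<forall>t\<in>torus d. \<psi> (\<phi> t) = t" using C by (auto simp: emb_def)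
  define f where "f i t = (\<phi> \<circ> \<psi>) t i / t i" for i t
  have m: "mon l (f i)" for i unfolding f_def
    using mon_divide[OF mmap_mon[OF mmap_comp[OF \<psi>(1) emb_mmap[OF C(1)]]] mon_coord, of i i] by simp
  have "tor_union l {t \<in> S. \<forall>i<k. f i t = 1}" for k
  proof (induction k)
    case (Suc k)
    have "{t \<in> S. \<forall>i<Suc k. f i t = 1} = {t \<in> {t \<in> S. \<forall>i<k. f i t = 1}. f k t = 1}"
      by (auto simp: less_Suc_eq)
    then show ?case using tor_union_cut[OF Suc m[of k]] by simp
  qed (use assms in auto)
  moreover have "S \<inter> Y = {t \<in> S. \<forall>i<l. f i t = 1}"
  proof -
    have S: "S \<subseteq> torus l" using assms(1) tor_sub by (auto simp: tor_union_def)
    have "\<phi> (\<psi> t) = t \<longleftrightarrow> (\<forall>i<l. f i t = 1)" if t: "t \<in> torus l" for t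
    proof -
      have "\<phi> (\<psi> t) \<in> torus l" using mmap_in \<psi> C emb_in t by blast
      then have "\<phi> (\<psi> t) = t \<longleftrightarrow> (\<forall>i<l. \<phi> (\<psi> t) i = t i)"
        using torus_outside[OF t] torus_outside[of "\<phi> (\<psi> t)" l] by (auto simp: fun_eq_iff) (metis not_less)
      then show ?thesis using torus_nonzero[OF t] by (simp add: f_def)
    qed
    then show ?thesis using S tor_fix[OF C(1) \<psi>] C(2) by auto
  qed
  ultimately show ?thesis by simp
qed

lemma tor_union_Inter: "finite B \<Longrightarrow> tor l X \<Longrightarrow> \<forall>K\<in>B. tor l K \<Longrightarrow> tor_union l (X \<inter> \<Inter>B)"
proof (induction B rule: finite_induct)
  case empty then show ?case by (simp add: tor_union_tor)
next
  case (insert K B)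
  then have "tor_union l ((X \<inter> \<Inter>B) \<inter> K)" using tor_union_Int_tor by auto
  then show ?case by (simp add: Int_ac)
qed

section \<open>Characteristic polynomials by counting torsion points\<close>

lemma torus_Suc_upd: "t \<in> torus n \<Longrightarrow> cmod z = 1 \<Longrightarrow> t(n := z) \<in> torus (Suc n)"
  by (auto simp: torus_def less_Suc_eq)

lemma torus_Suc_forget: "t \<in> torus (Suc n) \<Longrightarrow> t(n := 1) \<in> torus n"
  by (auto simp: torus_def)

lemma card_torus_root_pts: "q > 0 \<Longrightarrow> finite (torus n \<inter> root_pts q) \<and> card (torus n \<inter> root_pts q) = q ^ n"
proof (induction n)
  case 0
  have "torus 0 \<inter> root_pts q = {\<lambda>_. 1}" by (auto simp: torus_def root_pts_def)
  then show ?case by simp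
next
  case (Suc n)
  let ?R = "{z::complex. z ^ q = 1}"
  let ?h = "\<lambda>(t, z). t(n := z) :: pt"
  have nz: "cmod z = 1" if "z \<in> ?R" for z
    using that Suc.prems torsion_norm by (auto simp: torsion_def)
  have bij: "bij_betw ?h ((torus n \<inter> root_pts q) \<times> ?R) (torus (Suc n) \<inter> root_pts q)"
  proof (rule bij_betw_byWitness[where f' = "\<lambda>t. (t(n := 1), t n)"])
    show "\<forall>a\<in>(torus n \<inter> root_pts q) \<times> ?R. (\<lambda>t. (t(n := 1), t n)) (?h a) = a"
      by (auto simp: fun_eq_iff torus_outside)
    show "?h ` ((torus n \<inter> root_pts q) \<times> ?R) \<subseteq> torus (Suc n) \<inter> root_pts q"
      using nz by (auto simp: torus_Suc_upd root_pts_def)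
    show "(\<lambda>t. (t(n := 1), t n)) ` (torus (Suc n) \<inter> root_pts q) \<subseteq> (torus n \<inter> root_pts q) \<times> ?R"
      by (auto simp: torus_Suc_forget root_pts_def)
  qed auto
  have R: "finite ?R" "card ?R = q" using Suc.prems card_roots_unity_eq[of q] finite_nth_roots[of q 1] by auto
  show ?case using bij_betw_finite[OF bij] bij_betw_same_card[OF bij] R Suc
    by (simp add: card_cartesian_product mult.commute)
qed

text \<open>Both the embedding and its left inverse preserve \<open>q\<close>-th root points once
  \<open>q\<close> absorbs their coefficients, so membership transfers in both directions.\<close>

lemma emb_root_pts: assumes "emb n l \<phi>"
  shows "\<exists>N>0. \<forall>q. N dvd q \<longrightarrow> (\<forall>t\<in>torus n. \<phi> t \<in> root_pts q \<longleftrightarrow> t \<in> root_pts q)"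
proof -
  obtain \<psi> where \<psi>: "mmap l n \<psi>" "\<forall>t\<in>torus n. \<psi> (\<phi> t) = t" using assms by (auto simp: emb_def)
  obtain M where M: "M > 0" "\<forall>q. M dvd q \<longrightarrow> (\<forall>t\<in>torus n \<inter> root_pts q. \<phi> t \<in> root_pts q)"
    using mmap_root_pts[OF emb_mmap[OF assms]] by auto
  obtain N where N: "N > 0" "\<forall>q. N dvd q \<longrightarrow> (\<forall>t\<in>torus l \<inter> root_pts q. \<psi> t \<in> root_pts q)"
    using mmap_root_pts[OF \<psi>(1)] by auto
  have "\<phi> t \<in> root_pts q \<longleftrightarrow> t \<in> root_pts q" if "M * N dvd q" "t \<in> torus n" for q t
    using M(2)[rule_format, of q t] N(2)[rule_format, of q "\<phi> t"] that \<psi>(2) emb_in[OF assms that(2)]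
    by (auto dest: dvd_mult_left dvd_mult_right)
  then show ?thesis using M N by (intro exI[of _ "M * N"]) auto
qed

lemma card_emb_root_pts: assumes "emb n l \<phi>"
  obtains N where "N > 0" "\<And>q S. N dvd q \<Longrightarrow> S \<subseteq> torus n \<Longrightarrow> card (\<phi> ` S \<inter> root_pts q) = card (S \<inter> root_pts q)"
proof -
  obtain N where N: "N > 0" "\<forall>q. N dvd q \<longrightarrow> (\<forall>t\<in>torus n. \<phi> t \<in> root_pts q \<longleftrightarrow> t \<in> root_pts q)" using emb_root_pts[OF assms] by auto
  have "card (\<phi> ` S \<inter> root_pts q) = card (S \<inter> root_pts q)" if "N dvd q" "S \<subseteq> torus n" for q S
  proof -
    have "\<phi> ` S \<inter> root_pts q = \<phi> ` (S \<inter> root_pts q)" using N that by blast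
    moreover have "inj_on \<phi> (S \<inter> root_pts q)" using emb_inj[OF assms] that by (meson inf.coboundedI1 inj_on_subset)
    ultimately show ?thesis by (simp add: card_image)
  qed
  then show ?thesis using N(1) that by simp
qed

lemma tor_count: assumes "tor l Y"
  shows "\<exists>N>0. \<forall>q. N dvd q \<longrightarrow> q > 0 \<longrightarrow> card (Y \<inter> root_pts q) = q ^ tdim l Y"
proof -
  obtain d \<phi> where \<phi>: "emb d l \<phi>" "Y = \<phi> ` torus d" using assms by (auto simp: tor_def)
  obtain N where N: "N > 0" "\<And>q S. N dvd q \<Longrightarrow> S \<subseteq> torus d \<Longrightarrow> card (\<phi> ` S \<inter> root_pts q) = card (S \<inter> root_pts q)"
    by (rule card_emb_root_pts[OF \<phi>(1)]) blast
  have "card (Y \<inter> root_pts q) = q ^ tdim l Y" if "N dvd q" "q > 0" for q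
    using N(2)[OF that(1) subset_refl] card_torus_root_pts[OF that(2), of d] tdim_emb[OF \<phi>(1)] \<phi>(2) by simp
  then show ?thesis using N(1) by blast
qed

lemma eventually_multiples_ball:
  assumes "finite L" "\<forall>Y\<in>L. \<exists>N::nat. N > 0 \<and> (\<forall>q. N dvd q \<longrightarrow> P Y q)"
  shows "\<exists>N>0. \<forall>q. N dvd q \<longrightarrow> (\<forall>Y\<in>L. P Y q)"
proof -
  obtain N where N: "\<And>Y. Y \<in> L \<Longrightarrow> N Y > 0 \<and> (\<forall>q. N Y dvd q \<longrightarrow> P Y q)"
    using bchoice[OF assms(2)] by blast
  have "P Y q" if "Y \<in> L" "(\<Prod>Y\<in>L. N Y) dvd q" for Y q
  proof -
    have "N Y dvd (\<Prod>Y\<in>L. N Y)" using that assms(1) by (intro dvd_prodI) auto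
    then have "N Y dvd q" using that(2) by (rule dvd_trans)
    then show ?thesis using N[OF that(1)] by blast
  qed
  moreover have "(\<Prod>Y\<in>L. N Y) > 0" using N by (simp add: prod_pos)
  ultimately show ?thesis by blast
qed

text \<open>Only multiples of some \<open>N\<close> are tested, because for other \<open>q\<close> a
  coset may contain no \<open>q\<close>-th root points at all. Infinitely many tests remain, enough
  to determine \<open>p\<close>.\<close>

definition count_poly :: "pt set \<Rightarrow> pt set set \<Rightarrow> int poly \<Rightarrow> bool" where
  "count_poly X A p \<longleftrightarrow> (\<exists>N>0. \<forall>q. N dvd q \<longrightarrow> q > 0 \<longrightarrow> poly p (int q) = int (card ((X - \<Union>A) \<inter> root_pts q)))"

lemma count_polyE: assumes "count_poly X A p"
  obtains N where "N > 0" "\<And>q. N dvd q \<Longrightarrow> q > 0 \<Longrightarrow> poly p (int q) = int (card ((X - \<Union>A) \<inter> root_pts q))"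
  using assms unfolding count_poly_def by auto

lemma count_poly_unique: assumes "count_poly X A p" "count_poly X A p'" shows "p = p'"
proof -
  obtain M where M: "M > 0" "\<And>q. M dvd q \<Longrightarrow> q > 0 \<Longrightarrow> poly p (int q) = int (card ((X - \<Union>A) \<inter> root_pts q))"
    by (rule count_polyE[OF assms(1)]) blast
  obtain N where N: "N > 0" "\<And>q. N dvd q \<Longrightarrow> q > 0 \<Longrightarrow> poly p' (int q) = int (card ((X - \<Union>A) \<inter> root_pts q))"
    by (rule count_polyE[OF assms(2)]) blast
  have "(\<lambda>k. int (M * N * Suc k)) ` UNIV \<subseteq> {x. poly p x = poly p' x}"
  proof safe
    fix k
    have "M dvd M * N * Suc k" "N dvd M * N * Suc k" "M * N * Suc k > 0" using M(1) N(1) by auto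
    then show "poly p (int (M * N * Suc k)) = poly p' (int (M * N * Suc k))" using M(2) N(2) by metis
  qed
  moreover have "infinite ((\<lambda>k. int (M * N * Suc k)) ` UNIV)"
    by (rule range_inj_infinite) (use M N in \<open>auto simp: inj_on_def\<close>)
  ultimately have "infinite {x. poly p x = poly p' x}" by (meson finite_subset)
  then show ?thesis using poly_roots_finite[of "p - p'"] by auto
qed

lemma count_poly_emb: assumes "emb n l \<phi>" "count_poly (torus n) D p" "\<forall>K\<in>D. K \<subseteq> torus n"
  shows "count_poly (\<phi> ` torus n) ((`) \<phi> ` D) p"
proof -
  obtain M where M: "M > 0" "\<And>q. M dvd q \<Longrightarrow> q > 0 \<Longrightarrow> poly p (int q) = int (card ((torus n - \<Union>D) \<inter> root_pts q))"
    by (rule count_polyE[OF assms(2)]) blast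
  obtain N where N: "N > 0" "\<And>q S. N dvd q \<Longrightarrow> S \<subseteq> torus n \<Longrightarrow> card (\<phi> ` S \<inter> root_pts q) = card (S \<inter> root_pts q)"
    by (rule card_emb_root_pts[OF assms(1)]) blast
  have "\<phi> ` torus n - \<Union>((`) \<phi> ` D) = \<phi> ` (torus n - \<Union>D)"
    using inj_on_image_set_diff[OF emb_inj[OF assms(1)], of "torus n" "\<Union>D"] assms(3) by (auto simp: image_Union)
  then have "poly p (int q) = int (card ((\<phi> ` torus n - \<Union>((`) \<phi> ` D)) \<inter> root_pts q))"
    if "M * N dvd q" "q > 0" for q
    using M(2)[of q] N(2)[of q "torus n - \<Union>D"] that by (auto dest: dvd_mult_left dvd_mult_right)
  then show ?thesis unfolding count_poly_def using M N by (intro exI[of _ "M * N"]) auto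
qed

lemma layers_tor:
  assumes "tor l X" "finite A" "\<forall>K\<in>A. tor l K"
  shows "finite (layers X A)" "Y \<in> layers X A \<Longrightarrow> tor l Y"
proof -
  have "tor_union l (X \<inter> \<Inter>B)" if "B \<in> Pow A" for B
    using tor_union_Inter[of B l X] that assms finite_subset by blast
  note c = tor_union_components[OF this]
  show "finite (layers X A)" unfolding layers_def using c assms(2) by simp
  show "Y \<in> layers X A \<Longrightarrow> tor l Y" unfolding layers_def using c by blast
qed

lemma mob_sum:
  assumes "finite L" "Z \<in> L" "X \<in> L" "\<And>Y. Y \<in> L \<Longrightarrow> Y \<subseteq> X"
  shows "(\<Sum>Y\<in>{Y\<in>L. Z \<subseteq> Y}. mob L X Y) = (if Z = X then 1 else 0)"
proof -
  have "{Y\<in>L. Z \<subseteq> Y} = insert Z {Y\<in>L. Z \<subset> Y \<and> Y \<subseteq> X}" using assms by auto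
  then have "(\<Sum>Y\<in>{Y\<in>L. Z \<subseteq> Y}. mob L X Y) = mob L X Z + (\<Sum>Y\<in>{Y\<in>L. Z \<subset> Y \<and> Y \<subseteq> X}. mob L X Y)"
    using assms(1) by simp
  moreover have "mob L X Z = (if Z = X then 1 else - (\<Sum>Y\<in>{Y\<in>L. Z \<subset> Y \<and> Y \<subseteq> X}. mob L X Y))"
    by (subst mob.simps) (simp only: assms(1) not_True_eq_False if_False)
  moreover have "(\<Sum>Y\<in>{Y\<in>L. Z \<subset> Y \<and> Y \<subseteq> X}. mob L X Y) = 0" if "Z = X"
    using that by (intro sum.neutral) auto
  ultimately show ?thesis by (cases "Z = X") simp_all
qed

text \<open>Moebius inversion point by point: the layers through \<open>p\<close> are those
  containing the smallest one, \<open>Z\<close>. Their Moebius values add up to 1 if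
  \<open>Z = X\<close>, that is if \<open>p\<close> lies on no hypertorus, and to 0
  otherwise.\<close>

lemma chi_count_poly:
  assumes "tor l X" "finite A" "\<And>K. K \<in> A \<Longrightarrow> tor l K" "\<And>K. K \<in> A \<Longrightarrow> K \<subset> X"
  shows "count_poly X A (chi l X A)"
proof -
  let ?L = "layers X A"
  have fin: "finite ?L" and tor: "\<And>Y. Y \<in> ?L \<Longrightarrow> tor l Y" using layers_tor[OF assms(1,2)] assms(3) by blast+
  have XL: "X \<in> ?L" unfolding layers_def by (rule UN_I[of "{}"]) (simp_all add: components_tor[OF assms(1)])
  have sub: "Y \<subseteq> X" if Y: "Y \<in> ?L" for Y
  proof -
    obtain B where "Y \<in> components (X \<inter> \<Inter>B)" using Y unfolding layers_def by blast
    from in_components_subset[OF this] show ?thesis by blast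
  qed
  have pt: "(\<Sum>Y\<in>{Y\<in>?L. p \<in> Y}. mob ?L X Y) = (if p \<in> \<Union>A then 0 else 1)" if p: "p \<in> X" for p
  proof -
    define B where "B = {K\<in>A. p \<in> K}"
    \<comment> \<open>All hypertori through \<open>p\<close> are intersected before the component is
      taken, which makes \<open>Z\<close> the least layer through \<open>p\<close>.\<close>
    define Z where "Z = connected_component_set (X \<inter> \<Inter>B) p"
    have pB: "p \<in> X \<inter> \<Inter>B" using p by (auto simp: B_def)
    have Zc: "Z \<in> components (X \<inter> \<Inter>B)" unfolding Z_def using pB by (rule componentsI)
    have "B \<in> Pow A" by (auto simp: B_def)
    then have ZL: "Z \<in> ?L" unfolding layers_def using Zc by (rule UN_I)
    have pZ: "p \<in> Z" unfolding Z_def using pB by simp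
    have "p \<in> Y \<longleftrightarrow> Z \<subseteq> Y" if Y: "Y \<in> ?L" for Y
    proof
      assume "p \<in> Y"
      obtain B' where B': "B' \<subseteq> A" "Y \<in> components (X \<inter> \<Inter>B')" using Y unfolding layers_def by blast
      have "Y \<subseteq> X \<inter> \<Inter>B'" using in_components_subset[OF B'(2)] .
      then have "B' \<subseteq> B" using \<open>p \<in> Y\<close> B'(1) unfolding B_def by blast
      moreover have "Y = connected_component_set (X \<inter> \<Inter>B') p"
      proof -
        obtain x where x: "Y = connected_component_set (X \<inter> \<Inter>B') x" using B'(2) unfolding components_iff by blast
        show ?thesis using connected_component_eq[of p "X \<inter> \<Inter>B'" x] \<open>p \<in> Y\<close> unfolding x by simp
      qed
      moreover have "X \<inter> \<Inter>B \<subseteq> X \<inter> \<Inter>B'" if "B' \<subseteq> B" using that by blast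
      ultimately show "Z \<subseteq> Y" unfolding Z_def using connected_component_mono[of "X \<inter> \<Inter>B" "X \<inter> \<Inter>B'" p] by simp
    qed (use pZ in auto)
    then have "{Y\<in>?L. p \<in> Y} = {Y\<in>?L. Z \<subseteq> Y}" by auto
    then have "(\<Sum>Y\<in>{Y\<in>?L. p \<in> Y}. mob ?L X Y) = (if Z = X then 1 else 0)"
      using mob_sum[OF fin ZL XL sub] by simp
    moreover have "Z = X \<longleftrightarrow> p \<notin> \<Union>A"
    proof
      assume "Z = X"
      then have "X \<subseteq> \<Inter>B" using in_components_subset[OF Zc] by auto
      then have "B = {}" using assms(4) unfolding B_def by blast
      then show "p \<notin> \<Union>A" by (auto simp: B_def)
    next
      assume "p \<notin> \<Union>A"
      then have "B = {}" by (auto simp: B_def)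
      then show "Z = X" using Zc components_tor[OF assms(1)] by simp
    qed
    ultimately show ?thesis by simp
  qed
  have "\<forall>Y\<in>?L. \<exists>N::nat. N > 0 \<and> (\<forall>q. N dvd q \<longrightarrow> q > 0 \<longrightarrow> card (Y \<inter> root_pts q) = q ^ tdim l Y)"
    using tor_count[OF tor] by blast
  from eventually_multiples_ball[OF fin, where P = "\<lambda>Y q. q > 0 \<longrightarrow> card (Y \<inter> root_pts q) = q ^ tdim l Y", OF this]
  obtain N where N': "N > 0" "\<forall>q. N dvd q \<longrightarrow> (\<forall>Y\<in>?L. q > 0 \<longrightarrow> card (Y \<inter> root_pts q) = q ^ tdim l Y)" by blast
  then have N: "N > 0" "\<And>q Y. N dvd q \<Longrightarrow> Y \<in> ?L \<Longrightarrow> q > 0 \<Longrightarrow> card (Y \<inter> root_pts q) = q ^ tdim l Y" by blast+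
  have "poly (chi l X A) (int q) = int (card ((X - \<Union>A) \<inter> root_pts q))" if q: "N dvd q" "q > 0" for q
  proof -
    have f: "finite (X \<inter> root_pts q)" using card_torus_root_pts[OF q(2), of l] tor_sub[OF assms(1)]
      by (meson Int_mono finite_subset subset_refl)
    have "poly (chi l X A) (int q) = (\<Sum>Y\<in>?L. mob ?L X Y * int (card (Y \<inter> root_pts q)))"
      unfolding chi_def poly_sum poly_monom by (rule sum.cong[OF refl]) (simp add: N(2)[OF q(1) _ q(2)])
    \<comment> \<open>Double counting of pairs of a layer and a root point on it.\<close>
    also have "\<dots> = (\<Sum>Y\<in>?L. \<Sum>p\<in>X \<inter> root_pts q. if p \<in> Y then mob ?L X Y else 0)"
    proof (rule sum.cong[OF refl])
      fix Y assume "Y \<in> ?L"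
      then have "Y \<inter> root_pts q = (X \<inter> root_pts q) \<inter> {p. p \<in> Y}" using sub by auto
      then show "mob ?L X Y * int (card (Y \<inter> root_pts q)) = (\<Sum>p\<in>X \<inter> root_pts q. if p \<in> Y then mob ?L X Y else 0)"
        using f by (simp add: sum.If_cases)
    qed
    also have "\<dots> = (\<Sum>p\<in>X \<inter> root_pts q. \<Sum>Y\<in>?L. if p \<in> Y then mob ?L X Y else 0)" by (rule sum.swap)
    also have "\<dots> = (\<Sum>p\<in>X \<inter> root_pts q. if p \<in> \<Union>A then 0 else 1)"
    proof (rule sum.cong[OF refl])
      fix p assume "p \<in> X \<inter> root_pts q"
      moreover have "?L \<inter> {Y. p \<in> Y} = {Y\<in>?L. p \<in> Y}" by auto
      ultimately show "(\<Sum>Y\<in>?L. if p \<in> Y then mob ?L X Y else 0) = (if p \<in> \<Union>A then 0 else 1)"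
        using fin pt[of p] by (simp add: sum.If_cases)
    qed
    also have "\<dots> = int (card ((X - \<Union>A) \<inter> root_pts q))"
    proof -
      have "(X - \<Union>A) \<inter> root_pts q = (X \<inter> root_pts q) \<inter> - {p. p \<in> \<Union>A}" by auto
      then show ?thesis using f by (simp add: sum.If_cases)
    qed
    finally show ?thesis .
  qed
  then show ?thesis unfolding count_poly_def using N(1) by blast
qed

section \<open>Inductive arrangements carrying their polynomial\<close>

text \<open>An intrinsic form of inductiveness: \<open>D\<close> consists of hypertori of \<open>torus n\<close> and \<open>p\<close> is its characteristic
polynomial. The map \<open>h\<close> parametrises \<open>H\<close>, and \<open>D''\<close> is the restriction to \<open>H\<close> pulled back along \<open>h\<close>.\<close>

inductive ind_poly :: "nat \<Rightarrow> pt set set \<Rightarrow> int poly \<Rightarrow> bool" where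
  ind_poly_empty: "ind_poly n {} (monom 1 n)"
| ind_poly_step: "H \<in> D \<Longrightarrow> emb n (Suc n) h \<Longrightarrow> h ` torus n = H \<Longrightarrow>
    ind_poly (Suc n) (D - {H}) ([:- d, 1:] * p) \<Longrightarrow> ind_poly n D'' p \<Longrightarrow>
    D'' = (\<Union>K\<in>D - {H}. components {u \<in> torus n. h u \<in> K}) \<Longrightarrow>
    ind_poly (Suc n) D ([:- (d + 1), 1:] * p)"

lemma ind_poly_wf: "ind_poly n D p \<Longrightarrow> finite D \<and> (\<forall>K\<in>D. tor n K \<and> K \<subset> torus n)"
proof (induction rule: ind_poly.induct)
  case (ind_poly_step H D n h d p D'')
  have H: "tor (Suc n) H" using emb_tor[OF ind_poly_step.hyps(2)] ind_poly_step.hyps(3) by simp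
  \<comment> \<open>Dimension separates \<open>H\<close> from the whole torus.\<close>
  have "tdim (Suc n) H = n" using tdim_emb[OF ind_poly_step.hyps(2)] ind_poly_step.hyps(3) by simp
  moreover have "tdim (Suc n) (torus (Suc n)) = Suc n" using tdim_emb[OF emb_id[of "Suc n"]] by simp
  ultimately have "H \<noteq> torus (Suc n)" by auto
  then have "tor (Suc n) H \<and> H \<subset> torus (Suc n)" using H tor_sub[OF H] by blast
  then show ?case using ind_poly_step.IH(1) by (metis Diff_iff finite_Diff2 finite.emptyI finite_insert singletonD)
qed simp

text \<open>\<open>h'\<close> maps the part of \<open>K\<close> inside the image of \<open>h\<close>
  bijectively to the preimage. On that part \<open>h\<close> undoes \<open>h'\<close>, so a piece
  embedded by \<open>\<phi>\<close> stays split, with \<open>\<phi>' \<circ> h\<close> as left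
  inverse.\<close>

lemma ind_poly_restr_tor_union:
  assumes "emb n (Suc n) h" "tor (Suc n) K" shows "tor_union n {u \<in> torus n. h u \<in> K}"
proof -
  obtain h' where h': "mmap (Suc n) n h'" "\<forall>t\<in>torus n. h' (h t) = t" using assms(1) by (auto simp: emb_def)
  have "tor_union (Suc n) (K \<inter> h ` torus n)" using tor_union_Int_tor[OF tor_union_tor[OF assms(2)] emb_tor[OF assms(1)]] .
  then obtain F where F: "finite F" "disjoint F" "\<forall>C\<in>F. tor (Suc n) C" "K \<inter> h ` torus n = \<Union>F" by (auto simp: tor_union_def)
  have tC: "tor n (h' ` C)" if C: "C \<in> F" for C
  proof -
    obtain d \<phi> where \<phi>: "emb d (Suc n) \<phi>" "C = \<phi> ` torus d" using F(3) C unfolding tor_def by blast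
    obtain \<phi>' where \<phi>': "mmap (Suc n) d \<phi>'" "\<forall>t\<in>torus d. \<phi>' (\<phi> t) = t" using \<phi>(1) by (auto simp: emb_def)
    have hh: "h (h' (\<phi> t)) = \<phi> t" if "t \<in> torus d" for t
    proof -
      have "\<phi> t \<in> h ` torus n" using \<phi> F(4) \<open>C \<in> F\<close> that by blast
      then show ?thesis using h'(2) by auto
    qed
    have "emb d n (h' \<circ> \<phi>)"
      by (rule embI[where \<psi> = "\<phi>' \<circ> h"]) (use mmap_comp[OF emb_mmap[OF \<phi>(1)] h'(1)] mmap_comp[OF emb_mmap[OF assms(1)] \<phi>'(1)] hh \<phi>' in auto)
    then show ?thesis using emb_tor \<phi>(2) by (metis image_comp)
  qed
  have inj: "inj_on h' (h ` torus n)" using h'(2) by (auto simp: inj_on_def)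
  have "disjoint ((`) h' ` F)" using disjoint_image_emb[OF inj F(2)] F(4) by auto
  moreover have "{u \<in> torus n. h u \<in> K} = \<Union>((`) h' ` F)"
  proof -
    have "\<Union>((`) h' ` F) = h' ` (K \<inter> h ` torus n)" unfolding F(4) by auto
    also have "\<dots> = {u \<in> torus n. h u \<in> K}" using h'(2) by force
    finally show ?thesis by simp
  qed
  ultimately show ?thesis unfolding tor_union_def using F(1) tC by (intro exI[of _ "(`) h' ` F"]) auto
qed

lemma Union_restr: assumes "D'' = (\<Union>K\<in>D. components {u \<in> torus n. h u \<in> K})"
  shows "\<Union>D'' = {u \<in> torus n. h u \<in> \<Union>D}"
proof -
  have "\<Union>D'' = (\<Union>K\<in>D. \<Union>(components {u \<in> torus n. h u \<in> K}))" unfolding assms by blast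
  also have "\<dots> = {u \<in> torus n. h u \<in> \<Union>D}" unfolding Union_components by blast
  finally show ?thesis .
qed

lemma int_card_Diff: "finite A \<Longrightarrow> B \<subseteq> A \<Longrightarrow> int (card (A - B)) = int (card A) - int (card B)"
  by (simp add: card_Diff_subset card_mono finite_subset of_nat_diff)

text \<open>Removing \<open>H\<close> uncovers exactly the points of \<open>H\<close> on no other
  hypertorus, and \<open>h\<close> matches them with the complement of \<open>D''\<close>. The new
  exponent is thus read off from (t - d) p - p.\<close>

lemma ind_poly_count_poly: "ind_poly n D p \<Longrightarrow> count_poly (torus n) D p"
proof (induction rule: ind_poly.induct)
  case (ind_poly_empty n)
  then show ?case unfolding count_poly_def using card_torus_root_pts by (intro exI[of _ 1]) (auto simp: poly_monom)
next
  case (ind_poly_step H D n h d p D'')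
  obtain M where M: "M > 0" "\<And>q. M dvd q \<Longrightarrow> q > 0 \<Longrightarrow> poly ([:- d, 1:] * p) (int q) = int (card ((torus (Suc n) - \<Union>(D - {H})) \<inter> root_pts q))"
    by (rule count_polyE[OF ind_poly_step.IH(1)]) blast
  obtain N where N: "N > 0" "\<And>q. N dvd q \<Longrightarrow> q > 0 \<Longrightarrow> poly p (int q) = int (card ((torus n - \<Union>D'') \<inter> root_pts q))"
    by (rule count_polyE[OF ind_poly_step.IH(2)]) blast
  obtain R where R: "R > 0" "\<And>q S. R dvd q \<Longrightarrow> S \<subseteq> torus n \<Longrightarrow> card (h ` S \<inter> root_pts q) = card (S \<inter> root_pts q)"
    by (rule card_emb_root_pts[OF ind_poly_step.hyps(2)]) blast
  have HT: "H \<subseteq> torus (Suc n)" using ind_poly_step.hyps emb_in by blast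
  have "poly ([:- (d + 1), 1:] * p) (int q) = int (card ((torus (Suc n) - \<Union>D) \<inter> root_pts q))"
    if q: "M * N * R dvd q" "q > 0" for q
  proof -
    have dv: "M dvd q" "N dvd q" "R dvd q" using q(1) by (auto dest: dvd_mult_left dvd_mult_right)
    let ?A = "(torus (Suc n) - \<Union>(D - {H})) \<inter> root_pts q" and ?B = "(H - \<Union>(D - {H})) \<inter> root_pts q"
    have "h ` (torus n - \<Union>D'') = H - \<Union>(D - {H})"
      unfolding Union_restr[OF ind_poly_step.hyps(6)] ind_poly_step.hyps(3)[symmetric] by blast
    then have B: "int (card ?B) = poly p (int q)"
      using R(2)[OF dv(3), of "torus n - \<Union>D''"] N(2)[OF dv(2) q(2)] by simp
    have "?B \<subseteq> ?A" using HT by blast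
    moreover have "finite ?A" using card_torus_root_pts[OF q(2), of "Suc n"] by (auto intro: finite_subset[of _ "torus (Suc n) \<inter> root_pts q"])
    moreover have "(torus (Suc n) - \<Union>D) \<inter> root_pts q = ?A - ?B" using ind_poly_step.hyps(1) by blast
    ultimately have "int (card ((torus (Suc n) - \<Union>D) \<inter> root_pts q)) = int (card ?A) - int (card ?B)"
      by (metis int_card_Diff)
    then show ?thesis using B M(2)[OF dv(1) q(2)] by (simp add: algebra_simps)
  qed
  then show ?case unfolding count_poly_def using M N R by (intro exI[of _ "M * N * R"]) auto
qed

lemma image_diff_single:
  assumes "inj_on \<phi> T" "\<forall>K\<in>D. K \<subseteq> T" "H \<in> D"
  shows "(`) \<phi> ` (D - {H}) = (`) \<phi> ` D - {\<phi> ` H}"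
proof -
  have "inj_on ((`) \<phi>) D" using assms by (auto simp: inj_on_def inj_on_image_eq_iff)
  then show ?thesis using inj_on_image_set_diff[of "(`) \<phi>" D D "{H}"] assms(3) by simp
qed

text \<open>Both polynomials count the same points. The layer posets of deletion and restriction are
  therefore never compared with that of the arrangement.\<close>

lemma ind_poly_chi: assumes "ind_poly n D p" "emb n l \<phi>"
  shows "chi l (\<phi> ` torus n) ((`) \<phi> ` D) = p"
proof (rule count_poly_unique)
  note wf = ind_poly_wf[OF assms(1)]
  show "count_poly (\<phi> ` torus n) ((`) \<phi> ` D) p"
    using count_poly_emb[OF assms(2) ind_poly_count_poly[OF assms(1)]] wf by blast
  show "count_poly (\<phi> ` torus n) ((`) \<phi> ` D) (chi l (\<phi> ` torus n) ((`) \<phi> ` D))"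
  proof (rule chi_count_poly[OF emb_tor[OF assms(2)]])
    fix K assume "K \<in> (`) \<phi> ` D"
    then obtain K' where K': "K' \<in> D" "K = \<phi> ` K'" by auto
    show "tor l K" using K' wf tor_image[OF assms(2)] by auto
    show "K \<subset> \<phi> ` torus n" using K' wf emb_inj[OF assms(2)]
      by (metis image_strict_mono)
  qed (use wf in auto)
qed

text \<open>\<open>inductive_arr\<close> keeps every restriction as a subset of one ambient torus.
  Hence \<open>\<phi>\<close> is arbitrary: passing to a restriction replaces it by
  \<open>\<phi> \<circ> h\<close>.\<close>

lemma ind_poly_inductive_arr:
  "ind_poly n D p \<Longrightarrow> emb n l \<phi> \<Longrightarrow> inductive_arr l (\<phi> ` torus n) ((`) \<phi> ` D)"
proof (induction arbitrary: \<phi> rule: ind_poly.induct)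
  case (ind_poly_empty n) then show ?case by (simp add: inductive_arr.empty)
next
  case (ind_poly_step H D n h d p D'')
  note wf = ind_poly_wf[OF ind_poly.ind_poly_step[OF ind_poly_step.hyps]]
  have e: "emb n l (\<phi> \<circ> h)" using emb_comp[OF ind_poly_step.hyps(2) ind_poly_step.prems] .
  have inj: "inj_on \<phi> (torus (Suc n))" using emb_inj[OF ind_poly_step.prems] .
  have D': "(`) \<phi> ` D - {\<phi> ` H} = (`) \<phi> ` (D - {H})"
    by (rule image_diff_single[OF inj _ ind_poly_step.hyps(1), symmetric]) (use wf in auto)
  have c: "components (\<phi> ` K \<inter> \<phi> ` H) = (`) (\<phi> \<circ> h) ` components {u \<in> torus n. h u \<in> K}" if K: "K \<in> D - {H}" for K
  proof -
    let ?S = "{u \<in> torus n. h u \<in> K}"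
    have KT: "K \<subseteq> torus (Suc n)" "H \<subseteq> torus (Suc n)" using wf K ind_poly_step.hyps(1) by auto
    have tor_union: "tor_union n ?S" using ind_poly_restr_tor_union[OF ind_poly_step.hyps(2)] wf K by auto
    have "\<phi> ` K \<inter> \<phi> ` H = \<phi> ` (K \<inter> H)" using inj_on_image_Int[OF inj KT] by simp
    also have "K \<inter> H = h ` ?S" using ind_poly_step.hyps(3) by auto
    also have "\<phi> ` h ` ?S = (\<phi> \<circ> h) ` \<Union>(components ?S)" by (simp add: image_comp)
    also have "\<dots> = \<Union>((`) (\<phi> \<circ> h) ` components ?S)" by (rule image_Union)
    finally have 1: "\<phi> ` K \<inter> \<phi> ` H = \<Union>((`) (\<phi> \<circ> h) ` components ?S)" .
    have "components (\<Union>((`) (\<phi> \<circ> h) ` components ?S)) = (`) (\<phi> \<circ> h) ` components ?S"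
    proof (rule components_disjoint_torsion)
      show "finite ((`) (\<phi> \<circ> h) ` components ?S)" using tor_union_components[OF tor_union] by simp
      show "disjoint ((`) (\<phi> \<circ> h) ` components ?S)"
      proof (rule disjoint_image_emb[OF emb_inj[OF e]])
        show "disjoint (components ?S)" using components_nonoverlap unfolding disjoint_def by blast
      qed auto
      show "tor l C" if "C \<in> (`) (\<phi> \<circ> h) ` components ?S" for C
        using that tor_union_components[OF tor_union] tor_image[OF e] by auto
    qed
    then show ?thesis using 1 by simp
  qed
  have "restr ((`) \<phi> ` D) (\<phi> ` H) = (\<Union>K\<in>D - {H}. components (\<phi> ` K \<inter> \<phi> ` H))"
    unfolding restr_def D' by simp
  also have "\<dots> = (`) (\<phi> \<circ> h) ` D''" unfolding ind_poly_step.hyps(6) using c by (simp add: image_UN)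
  finally have R: "restr ((`) \<phi> ` D) (\<phi> ` H) = (`) (\<phi> \<circ> h) ` D''" .
  have H: "\<phi> ` H = (\<phi> \<circ> h) ` torus n" using ind_poly_step.hyps(3) by (auto simp: image_comp)
  show ?case
  proof (rule inductive_arr.step[where d = d])
    show "\<phi> ` H \<in> (`) \<phi> ` D" using ind_poly_step.hyps(1) by simp
    show "inductive_arr l (\<phi> ` torus (Suc n)) ((`) \<phi> ` D - {\<phi> ` H})"
      unfolding D' by (rule ind_poly_step.IH(1)[OF ind_poly_step.prems])
    show "inductive_arr l (\<phi> ` H) (restr ((`) \<phi> ` D) (\<phi> ` H))"
      unfolding R unfolding H by (rule ind_poly_step.IH(2)[OF e])
    show "chi l (\<phi> ` torus (Suc n)) ((`) \<phi> ` D - {\<phi> ` H}) = [:- of_int d, 1:] * chi l (\<phi> ` H) (restr ((`) \<phi> ` D) (\<phi> ` H))"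
      unfolding D' R unfolding H ind_poly_chi[OF ind_poly_step.hyps(4) ind_poly_step.prems] ind_poly_chi[OF ind_poly_step.hyps(5) e] by simp
  qed
qed

section \<open>Cylinders and sections\<close>

definition cyl :: "nat \<Rightarrow> pt set \<Rightarrow> pt set" where
  "cyl n K = {x \<in> torus (Suc n). x(n := 1) \<in> K}"

text \<open>The product of \<open>h\<close> with the identity of a circle; that circle has index
  \<open>n\<close> in the source but \<open>m\<close> in the target.\<close>

definition lift :: "nat \<Rightarrow> nat \<Rightarrow> (pt \<Rightarrow> pt) \<Rightarrow> pt \<Rightarrow> pt" where
  "lift n m h y = (h (y(n := 1)))(m := y n)"

lemma torus_upd_self: "t \<in> torus n \<Longrightarrow> t(n := 1) = t"
  by (auto simp: fun_eq_iff torus_outside)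

lemma mmap_forget: "mmap (Suc n) n (\<lambda>y. y(n := 1))"
proof (rule mmapI)
  fix i assume "i < n"
  then show "mon (Suc n) (\<lambda>t. (t(n := 1)) i)" using mon_coord by auto
qed (auto simp: torus_outside)

lemma mmap_lift: assumes "mmap n m h" shows "mmap (Suc n) (Suc m) (lift n m h)"
proof (rule mmapI)
  fix i assume "i < Suc m"
  show "mon (Suc n) (\<lambda>t. lift n m h t i)"
    using mon_coord mon_comp[OF mmap_forget mmap_mon[OF assms]] by (cases "i = m") (auto simp: lift_def)
next
  fix t i assume "t \<in> torus (Suc n)" "Suc m \<le> i"
  then show "lift n m h t i = 1" using torus_outside[OF mmap_in[OF assms torus_Suc_forget], of t i] by (simp add: lift_def)
qed

lemma lift_lift:
  assumes "mmap n m h" "\<And>t. t \<in> torus n \<Longrightarrow> h' (h t) = t" "y \<in> torus (Suc n)"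
  shows "lift m n h' (lift n m h y) = y"
  using assms(2)[OF torus_Suc_forget[OF assms(3)]] mmap_in[OF assms(1) torus_Suc_forget[OF assms(3)]]
  by (simp add: lift_def torus_upd_self)

lemma emb_lift: assumes "emb n m h" shows "emb (Suc n) (Suc m) (lift n m h)"
proof -
  obtain h' where h': "mmap m n h'" "\<And>t. t \<in> torus n \<Longrightarrow> h' (h t) = t" using assms by (auto simp: emb_def)
  show ?thesis
    by (rule embI[OF mmap_lift[OF emb_mmap[OF assms]] mmap_lift[OF h'(1)]])
      (rule lift_lift[OF emb_mmap[OF assms] h'(2)])
qed

lemma cyl_torus: "cyl n (torus n) = torus (Suc n)"
  using torus_Suc_forget by (auto simp: cyl_def)

lemma cyl_inter: "S \<subseteq> torus n \<Longrightarrow> cyl n S \<inter> torus n = S"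
  using torus_upd_self torus_mono[of _ n "Suc n"] by (force simp: cyl_def)

lemma cyl_inj: "S \<subseteq> torus n \<Longrightarrow> S' \<subseteq> torus n \<Longrightarrow> cyl n S = cyl n S' \<Longrightarrow> S = S'"
  using cyl_inter by metis

lemma lift_cyl: assumes "emb n m h" "S \<subseteq> torus n"
  shows "lift n m h ` cyl n S = cyl m (h ` S)"
proof safe
  fix y assume y: "y \<in> cyl n S"
  then have y': "y \<in> torus (Suc n)" "y(n := 1) \<in> S" by (auto simp: cyl_def)
  have "h (y(n := 1)) \<in> torus m" using emb_in[OF assms(1)] y'(2) assms(2) by auto
  then show "lift n m h y \<in> cyl m (h ` S)"
    using emb_in[OF emb_lift[OF assms(1)] y'(1)] y'(2) by (auto simp: cyl_def lift_def torus_upd_self)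
next
  fix x assume x: "x \<in> cyl m (h ` S)"
  then obtain u where u: "x \<in> torus (Suc m)" "u \<in> S" "x(m := 1) = h u" by (auto simp: cyl_def)
  have ut: "u \<in> torus n" using u(2) assms(2) by auto
  have 1: "(u(n := x m))(n := 1) = u" using torus_upd_self[OF ut] by simp
  have "u(n := x m) \<in> cyl n S"
    using torus_Suc_upd[OF ut torus_norm[OF u(1)]] 1 u(2) by (simp add: cyl_def)
  moreover have "lift n m h (u(n := x m)) = x" using 1 u(3)[symmetric] by (simp add: lift_def)
  ultimately show "x \<in> lift n m h ` cyl n S" by (metis image_eqI)
qed

lemma tor_cyl: assumes "tor n K" shows "tor (Suc n) (cyl n K)"
proof -
  obtain d \<phi> where \<phi>: "emb d n \<phi>" "K = \<phi> ` torus d" using assms by (auto simp: tor_def)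
  have "cyl n K = lift d n \<phi> ` torus (Suc d)" using lift_cyl[OF \<phi>(1) subset_refl] \<phi>(2) by (simp add: cyl_torus)
  then show ?thesis using emb_tor[OF emb_lift[OF \<phi>(1)]] by simp
qed

lemma cyl_Union: "cyl n (\<Union>F) = \<Union>(cyl n ` F)"
  by (auto simp: cyl_def)

lemma components_cyl: assumes "tor_union n S" shows "components (cyl n S) = cyl n ` components S"
proof -
  have "cyl n S = cyl n (\<Union>(components S))" by simp
  also have "\<dots> = \<Union>(cyl n ` components S)" by (rule cyl_Union)
  finally have 1: "cyl n S = \<Union>(cyl n ` components S)" .
  have "components (\<Union>(cyl n ` components S)) = cyl n ` components S"
  proof (rule components_disjoint_torsion)
    show "finite (cyl n ` components S)" using tor_union_components[OF assms] by simp
    show "tor (Suc n) C" if "C \<in> cyl n ` components S" for C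
      using that tor_union_components[OF assms] by (auto intro: tor_cyl)
    show "disjoint (cyl n ` components S)"
      unfolding disjoint_def
    proof (intro ballI impI)
      fix a b assume "a \<in> cyl n ` components S" "b \<in> cyl n ` components S" "a \<noteq> b"
      then obtain a' b' where ab: "a' \<in> components S" "b' \<in> components S" "a' \<noteq> b'" "a = cyl n a'" "b = cyl n b'" by blast
      then have "a' \<inter> b' = {}" using components_nonoverlap[of a' S b'] by simp
      then show "a \<inter> b = {}" using ab by (auto simp: cyl_def)
    qed
  qed
  then show ?thesis by (simp only: 1)
qed

lemma cyl_image_diff: assumes "\<forall>K\<in>D. K \<subseteq> torus n" "H \<in> D"
  shows "cyl n ` D - {cyl n H} = cyl n ` (D - {H})"
proof -
  have "inj_on (cyl n) D"
    by (rule inj_onI, rule cyl_inj) (use assms(1) in simp_all)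
  then show ?thesis using inj_on_image_set_diff[of "cyl n" D D "{H}"] assms(2) by simp
qed

text \<open>Each deletion-restriction step is multiplied by a circle, and the free coordinate
  contributes the exponent 0.\<close>

lemma ind_poly_cyl: "ind_poly n D p \<Longrightarrow> ind_poly (Suc n) (cyl n ` D) ([:0, 1:] * p)"
proof (induction rule: ind_poly.induct)
  case (ind_poly_empty n)
  show ?case using ind_poly.ind_poly_empty[of "Suc n"] by (simp add: monom_Suc)
next
  case (ind_poly_step H D n h d p D'')
  note wf = ind_poly_wf[OF ind_poly.ind_poly_step[OF ind_poly_step.hyps]]
  have D': "cyl (Suc n) ` D - {cyl (Suc n) H} = cyl (Suc n) ` (D - {H})"
    by (rule cyl_image_diff) (use wf ind_poly_step.hyps(1) in auto)
  have pre: "{u \<in> torus (Suc n). lift n (Suc n) h u \<in> cyl (Suc n) K} = cyl n {u \<in> torus n. h u \<in> K}" for K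
  proof -
    have "lift n (Suc n) h u \<in> cyl (Suc n) K \<longleftrightarrow> h (u(n := 1)) \<in> K" if u: "u \<in> torus (Suc n)" for u
    proof -
      have "h (u(n := 1)) \<in> torus (Suc n)" using emb_in[OF ind_poly_step.hyps(2) torus_Suc_forget[OF u]] .
      then show ?thesis using emb_in[OF emb_lift[OF ind_poly_step.hyps(2)] u] by (simp add: cyl_def lift_def torus_upd_self)
    qed
    then show ?thesis using torus_Suc_forget by (auto simp: cyl_def[of n])
  qed
  have "ind_poly (Suc (Suc n)) (cyl (Suc n) ` D) ([:- (d + 1), 1:] * ([:0, 1:] * p))"
  proof (rule ind_poly.ind_poly_step)
    show "cyl (Suc n) H \<in> cyl (Suc n) ` D" using ind_poly_step.hyps(1) by simp
    show "emb (Suc n) (Suc (Suc n)) (lift n (Suc n) h)" by (rule emb_lift[OF ind_poly_step.hyps(2)])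
    show "lift n (Suc n) h ` torus (Suc n) = cyl (Suc n) H"
      using lift_cyl[OF ind_poly_step.hyps(2) subset_refl] ind_poly_step.hyps(3) by (simp add: cyl_torus)
    show "ind_poly (Suc (Suc n)) (cyl (Suc n) ` D - {cyl (Suc n) H}) ([:- d, 1:] * ([:0, 1:] * p))"
      unfolding D' using ind_poly_step.IH(1) by (simp only: mult.left_commute)
    show "ind_poly (Suc n) (cyl n ` D'') ([:0, 1:] * p)" by (rule ind_poly_step.IH(2))
    have "components (cyl n {u \<in> torus n. h u \<in> K}) = cyl n ` components {u \<in> torus n. h u \<in> K}" if "K \<in> D - {H}" for K
      using components_cyl[OF ind_poly_restr_tor_union[OF ind_poly_step.hyps(2)]] wf that by blast
    then show "cyl n ` D'' = (\<Union>K\<in>cyl (Suc n) ` D - {cyl (Suc n) H}. components {u \<in> torus (Suc n). lift n (Suc n) h u \<in> K})"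
      unfolding D' ind_poly_step.hyps(6) by (simp add: pre image_UN)
  qed
  then show ?case by (simp only: mult.left_commute)
qed

text \<open>Only the parametrisations change, to \<open>g \<circ> h\<close>; the restrictions pulled
  back along them are literally the same.\<close>

lemma ind_poly_aut: "ind_poly n D p \<Longrightarrow> emb n n g \<Longrightarrow> g ` torus n = torus n \<Longrightarrow> ind_poly n ((`) g ` D) p"
proof (induction arbitrary: rule: ind_poly.induct)
  case (ind_poly_empty n)
  show ?case using ind_poly.ind_poly_empty by simp
next
  case (ind_poly_step H D n h d p D'')
  note wf = ind_poly_wf[OF ind_poly.ind_poly_step[OF ind_poly_step.hyps]]
  have inj: "inj_on g (torus (Suc n))" using emb_inj ind_poly_step.prems by blast
  have D': "(`) g ` D - {g ` H} = (`) g ` (D - {H})"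
    by (rule image_diff_single[OF inj _ ind_poly_step.hyps(1), symmetric]) (use wf in auto)
  have pre: "{u \<in> torus n. (g \<circ> h) u \<in> g ` K} = {u \<in> torus n. h u \<in> K}" if "K \<in> D - {H}" for K
  proof -
    have "K \<subseteq> torus (Suc n)" using wf that by blast
    then show ?thesis using inj_on_image_mem_iff[OF inj emb_in[OF ind_poly_step.hyps(2)]] by auto
  qed
  show ?case
  proof (rule ind_poly.ind_poly_step)
    show "g ` H \<in> (`) g ` D" using ind_poly_step.hyps(1) by simp
    show "emb n (Suc n) (g \<circ> h)" using emb_comp[OF ind_poly_step.hyps(2) ind_poly_step.prems(1)] .
    show "(g \<circ> h) ` torus n = g ` H" using ind_poly_step.hyps(3) by auto
    show "ind_poly (Suc n) ((`) g ` D - {g ` H}) ([:- d, 1:] * p)"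
      unfolding D' by (rule ind_poly_step.IH(1)[OF ind_poly_step.prems])
    show "ind_poly n D'' p" by (rule ind_poly_step.hyps(5))
    show "D'' = (\<Union>K\<in>(`) g ` D - {g ` H}. components {u \<in> torus n. (g \<circ> h) u \<in> K})"
      unfolding D' ind_poly_step.hyps(6) using pre by simp
  qed
qed

section \<open>Splitting off the last coordinate by sections\<close>

definition graph :: "nat \<Rightarrow> (pt \<Rightarrow> complex) \<Rightarrow> pt set" where
  "graph n f = {x \<in> torus (Suc n). x n = f (x(n := 1))}"

text \<open>The condition under which restricting to one section makes the other add nothing to
  \<open>D\<close>. Sections that never meet are compatible, as the empty set has no
  components.\<close>

definition compat :: "nat \<Rightarrow> pt set set \<Rightarrow> (pt \<Rightarrow> complex) \<Rightarrow> (pt \<Rightarrow> complex) \<Rightarrow> bool" where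
  "compat n D f g \<longleftrightarrow> (\<exists>u\<in>torus n. f u \<noteq> g u) \<and> components {u \<in> torus n. f u = g u} \<subseteq> D"

lemma graph_mem: assumes "mon n f" "u \<in> torus n" shows "u(n := f u) \<in> graph n g \<longleftrightarrow> f u = g u"
  using torus_Suc_upd[OF assms(2) mon_norm[OF assms]] torus_upd_self[OF assms(2)] by (simp add: graph_def)

lemma emb_graph: assumes "mon n f" shows "emb n (Suc n) (\<lambda>u. u(n := f u))" "(\<lambda>u. u(n := f u)) ` torus n = graph n f"
proof -
  have 1: "mmap n (Suc n) (\<lambda>u. u(n := f u))"
  proof (rule mmapI)
    fix i show "mon n (\<lambda>t. (t(n := f t)) i)" using assms mon_coord by (cases "i = n") auto
  qed (auto simp: torus_outside)
  show "emb n (Suc n) (\<lambda>u. u(n := f u))"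
    by (rule embI[OF 1 mmap_forget]) (simp add: torus_upd_self)
  show "(\<lambda>u. u(n := f u)) ` torus n = graph n f"
  proof safe
    fix u assume "u \<in> torus n" then show "u(n := f u) \<in> graph n f" using graph_mem[OF assms] by simp
  next
    fix x assume "x \<in> graph n f"
    then show "x \<in> (\<lambda>u. u(n := f u)) ` torus n" using torus_Suc_forget
      by (intro image_eqI[of _ _ "x(n := 1)"]) (auto simp: graph_def)
  qed
qed

lemma graph_not_cyl: assumes "mon n f" "tor n K" shows "graph n f \<noteq> cyl n K"
proof
  assume K: "graph n f = cyl n K"
  obtain u where u: "u \<in> K" using tor_ne[OF assms(2)] by blast
  have ut: "u \<in> torus n" using u tor_sub[OF assms(2)] by blast
  \<comment> \<open>A cylinder contains the whole circle over \<open>u\<close>, a graph only one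
    point of it; the antipode is a convenient second one.\<close>
  have "u(n := - f u) \<in> cyl n K"
    using torus_Suc_upd[OF ut, of "- f u"] mon_norm[OF assms(1) ut] u torus_upd_self[OF ut] by (simp add: cyl_def)
  then have "u(n := - f u) \<in> graph n f" using K by simp
  then have "- f u = f u" using torus_upd_self[OF ut] by (simp add: graph_def)
  then show False using mon_norm[OF assms(1) ut] by auto
qed

lemma graph_neq: "mon n f \<Longrightarrow> u \<in> torus n \<Longrightarrow> f u \<noteq> g u \<Longrightarrow> graph n f \<noteq> graph n g"
  using graph_mem[of n f u f] graph_mem[of n f u g] by auto

text \<open>The section itself parametrises its graph by \<open>torus n\<close>. In this
  parametrisation a cylinder restricts to its base and the graph of \<open>g\<close> to the locus
  \<open>f u = g u\<close>.\<close>

lemma ind_poly_step_graph: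
  assumes D1: "\<And>K. K \<in> D1 \<Longrightarrow> tor n K" and f: "mon n f"
    and G: "\<And>g. g \<in> G \<Longrightarrow> \<exists>u\<in>torus n. f u \<noteq> g u"
    and ip1: "ind_poly (Suc n) (cyl n ` D1 \<union> graph n ` G) ([:- d, 1:] * p)"
    and ip2: "ind_poly n (D1 \<union> (\<Union>g\<in>G. components {u \<in> torus n. f u = g u})) p"
  shows "ind_poly (Suc n) (insert (graph n f) (cyl n ` D1 \<union> graph n ` G)) ([:- (d + 1), 1:] * p)"
proof -
  let ?D' = "cyl n ` D1 \<union> graph n ` G"
  have ni: "graph n f \<notin> ?D'"
  proof
    assume "graph n f \<in> ?D'"
    then consider K where "K \<in> D1" "graph n f = cyl n K" | g where "g \<in> G" "graph n f = graph n g" by auto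
    then show False
    proof cases
      case 1 then show False using graph_not_cyl[OF f D1] by simp
    next
      case 2 then show False using G[OF 2(1)] graph_neq[OF f] by metis
    qed
  qed
  then have D': "insert (graph n f) ?D' - {graph n f} = ?D'" by simp
  show ?thesis
  proof (rule ind_poly.ind_poly_step[OF _ emb_graph[OF f] _ ip2])
    show "ind_poly (Suc n) (insert (graph n f) ?D' - {graph n f}) ([:- d, 1:] * p)"
      unfolding D' by (rule ip1)
    have 1: "components {u \<in> torus n. u(n := f u) \<in> cyl n K} = {K}" if "K \<in> D1" for K
    proof -
      have "K \<subseteq> torus n" using tor_sub[OF D1[OF that]] .
      then have "{u \<in> torus n. u(n := f u) \<in> cyl n K} = K"
        using torus_Suc_upd[OF _ mon_norm[OF f]] torus_upd_self by (auto simp: cyl_def)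
      then show ?thesis using components_tor[OF D1[OF that]] by simp
    qed
    have 2: "{u \<in> torus n. u(n := f u) \<in> graph n g} = {u \<in> torus n. f u = g u}" for g
      using graph_mem[OF f] by auto
    show "D1 \<union> (\<Union>g\<in>G. components {u \<in> torus n. f u = g u}) =
      (\<Union>K\<in>insert (graph n f) ?D' - {graph n f}. components {u \<in> torus n. u(n := f u) \<in> K})"
      unfolding D' UN_Un using 1 by (simp add: 2)
  qed simp
qed

text \<open>By compatibility the restriction to each section is \<open>D\<close> again, whichever
  sections are still present. This is the toric counterpart of a fibre-type, or supersolvable,
  step.\<close>

lemma ind_poly_peel:
  assumes ind_poly: "ind_poly n D p"
  shows "\<forall>f\<in>set fs. mon n f \<Longrightarrow> sorted_wrt (compat n D) fs \<Longrightarrow>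
    ind_poly (Suc n) (cyl n ` D \<union> graph n ` set fs) ([:- int (length fs), 1:] * p)"
proof (induction fs)
  case Nil
  show ?case using ind_poly_cyl[OF ind_poly] by simp
next
  case (Cons f fs)
  have co: "compat n D f g" if "g \<in> set fs" for g using Cons.prems that by simp
  have "D \<union> (\<Union>g\<in>set fs. components {u \<in> torus n. f u = g u}) = D"
    using co unfolding compat_def by (intro Un_absorb2 UN_least) simp
  then have "ind_poly (Suc n) (insert (graph n f) (cyl n ` D \<union> graph n ` set fs)) ([:- (int (length fs) + 1), 1:] * p)"
    using ind_poly_wf[OF ind_poly] Cons co ind_poly by (intro ind_poly_step_graph) (auto simp: compat_def)
  then show ?case by (simp add: add.commute)
qed

section \<open>Shifted arrangements of type B\<close>

definition hyp_c :: "nat \<Rightarrow> complex \<Rightarrow> nat \<Rightarrow> pt set" where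
  "hyp_c n c i = {x \<in> torus n. x i = c}"

definition hyp_eq :: "nat \<Rightarrow> nat \<Rightarrow> nat \<Rightarrow> pt set" where
  "hyp_eq n i j = {x \<in> torus n. x i = x j}"

definition hyp_inv :: "nat \<Rightarrow> nat \<Rightarrow> nat \<Rightarrow> pt set" where
  "hyp_inv n i j = {x \<in> torus n. x i * x j = 1}"

lemma hyp_eq_commute: "hyp_eq n i j = hyp_eq n j i" by (auto simp: hyp_eq_def)
lemma hyp_inv_commute: "hyp_inv n i j = hyp_inv n j i" by (auto simp: hyp_inv_def mult.commute)

lemma tor_hyp_c: "i < n \<Longrightarrow> torsion c \<Longrightarrow> tor n (hyp_c n c i)"
  unfolding hyp_c_def by (rule tor_solve) (auto intro: mon_const)

lemma cyl_hyp_c: "i < n \<Longrightarrow> cyl n (hyp_c n c i) = hyp_c (Suc n) c i"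
  using torus_Suc_forget by (auto simp: cyl_def hyp_c_def)
lemma cyl_hyp_eq: "i < n \<Longrightarrow> j < n \<Longrightarrow> cyl n (hyp_eq n i j) = hyp_eq (Suc n) i j"
  using torus_Suc_forget by (auto simp: cyl_def hyp_eq_def)
lemma cyl_hyp_inv: "i < n \<Longrightarrow> j < n \<Longrightarrow> cyl n (hyp_inv n i j) = hyp_inv (Suc n) i j"
  using torus_Suc_forget by (auto simp: cyl_def hyp_inv_def)

lemma graph_const: "graph n (\<lambda>_. c) = hyp_c (Suc n) c n"
  by (auto simp: graph_def hyp_c_def)
lemma graph_coord: "j < n \<Longrightarrow> graph n (\<lambda>x. x j) = hyp_eq (Suc n) n j"
  by (auto simp: graph_def hyp_eq_def)
lemma graph_inverse: "j < n \<Longrightarrow> graph n (\<lambda>x. inverse (x j)) = hyp_inv (Suc n) n j"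
  by (auto simp: graph_def hyp_inv_def torus_nonzero intro: inverse_unique) (metis inverse_unique mult.commute)

text \<open>The function \<open>m\<close> encodes a graph in which the neighbours of \<open>i\<close> below \<open>i\<close> are the \<open>j < m i\<close>; its edges
contribute the hypertori \<open>x i * x j = 1\<close>. Hypertori \<open>x i = -1\<close> with \<open>i < s\<close> arise by restriction to such an edge.\<close>

definition sh_arr :: "nat \<Rightarrow> nat \<Rightarrow> (nat \<Rightarrow> nat) \<Rightarrow> pt set set" where
  "sh_arr n s m = hyp_c n 1 ` {..<n} \<union> hyp_c n (-1) ` {..<s} \<union> (\<Union>i<n. hyp_eq n i ` {..<i}) \<union> (\<Union>i<n. hyp_inv n i ` {..<m i})"

definition sections :: "nat \<Rightarrow> nat \<Rightarrow> (pt \<Rightarrow> complex) list" where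
  "sections n k = (\<lambda>_. 1) # map (\<lambda>j x. x j) [0..<n] @ map (\<lambda>j x. inverse (x j)) [0..<k]"

lemma sh_arr_Suc:
  assumes "s \<le> n" "\<forall>i\<le>n. m i \<le> i"
  shows "sh_arr (Suc n) s m = cyl n ` sh_arr n s m \<union> graph n ` set (sections n (m n))"
proof -
  have 1: "cyl n ` (hyp_c n c ` {..<k}) = hyp_c (Suc n) c ` {..<k}" if "k \<le> n" for c k
    unfolding image_image by (rule image_cong) (use that cyl_hyp_c in auto)
  have 2: "cyl n ` (\<Union>i<n. hyp_eq n i ` {..<i}) = (\<Union>i<n. hyp_eq (Suc n) i ` {..<i})"
    unfolding image_UN image_image by (intro SUP_cong image_cong) (auto simp: cyl_hyp_eq)
  have 3: "cyl n ` (\<Union>i<n. hyp_inv n i ` {..<m i}) = (\<Union>i<n. hyp_inv (Suc n) i ` {..<m i})"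
    unfolding image_UN image_image
  proof (intro SUP_cong image_cong refl cyl_hyp_inv)
    fix i j assume "i \<in> {..<n}" "j \<in> {..<m i}"
    moreover have "m i \<le> i" if "i < n" using assms(2) that by simp
    ultimately show "i < n" "j < n" by auto
  qed
  have 4: "graph n ` set (map (\<lambda>j x. x j) [0..<n]) = hyp_eq (Suc n) n ` {..<n}"
    unfolding set_map image_image by (intro image_cong) (auto simp: graph_coord)
  have "m n \<le> n" using assms(2) by simp
  then have 5: "graph n ` set (map (\<lambda>j x. inverse (x j)) [0..<m n]) = hyp_inv (Suc n) n ` {..<m n}"
    unfolding set_map image_image by (intro image_cong) (auto simp: graph_inverse)
  have 6: "graph n ` set (sections n (m n)) = insert (hyp_c (Suc n) 1 n) (hyp_eq (Suc n) n ` {..<n} \<union> hyp_inv (Suc n) n ` {..<m n})"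
    unfolding sections_def list.set set_append image_insert image_Un 4 5 graph_const ..
  show ?thesis unfolding 6 unfolding sh_arr_def image_Un 1[OF order_refl] 1[OF assms(1)] 2 3
    unfolding lessThan_Suc by auto
qed

text \<open>If \<open>j\<close> is a neighbour of \<open>i\<close> and \<open>j < k \<le> i\<close>,
  then \<open>j\<close> is a neighbour of \<open>k\<close>. As neighbours below a vertex form an
  initial segment, both ends of an edge may be lowered; ideals give precisely this closure.\<close>

definition shifted :: "nat \<Rightarrow> (nat \<Rightarrow> nat) \<Rightarrow> bool" where
  "shifted n m \<longleftrightarrow> (\<forall>i<n. m i \<le> i \<and> (\<forall>k\<le>i. min (m i) k \<le> m k))"

lemma shifted_le: "shifted n m \<Longrightarrow> i < n \<Longrightarrow> m i \<le> i"
  by (simp add: shifted_def)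

lemma shifted_min: "shifted n m \<Longrightarrow> i < n \<Longrightarrow> k \<le> i \<Longrightarrow> min (m i) k \<le> m k"
  unfolding shifted_def by blast

lemma hyp_c_in: "i < n \<Longrightarrow> hyp_c n 1 i \<in> sh_arr n s m" by (auto simp: sh_arr_def)
lemma hyp_c_minus_in: "i < s \<Longrightarrow> hyp_c n (-1) i \<in> sh_arr n s m" by (auto simp: sh_arr_def)

lemma hyp_eq_in: assumes "i < n" "j < n" "i \<noteq> j" shows "hyp_eq n i j \<in> sh_arr n s m"
proof -
  have *: "hyp_eq n i j \<in> sh_arr n s m" if "j < i" "i < n" for i j
    using that unfolding sh_arr_def by (intro UnI1[of _ _ "\<Union>i<n. hyp_inv n i ` {..<m i}"] UnI2 UN_I[of i]) auto
  show ?thesis using *[of j i] *[of i j] assms hyp_eq_commute[of n i j] by (cases "j < i") auto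
qed

lemma hyp_inv_in: assumes "i < n" "j < n" "j < m i \<or> i < m j" shows "hyp_inv n i j \<in> sh_arr n s m"
proof -
  have *: "hyp_inv n i j \<in> sh_arr n s m" if "j < m i" "i < n" for i j
    using that unfolding sh_arr_def by (intro UnI2 UN_I[of i]) auto
  show ?thesis using *[of j i] *[of i j] assms hyp_inv_commute[of n i j] by (cases "j < m i") auto
qed

text \<open>A neighbour of the last vertex is adjacent to every other vertex: lower the end
  \<open>n\<close> of its edge.\<close>

lemma shifted_adj: assumes "shifted (Suc n) m" "j < m n" "i < n" "i \<noteq> j" shows "j < m i \<or> i < m j"
proof (cases "j < i")
  case True
  then show ?thesis using shifted_min[OF assms(1), of n i] assms by (auto simp: min_def split: if_splits)
next
  case False
  have "j < n" using shifted_le[OF assms(1), of n] assms(2) by simp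
  then show ?thesis using shifted_min[OF assms(1), of n j] assms False by (auto simp: min_def split: if_splits)
qed

lemma hyp_inv_in_dom: assumes "shifted (Suc n) m" "j < m n" "i < n" "i \<noteq> j" shows "hyp_inv n i j \<in> sh_arr n s m"
  using shifted_adj[OF assms] shifted_le[OF assms(1), of n] assms by (intro hyp_inv_in) auto

lemma compat_mem: assumes "ind_poly n D p" "{u \<in> torus n. f u = g u} \<in> D" shows "compat n D f g"
proof -
  have "tor n {u \<in> torus n. f u = g u}" "{u \<in> torus n. f u = g u} \<noteq> torus n" using ind_poly_wf[OF assms(1)] assms(2) by blast+
  then show ?thesis unfolding compat_def using assms(2) by (auto simp: components_tor)
qed

lemma components_two: assumes "j < n" shows "components {u \<in> torus n. u j = inverse (u j)} = {hyp_c n 1 j, hyp_c n (-1) j}"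
proof -
  have "u j = inverse (u j) \<longleftrightarrow> u j = 1 \<or> u j = -1" if "u \<in> torus n" for u
    using torus_nonzero[OF that, of j] power2_eq_1_iff[of "u j"]
    by (metis field_class.field_inverse inverse_1 inverse_minus_eq mult.commute power2_eq_square)
  then have "{u \<in> torus n. u j = inverse (u j)} = \<Union>{hyp_c n 1 j, hyp_c n (-1) j}" by (auto simp: hyp_c_def)
  moreover have "disjoint {hyp_c n 1 j, hyp_c n (-1) j}" by (auto simp: disjoint_def hyp_c_def)
  moreover have "tor n C" if "C \<in> {hyp_c n 1 j, hyp_c n (-1) j}" for C
    using that tor_hyp_c[OF assms torsion_1] tor_hyp_c[OF assms torsion_minus_1] by blast
  ultimately show ?thesis using components_disjoint_torsion[of "{hyp_c n 1 j, hyp_c n (-1) j}" n] by simp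
qed

lemma imaginary_pt: "j < n \<Longrightarrow> \<exists>u\<in>torus n. u j \<noteq> inverse (u j)"
  by (rule bexI[of _ "(\<lambda>_. 1)(j := \<i>)"]) (auto intro: torus_upd simp: complex_eq_iff)

lemma mon_sections: "\<forall>f\<in>set (sections n k). mon n f"
  by (auto simp: sections_def intro: mon_coord mon_inverse)

lemma inverse_eq_iff_mult: "(b::complex) \<noteq> 0 \<Longrightarrow> a = inverse b \<longleftrightarrow> a * b = 1"
  by (auto simp: field_simps)

lemma set_one_inverse: "{u \<in> torus n. 1 = inverse (u j)} = hyp_c n 1 j"
  by (auto simp: hyp_c_def)
lemma set_coord_inverse: "{u \<in> torus n. u i = inverse (u j)} = hyp_inv n i j"
  using torus_nonzero by (auto simp: hyp_inv_def inverse_eq_iff_mult)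
lemma set_inverse_inverse: "{u \<in> torus n. inverse (u i) = inverse (u j)} = hyp_eq n i j"
  by (auto simp: hyp_eq_def)
lemma set_one_coord: "{u \<in> torus n. 1 = u j} = hyp_c n 1 j"
  by (auto simp: hyp_c_def)

lemma sorted_wrt_map_upt: "(\<And>i j. i < j \<Longrightarrow> j < k \<Longrightarrow> R (f i) (f j)) \<Longrightarrow> sorted_wrt R (map f [0..<k])"
  by (simp add: sorted_wrt_iff_nth_less)

text \<open>Only \<open>x j\<close> and \<open>1 / x j\<close> meet in a disconnected set, and
  \<open>m n \<le> s\<close> ensures that its component \<open>x j = -1\<close> is present. For
  \<open>i \<noteq> j\<close>, \<open>x i\<close> and \<open>1 / x j\<close> meet in a hypertorus of
  the base because \<open>j\<close> is adjacent to every other vertex.\<close>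

lemma sections_compat:
  assumes ind_poly: "ind_poly n (sh_arr n s m) p" and sh: "shifted (Suc n) m" and ms: "m n \<le> s"
  shows "sorted_wrt (compat n (sh_arr n s m)) (sections n (m n))"
proof -
  have mn: "m n \<le> n" using shifted_le[OF sh, of n] by simp
  note c = compat_mem[OF ind_poly]
  have c1: "compat n (sh_arr n s m) (\<lambda>_. 1) (\<lambda>x. x j)" if "j < n" for j
    by (rule c, unfold set_one_coord, rule hyp_c_in[OF that])
  have c2: "compat n (sh_arr n s m) (\<lambda>_. 1) (\<lambda>x. inverse (x j))" if "j < m n" for j
    by (rule c, unfold set_one_inverse, rule hyp_c_in) (use that mn in simp)
  have c3: "compat n (sh_arr n s m) (\<lambda>x. x i) (\<lambda>x. x j)" if "i < n" "j < n" "i < j" for i j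
    by (rule c, fold hyp_eq_def, rule hyp_eq_in) (use that in auto)
  have c4: "compat n (sh_arr n s m) (\<lambda>x. inverse (x i)) (\<lambda>x. inverse (x j))" if "i < m n" "j < m n" "i < j" for i j
    by (rule c, unfold set_inverse_inverse, rule hyp_eq_in) (use that mn in auto)
  have c5: "compat n (sh_arr n s m) (\<lambda>x. x i) (\<lambda>x. inverse (x j))" if ij: "i < n" "j < m n" for i j
  proof (cases "i = j")
    case True
    then show ?thesis unfolding compat_def
      using components_two[of j n] imaginary_pt[of j n] ij mn ms hyp_c_in[of j n s m] hyp_c_minus_in[of j s n m] by simp
  next
    case False
    show ?thesis by (rule c, unfold set_coord_inverse, rule hyp_inv_in_dom[OF sh ij(2,1) False])
  qed
  show ?thesis
    unfolding sections_def sorted_wrt.simps sorted_wrt_append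
  proof (intro conjI ballI)
    fix g :: "pt \<Rightarrow> complex" assume "g \<in> set (map (\<lambda>j x. x j) [0..<n] @ map (\<lambda>j x. inverse (x j)) [0..<m n])"
    then show "compat n (sh_arr n s m) (\<lambda>_. 1) g" by (auto intro: c1 c2)
  next
    show "sorted_wrt (compat n (sh_arr n s m)) (map (\<lambda>j x. x j) [0..<n])"
      by (rule sorted_wrt_map_upt) (use c3 in auto)
    show "sorted_wrt (compat n (sh_arr n s m)) (map (\<lambda>j x. inverse (x j)) [0..<m n])"
      by (rule sorted_wrt_map_upt) (use c4 in auto)
  next
    fix f g :: "pt \<Rightarrow> complex" assume "f \<in> set (map (\<lambda>j x. x j) [0..<n])" "g \<in> set (map (\<lambda>j x. inverse (x j)) [0..<m n])"
    then obtain i j where "i < n" "j < m n" "f = (\<lambda>x. x i)" "g = (\<lambda>x. inverse (x j))" by auto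
    then show "compat n (sh_arr n s m) f g" using c5 by simp
  qed
qed

text \<open>In the first two clauses the coordinate splits off and the exponent counts the sections
  1, \<open>x j\<close>, \<open>1 / x j\<close> and possibly -1. In the third, deleting the top edge
  at \<open>n\<close> leaves a restriction with one more hypertorus \<open>x i = -1\<close>. That
  base appears instead, with an exponent smaller by one.\<close>

fun sh_poly :: "(nat \<Rightarrow> nat) \<Rightarrow> nat \<Rightarrow> nat \<Rightarrow> int poly" where
  "sh_poly m 0 s = 1"
| "sh_poly m (Suc n) s = (if s > n then [:- int (n + 2 + m n), 1:] * sh_poly m n n
     else if m n \<le> s then [:- int (n + 1 + m n), 1:] * sh_poly m n s
     else [:- int (n + m n), 1:] * sh_poly m n (Suc s))"

lemma sh_poly_cong: "(\<And>i. i < n \<Longrightarrow> m i = m' i) \<Longrightarrow> sh_poly m n s = sh_poly m' n s"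
  by (induction n arbitrary: s) auto

lemma shifted_Suc: "shifted (Suc n) m \<Longrightarrow> shifted n m"
  by (auto simp: shifted_def)

lemma linear_factors_swap:
  "a = d \<Longrightarrow> b = c \<Longrightarrow> [:- int a, 1:] * ([:- int b, 1:] * p) = [:- int c, 1:] * ([:- int d, 1:] * p)"
  by (simp only: mult.left_commute)

text \<open>Raising \<open>s\<close> by one turns a single exponent \<open>n + s\<close> into
  \<open>n + s + 1\<close>. The condition says that the vertices up to \<open>s\<close> are adjacent
  to all others. The change happens at the rank where \<open>s = N\<close> or
  \<open>m N = Suc s\<close>; at any rank above, both sides share a factor and the claim passes to
  \<open>Suc s\<close> one rank lower.\<close>

lemma sh_poly_identity:
  "shifted n m \<Longrightarrow> Suc s \<le> n \<Longrightarrow> \<forall>i<n. min (Suc s) i \<le> m i \<Longrightarrow>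
    [:- int (n + s + 1), 1:] * sh_poly m n s = [:- int (n + s), 1:] * sh_poly m n (Suc s)"
proof (induction n arbitrary: s)
  case (Suc N)
  have mN: "m N \<le> N" using shifted_le[OF Suc.prems(1), of N] by simp
  have d: "min (Suc s) N \<le> m N" using Suc.prems(3) by simp
  show ?case
  proof (cases "s = N")
    case True
    then have "m N = N" using mN d by simp
    then have 1: "sh_poly m (Suc N) s = [:- int (N + 1 + N), 1:] * sh_poly m N N"
      and 2: "sh_poly m (Suc N) (Suc s) = [:- int (N + 2 + N), 1:] * sh_poly m N N" using True by simp_all
    show ?thesis unfolding 1 2 by (rule linear_factors_swap) (use True in auto)
  next
    case False
    then have sN: "Suc s \<le> N" using Suc.prems(2) by simp
    then have ms: "Suc s \<le> m N" using d by simp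
    show ?thesis
    proof (cases "m N = Suc s")
      case True
      then have 1: "sh_poly m (Suc N) s = [:- int (N + m N), 1:] * sh_poly m N (Suc s)"
        and 2: "sh_poly m (Suc N) (Suc s) = [:- int (N + 1 + m N), 1:] * sh_poly m N (Suc s)" using sN by simp_all
      show ?thesis unfolding 1 2 by (rule linear_factors_swap) (use True in auto)
    next
      case False
      \<comment> \<open>As \<open>m N\<close> exceeds \<open>Suc s\<close>, the vertex
        \<open>Suc s\<close> is a neighbour of \<open>N\<close> and hence adjacent to all
        others.\<close>
      have "\<forall>i<N. min (Suc (Suc s)) i \<le> m i"
      proof (intro allI impI)
        fix i assume "i < N"
        then show "min (Suc (Suc s)) i \<le> m i" using shifted_min[OF Suc.prems(1), of N i] ms False by simp
      qed
      then have IH: "[:- int (N + Suc s + 1), 1:] * sh_poly m N (Suc s) = [:- int (N + Suc s), 1:] * sh_poly m N (Suc (Suc s))"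
        using Suc.IH[of "Suc s"] shifted_Suc[OF Suc.prems(1)] ms False mN by simp
      have 1: "sh_poly m (Suc N) s = [:- int (N + m N), 1:] * sh_poly m N (Suc s)" using ms sN by simp
      have 2: "sh_poly m (Suc N) (Suc s) = [:- int (N + m N), 1:] * sh_poly m N (Suc (Suc s))" using ms sN False by simp
      have "[:- int (Suc N + s + 1), 1:] * sh_poly m (Suc N) s = [:- int (N + m N), 1:] * ([:- int (N + Suc s + 1), 1:] * sh_poly m N (Suc s))"
        unfolding 1 by (simp only: mult.left_commute add_Suc add_Suc_right)
      also have "\<dots> = [:- int (Suc N + s), 1:] * sh_poly m (Suc N) (Suc s)"
        unfolding IH 2 by (simp only: mult.left_commute add_Suc add_Suc_right)
      finally show ?thesis .
    qed
  qed
qed simp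

lemma reindex_image:
  assumes "\<And>i. \<tau> (\<tau> i) = i" "\<And>j. j \<ge> n \<Longrightarrow> \<tau> j \<ge> n"
  shows "(\<lambda>u. u \<circ> \<tau>) ` {x \<in> torus n. P x} = {x \<in> torus n. P (x \<circ> \<tau>)}"
proof -
  have m: "x \<circ> \<tau> \<in> torus n" if "x \<in> torus n" for x using mmap_in[OF mmap_reindex[OF assms(2)] that] .
  have i: "(x \<circ> \<tau>) \<circ> \<tau> = x" for x :: pt using assms(1) by (auto simp: fun_eq_iff)
  show ?thesis
  proof safe
    fix x assume "x \<in> torus n" "P x" then show "x \<circ> \<tau> \<in> torus n" "P ((x \<circ> \<tau>) \<circ> \<tau>)" using m i by auto
  next
    fix x assume "x \<in> torus n" "P (x \<circ> \<tau>)"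
    then show "x \<in> (\<lambda>u. u \<circ> \<tau>) ` {x \<in> torus n. P x}" using m i by (intro image_eqI[of _ _ "x \<circ> \<tau>"]) auto
  qed
qed

lemma emb_reindex:
  assumes "\<And>i. \<tau> (\<tau> i) = i" "\<And>j. j \<ge> n \<Longrightarrow> \<tau> j \<ge> n"
  shows "emb n n (\<lambda>u. u \<circ> \<tau>)" "(\<lambda>u. u \<circ> \<tau>) ` torus n = torus n"
proof -
  have m: "mmap n n (\<lambda>u. u \<circ> \<tau>)" by (rule mmap_reindex[OF assms(2)])
  show "emb n n (\<lambda>u. u \<circ> \<tau>)" by (rule embI[OF m m]) (use assms(1) in \<open>auto simp: fun_eq_iff\<close>)
  show "(\<lambda>u. u \<circ> \<tau>) ` torus n = torus n" using reindex_image[OF assms, of "\<lambda>_. True"] by simp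
qed

lemma sh_arr_cases:
  assumes "K \<in> sh_arr n s m"
  obtains i where "i < n" "K = hyp_c n 1 i" | i where "i < s" "K = hyp_c n (-1) i"
    | i j where "i < n" "j < i" "K = hyp_eq n i j" | i j where "i < n" "j < m i" "K = hyp_inv n i j"
  using assms unfolding sh_arr_def by auto

text \<open>Below \<open>m n\<close> every vertex is adjacent to all others, so exchanging the coordinates \<open>s\<close> and \<open>k\<close> preserves the graph.\<close>

lemma sh_arr_swap:
  assumes sh: "shifted (Suc n) m" and k: "k < m n" "s \<le> k"
    and ind_poly: "ind_poly n (sh_arr n (Suc s) m) p"
  shows "ind_poly n (insert (hyp_c n (-1) k) (sh_arr n s m)) p"
proof -
  define \<tau> where "\<tau> = Transposition.transpose s k"
  have mn: "m n \<le> n" using shifted_le[OF sh, of n] by simp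
  have kn: "k < n" "s < n" using k mn by auto
  have tt: "\<tau> (\<tau> i) = i" for i by (simp add: \<tau>_def)
  have to: "\<tau> j \<ge> n" if "j \<ge> n" for j using that kn by (auto simp: \<tau>_def Transposition.transpose_def)
  have tn: "\<tau> j < n" if "j < n" for j using that kn by (auto simp: \<tau>_def Transposition.transpose_def)
  let ?g = "\<lambda>u::pt. u \<circ> \<tau>"
  have gc: "?g ` hyp_c n c i = hyp_c n c (\<tau> i)" for c i
    unfolding hyp_c_def using reindex_image[of \<tau> n "\<lambda>x. x i = c"] tt to by simp
  have ge: "?g ` hyp_eq n i j = hyp_eq n (\<tau> i) (\<tau> j)" for i j
    unfolding hyp_eq_def using reindex_image[of \<tau> n "\<lambda>x. x i = x j"] tt to by simp
  have gi: "?g ` hyp_inv n i j = hyp_inv n (\<tau> i) (\<tau> j)" for i j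
    unfolding hyp_inv_def using reindex_image[of \<tau> n "\<lambda>x. x i * x j = 1"] tt to by simp
  have inj: "\<tau> i \<noteq> \<tau> j" if "i \<noteq> j" for i j using tt that by metis
  have inv_in: "hyp_inv n (\<tau> i) (\<tau> j) \<in> sh_arr n r m" if ij: "i < n" "j < m i" for i j r
  proof -
    have ji: "j < i" using ij shifted_le[OF sh, of i] by simp
    have n: "\<tau> i < n" "\<tau> j < n" "\<tau> i \<noteq> \<tau> j" using tn ij ji inj[of i j] by auto
    have "\<tau> a < m n \<or> \<tau> a = a" for a
      using k by (simp add: \<tau>_def Transposition.transpose_def)
    then consider "\<tau> j < m n" | "\<tau> i < m n" | "\<tau> i = i" "\<tau> j = j" by blast
    then show ?thesis
    proof cases
      case 1 then show ?thesis using hyp_inv_in_dom[OF sh 1 n(1,3)] by simp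
    next
      case 2 then show ?thesis using hyp_inv_in_dom[OF sh 2 n(2)] n(3) hyp_inv_commute by metis
    next
      case 3 then show ?thesis using ij ji by (intro hyp_inv_in) auto
    qed
  qed
  let ?E = "insert (hyp_c n (-1) k) (sh_arr n s m)"
  have A: "?g ` K \<in> ?E" if "K \<in> sh_arr n (Suc s) m" for K
    using that
  proof (cases rule: sh_arr_cases)
    case (1 i) then show ?thesis using gc hyp_c_in[OF tn] by simp
  next
    case (2 i)
    have "\<tau> i = k \<or> \<tau> i < s" using 2(1) k(2) by (auto simp: \<tau>_def Transposition.transpose_def)
    then show ?thesis using 2(2) gc hyp_c_minus_in by auto
  next
    case (3 i j) then show ?thesis using ge hyp_eq_in[OF tn tn inj] by simp
  next
    case (4 i j) then show ?thesis using gi inv_in by simp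
  qed
  have B: "?g ` K \<in> sh_arr n (Suc s) m" if "K \<in> ?E" for K
  proof (cases "K = hyp_c n (-1) k")
    case True
    then show ?thesis using gc hyp_c_minus_in[of s "Suc s"] by (simp add: \<tau>_def)
  next
    case False
    then have "K \<in> sh_arr n s m" using that by simp
    then show ?thesis
    proof (cases rule: sh_arr_cases)
      case (1 i) then show ?thesis using gc hyp_c_in[OF tn] by simp
    next
      case (2 i)
      then have "\<tau> i = i" using k(2) by (auto simp: \<tau>_def Transposition.transpose_def)
      then show ?thesis using 2 gc hyp_c_minus_in[of i "Suc s"] by simp
    next
      case (3 i j) then show ?thesis using ge hyp_eq_in[OF tn tn inj] by simp
    next
      case (4 i j) then show ?thesis using gi inv_in by simp
    qed
  qed
  have "?E \<subseteq> (`) ?g ` sh_arr n (Suc s) m"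
  proof
    fix K assume K: "K \<in> ?E"
    have "?g ` ?g ` K = K" using tt by (simp add: image_image o_def)
    then show "K \<in> (`) ?g ` sh_arr n (Suc s) m" using B[OF K] by (metis image_eqI)
  qed
  moreover have "(`) ?g ` sh_arr n (Suc s) m \<subseteq> ?E" using A by (rule image_subsetI)
  ultimately have "(`) ?g ` sh_arr n (Suc s) m = ?E" by (rule subset_antisym[rotated])
  then show ?thesis using ind_poly_aut[OF ind_poly emb_reindex[of \<tau> n]] tt to by simp
qed

lemma set_minus_coord: "{u \<in> torus n. -1 = u j} = hyp_c n (-1) j"
  by (auto simp: hyp_c_def)
lemma set_minus_inverse: "{u \<in> torus n. -1 = inverse (u j)} = hyp_c n (-1) j"
proof -
  have "-1 = inverse (u j) \<longleftrightarrow> u j = -1" for u :: pt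
    by (metis inverse_1 inverse_inverse_eq inverse_minus_eq)
  then show ?thesis by (auto simp: hyp_c_def)
qed

lemma set_inverse_one: "{u \<in> torus n. inverse (u k) = 1} = hyp_c n 1 k"
  by (auto simp: hyp_c_def)
lemma set_inverse_coord: "{u \<in> torus n. inverse (u k) = u j} = hyp_inv n j k"
  using torus_nonzero by (auto simp: hyp_inv_def field_simps)

lemma in_sections: "g \<in> set (sections n k) \<longleftrightarrow> g = (\<lambda>_. 1) \<or> (\<exists>j<n. g = (\<lambda>x. x j)) \<or> (\<exists>j<k. g = (\<lambda>x. inverse (x j)))"
  unfolding sections_def by auto

text \<open>Outer induction on the rank, inner induction on the number \<open>m n\<close> of edges
  at the last vertex. Edges are deleted from the top until \<open>m n \<le> s\<close>, when the
  coordinate splits off. For \<open>s = Suc n\<close> it splits off at once, with the extra section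
  -1.\<close>

lemma ind_poly_sh_arr: "shifted n m \<Longrightarrow> s \<le> n \<Longrightarrow> ind_poly n (sh_arr n s m) (sh_poly m n s)"
proof (induction n arbitrary: m s)
  case 0
  have "ind_poly 0 {} (monom 1 0)" by (rule ind_poly.ind_poly_empty)
  moreover have "sh_arr 0 s m = {}" using 0 by (simp add: sh_arr_def)
  ultimately show ?case by (simp add: monom_eq_1)
next
  case (Suc n)
  show ?case
  proof (cases "s = Suc n")
    case True
    have sh: "shifted n m" by (rule shifted_Suc[OF Suc.prems(1)])
    have mn: "m n \<le> n" using shifted_le[OF Suc.prems(1), of n] by simp
    have IH: "ind_poly n (sh_arr n n m) (sh_poly m n n)" by (rule Suc.IH[OF sh]) simp
    let ?fs = "(\<lambda>_. -1) # sections n (m n)"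
    have 1: "compat n (sh_arr n n m) (\<lambda>_. -1) g" if g: "g \<in> set (sections n (m n))" for g
    proof -
      consider "g = (\<lambda>_. 1)" | j where "j < n" "g = (\<lambda>x. x j)" | j where "j < m n" "g = (\<lambda>x. inverse (x j))"
        using g in_sections by blast
      then show ?thesis
      proof cases
        case 1
        \<comment> \<open>The sections -1 and 1 never meet.\<close>
        then show ?thesis by (auto simp: compat_def intro: exI[of _ "\<lambda>_. 1"])
      next
        case (2 j) show ?thesis unfolding 2(2) by (rule compat_mem[OF IH], unfold set_minus_coord, rule hyp_c_minus_in[OF 2(1)])
      next
        case (3 j) show ?thesis unfolding 3(2) by (rule compat_mem[OF IH], unfold set_minus_inverse, rule hyp_c_minus_in) (use 3 mn in simp)
      qed
    qed
    have "ind_poly (Suc n) (cyl n ` sh_arr n n m \<union> graph n ` set ?fs) ([:- int (length ?fs), 1:] * sh_poly m n n)"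
    proof (rule ind_poly_peel[OF IH])
      show "\<forall>f\<in>set ?fs. mon n f" using mon_sections by auto
      show "sorted_wrt (compat n (sh_arr n n m)) ?fs"
        using 1 sections_compat[OF IH Suc.prems(1) mn] by simp
    qed
    moreover have "cyl n ` sh_arr n n m \<union> graph n ` set ?fs = sh_arr (Suc n) s m"
    proof -
      have "cyl n ` sh_arr n n m \<union> graph n ` set ?fs = insert (hyp_c (Suc n) (-1) n) (sh_arr (Suc n) n m)"
        using sh_arr_Suc[of n n m] shifted_le[OF Suc.prems(1)] by (simp add: graph_const)
      also have "\<dots> = sh_arr (Suc n) s m" unfolding True sh_arr_def lessThan_Suc by auto
      finally show ?thesis .
    qed
    moreover have "int (length ?fs) = int (n + 2 + m n)" by (simp add: sections_def)
    ultimately show ?thesis using True by (simp only: sh_poly.simps if_True lessI)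
  next
    case False
    then have sn: "s \<le> n" using Suc.prems by simp
    \<comment> \<open>Here \<open>m\<close> is universally quantified because a deletion changes its
      value at \<open>n\<close>.\<close>
    have "ind_poly (Suc n) (sh_arr (Suc n) s m) (sh_poly m (Suc n) s)" if "m n = k" "shifted (Suc n) m" for k m
      using that
    proof (induction k arbitrary: m rule: less_induct)
      case (less k)
      note shS = less.prems(2)
      have sh: "shifted n m" by (rule shifted_Suc[OF shS])
      have mn: "m n \<le> n" using shifted_le[OF shS, of n] by simp
      have ml: "\<forall>i\<le>n. m i \<le> i" using shifted_le[OF shS] by simp
      have IH: "ind_poly n (sh_arr n s m) (sh_poly m n s)" by (rule Suc.IH[OF sh sn])
      show ?case
      proof (cases "m n \<le> s")
        case True
        have "ind_poly (Suc n) (cyl n ` sh_arr n s m \<union> graph n ` set (sections n (m n))) ([:- int (length (sections n (m n))), 1:] * sh_poly m n s)"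
          by (rule ind_poly_peel[OF IH mon_sections sections_compat[OF IH shS True]])
        moreover have "int (length (sections n (m n))) = int (n + 1 + m n)" by (simp add: sections_def)
        moreover have "sh_poly m (Suc n) s = [:- int (n + 1 + m n), 1:] * sh_poly m n s" using True sn by simp
        ultimately show ?thesis using sh_arr_Suc[OF sn ml] by simp
      next
        case False
        then obtain k' where k': "m n = Suc k'" "s \<le> k'" by (cases "m n") auto
        \<comment> \<open>Deletes the top edge at \<open>n\<close>, the one to \<open>k'\<close>;
          the graph below \<open>n\<close> is untouched.\<close>
        define m' where "m' = m(n := k')"
        have sh': "shifted (Suc n) m'"
          unfolding shifted_def
        proof (intro allI impI conjI)
          fix i assume "i < Suc n"
          then show "m' i \<le> i" using shifted_le[OF shS, of i] k' by (auto simp: m'_def)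
          fix r assume "r \<le> i"
          then show "min (m' i) r \<le> m' r"
            using shifted_min[OF shS \<open>i < Suc n\<close>, of r] k' \<open>i < Suc n\<close> by (auto simp: m'_def)
        qed
        have ip': "ind_poly (Suc n) (sh_arr (Suc n) s m') (sh_poly m' (Suc n) s)"
          by (rule less.IH[OF _ _ sh', of k']) (use k' less.prems in \<open>auto simp: m'_def\<close>)
        have m'n: "m' n = k'" by (simp add: m'_def)
        have FPm: "sh_poly m' n r = sh_poly m n r" for r by (rule sh_poly_cong) (simp add: m'_def)
        \<comment> \<open>The deletion has to exhibit the base with \<open>Suc s\<close>. For
          \<open>s < k'\<close> the recursion yields it directly; for \<open>s = k'\<close> the
          coordinate splits over the base with \<open>s\<close>, and the identity exchanges the two
          bases.\<close>
        have FPe: "sh_poly m' (Suc n) s = [:- int (n + k'), 1:] * sh_poly m n (Suc s)"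
        proof (cases "s = k'")
          case True
          have "[:- int (n + s + 1), 1:] * sh_poly m n s = [:- int (n + s), 1:] * sh_poly m n (Suc s)"
          proof (rule sh_poly_identity[OF sh])
            show "Suc s \<le> n" using mn k' True by simp
            show "\<forall>i<n. min (Suc s) i \<le> m i"
            proof (intro allI impI)
              fix i assume "i < n" then show "min (Suc s) i \<le> m i" using shifted_min[OF shS, of n i] k' True by simp
            qed
          qed
          moreover have "sh_poly m' (Suc n) s = [:- int (n + s + 1), 1:] * sh_poly m n s"
            using True sn by (simp add: FPm m'n)
          ultimately show ?thesis using True by simp
        next
          case False
          then show ?thesis using k' sn by (simp add: FPm m'n)
        qed
        have BDm: "sh_arr n s m' = sh_arr n s m" unfolding sh_arr_def by (simp add: m'_def)
        have ml': "\<forall>i\<le>n. m' i \<le> i" using shifted_le[OF sh'] by simp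
        have BD': "sh_arr (Suc n) s m' = cyl n ` sh_arr n s m \<union> graph n ` set (sections n k')"
          using sh_arr_Suc[OF sn ml'] unfolding BDm m'n .
        define f where "f = (\<lambda>x::pt. inverse (x k'))"
        have f: "mon n f" unfolding f_def by (intro mon_inverse mon_coord)
        have "set (sections n (m n)) = insert f (set (sections n k'))"
          unfolding k'(1) f_def sections_def by auto
        then have BDS: "sh_arr (Suc n) s m = insert (graph n f) (cyl n ` sh_arr n s m \<union> graph n ` set (sections n k'))"
          using sh_arr_Suc[OF sn ml] by simp
        have kn: "k' < n" using k' mn by simp
        have co: "compat n (sh_arr n s m) f g" if g: "g \<in> set (sections n k')" "g \<noteq> (\<lambda>x. x k')" for g
        proof -
          consider "g = (\<lambda>_. 1)" | j where "j < n" "g = (\<lambda>x. x j)" | j where "j < k'" "g = (\<lambda>x. inverse (x j))"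
            using g in_sections by blast
          then show ?thesis
          proof cases
            case 1
            show ?thesis unfolding 1 f_def by (rule compat_mem[OF IH], unfold set_inverse_one, rule hyp_c_in[OF kn])
          next
            case (2 j)
            then have "j \<noteq> k'" using g by auto
            show ?thesis unfolding 2(2) f_def
              by (rule compat_mem[OF IH], unfold set_inverse_coord, rule hyp_inv_in_dom[OF shS]) (use 2 \<open>j \<noteq> k'\<close> k' in auto)
          next
            case (3 j)
            show ?thesis unfolding 3(2) f_def
              by (rule compat_mem[OF IH], unfold set_inverse_inverse, rule hyp_eq_in) (use 3 kn in auto)
          qed
        qed
        have two: "components {u \<in> torus n. f u = u k'} = {hyp_c n 1 k', hyp_c n (-1) k'}"
          using components_two[OF kn] unfolding f_def by (simp only: eq_commute)
        \<comment> \<open>Among the sections only \<open>x k'\<close> meets \<open>f\<close> outside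
          the hypertori already present: \<open>x k' ^ 2 = 1\<close> contributes the component
          \<open>x k' = -1\<close>.\<close>
        have E: "sh_arr n s m \<union> (\<Union>g\<in>set (sections n k'). components {u \<in> torus n. f u = g u}) = insert (hyp_c n (-1) k') (sh_arr n s m)" (is "?L = ?R")
        proof (rule subset_antisym)
          have "components {u \<in> torus n. f u = g u} \<subseteq> ?R" if "g \<in> set (sections n k')" for g
          proof (cases "g = (\<lambda>x. x k')")
            case True
            then show ?thesis using two hyp_c_in[OF kn, of s m] by simp
          next
            case False
            then show ?thesis using co[OF that False] unfolding compat_def by (simp add: subset_insertI2)
          qed
          then show "?L \<subseteq> ?R" by (intro Un_least UN_least subset_insertI)
          have "(\<lambda>x. x k') \<in> set (sections n k')" using kn in_sections by blast
          then have "hyp_c n (-1) k' \<in> (\<Union>g\<in>set (sections n k'). components {u \<in> torus n. f u = g u})"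
            by (rule UN_I) (simp add: two)
          then show "?R \<subseteq> ?L" by (intro insert_subsetI UnI2 Un_upper1)
        qed
        \<comment> \<open>The index \<open>k'\<close> need not be \<open>s\<close>; exchanging the
          two coordinates reduces to the induction hypothesis for \<open>Suc s\<close>.\<close>
        have ipR: "ind_poly n (insert (hyp_c n (-1) k') (sh_arr n s m)) (sh_poly m n (Suc s))"
          by (rule sh_arr_swap[OF shS _ k'(2) Suc.IH[OF sh]]) (use k' mn in auto)
        have "ind_poly (Suc n) (sh_arr (Suc n) s m) ([:- (int (n + k') + 1), 1:] * sh_poly m n (Suc s))"
          unfolding BDS
        proof (rule ind_poly_step_graph[OF _ f])
          show "tor n K" if "K \<in> sh_arr n s m" for K using ind_poly_wf[OF IH] that by blast
          show "\<exists>u\<in>torus n. f u \<noteq> g u" if "g \<in> set (sections n k')" for g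
          proof (cases "g = (\<lambda>x. x k')")
            case True then show ?thesis using imaginary_pt[OF kn] unfolding f_def by metis
          next
            case False then show ?thesis using co[OF that False] unfolding compat_def by simp
          qed
          show "ind_poly (Suc n) (cyl n ` sh_arr n s m \<union> graph n ` set (sections n k')) ([:- int (n + k'), 1:] * sh_poly m n (Suc s))"
            using ip' unfolding BD' FPe .
          show "ind_poly n (sh_arr n s m \<union> (\<Union>g\<in>set (sections n k'). components {u \<in> torus n. f u = g u})) (sh_poly m n (Suc s))"
            unfolding E by (rule ipR)
        qed
        moreover have "sh_poly m (Suc n) s = [:- (int (n + k') + 1), 1:] * sh_poly m n (Suc s)"
          using k' sn by (simp add: add.commute)
        ultimately show ?thesis by simp
      qed
    qed
    then show ?thesis using Suc.prems(1) by simp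
  qed
qed

section \<open>Ideals in epsilon coordinates\<close>

text \<open>\<open>U r\<close>, \<open>V r j\<close> and \<open>W r j\<close> record whether the
  ideal contains \<open>\<epsilon>\<^sub>r\<close>,
  \<open>\<epsilon>\<^sub>r - \<epsilon>\<^sub>j\<close> and
  \<open>\<epsilon>\<^sub>r + \<epsilon>\<^sub>j\<close>, in the reversed numbering.\<close>

definition arr_B :: "nat \<Rightarrow> (nat \<Rightarrow> bool) \<Rightarrow> (nat \<Rightarrow> nat \<Rightarrow> bool) \<Rightarrow> (nat \<Rightarrow> nat \<Rightarrow> bool) \<Rightarrow> pt set set" where
  "arr_B n U V W = hyp_c n 1 ` {r. r < n \<and> U r} \<union> (\<Union>r<n. hyp_eq n r ` {j. j < r \<and> V r j})
     \<union> (\<Union>r<n. hyp_inv n r ` {j. j < r \<and> W r j})"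

lemma initial_segment: "finite S \<Longrightarrow> (\<And>x y::nat. x \<in> S \<Longrightarrow> y \<le> x \<Longrightarrow> y \<in> S) \<Longrightarrow> S = {..<card S}"
proof (induction "card S" arbitrary: S)
  case (Suc k)
  let ?M = "Max S"
  have "S \<noteq> {}" using Suc.hyps(2) by auto
  then have M: "?M \<in> S" using Suc.prems(1) by simp
  have S: "S = {..?M}"
  proof
    show "S \<subseteq> {..?M}" using Suc.prems(1) by auto
    show "{..?M} \<subseteq> S" using Suc.prems(2)[OF M] by auto
  qed
  have "card S = card {..?M}" using S by (rule arg_cong)
  then have "{..<card S} = {..?M}" by (simp add: lessThan_Suc_atMost)
  then show ?case using S by (rule trans[rotated, OF sym])
qed auto

text \<open>If \<open>\<epsilon>\<^sub>n\<close> lies in the ideal, so do all short roots and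
  differences up to \<open>n\<close>, and a shifted arrangement with \<open>s = 0\<close> remains.
  Otherwise no sum with \<open>\<epsilon>\<^sub>n\<close> lies in it either, and the sections
  \<open>x j\<close> coming from differences split off. The hypotheses spell out downward closure
  for the three kinds of roots.\<close>

lemma ind_poly_arr_B:
  assumes a: "\<And>r r'. r < l \<Longrightarrow> U r \<Longrightarrow> r' \<le> r \<Longrightarrow> U r'"
    and b: "\<And>r j. r < l \<Longrightarrow> U r \<Longrightarrow> j < r \<Longrightarrow> V r j"
    and c: "\<And>r j r' j'. r < l \<Longrightarrow> V r j \<Longrightarrow> j \<le> j' \<Longrightarrow> j' < r' \<Longrightarrow> r' \<le> r \<Longrightarrow> V r' j'"
    and d: "\<And>r j. r < l \<Longrightarrow> j < r \<Longrightarrow> W r j \<Longrightarrow> U r"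
    and e: "\<And>r j r' j'. r < l \<Longrightarrow> j < r \<Longrightarrow> W r j \<Longrightarrow> r' \<le> r \<Longrightarrow> j' \<le> j \<Longrightarrow> j' < r' \<Longrightarrow> W r' j'"
  shows "n \<le> l \<Longrightarrow> \<exists>p. ind_poly n (arr_B n U V W) p"
proof (induction n)
  case 0
  have "arr_B 0 U V W = {}" by (simp add: arr_B_def)
  then show ?case using ind_poly.ind_poly_empty[of 0] by auto
next
  case (Suc n)
  then have nl: "n < l" by simp
  obtain p where p: "ind_poly n (arr_B n U V W) p" using Suc by auto
  show ?case
  proof (cases "U n")
    case True
    have U: "U r" if "r < Suc n" for r using a[OF nl True] that by simp
    define m where "m r = card {j. j < r \<and> W r j}" for r
    have mW: "{j. j < r \<and> W r j} = {..<m r}" if "r < Suc n" for r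
      unfolding m_def
    proof (rule initial_segment)
      fix x y assume "x \<in> {j. j < r \<and> W r j}" "y \<le> x"
      then show "y \<in> {j. j < r \<and> W r j}" using e[of r x r y] that nl by simp
    qed simp
    have "shifted (Suc n) m"
      unfolding shifted_def
    proof (intro allI impI conjI)
      fix r assume r: "r < Suc n"
      have "{j. j < r \<and> W r j} \<subseteq> {..<r}" by auto
      then show "m r \<le> r" unfolding mW[OF r] by simp
      fix k assume k: "k \<le> r"
      show "min (m r) k \<le> m k"
      proof (rule ccontr)
        assume "\<not> min (m r) k \<le> m k"
        then have lt: "m k < m r" "m k < k" by auto
        then have "m k \<in> {j. j < r \<and> W r j}" unfolding mW[OF r] by simp
        then have "W k (m k)" using e[of r "m k" k "m k"] r nl k lt by simp
        then have "m k \<in> {j. j < k \<and> W k j}" using lt by simp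
        then show False unfolding mW[OF le_less_trans[OF k r]] by simp
      qed
    qed
    from ind_poly_sh_arr[OF this, of 0] have "ind_poly (Suc n) (sh_arr (Suc n) 0 m) (sh_poly m (Suc n) 0)" by simp
    moreover have "sh_arr (Suc n) 0 m = arr_B (Suc n) U V W"
    proof -
      have "{r. r < Suc n \<and> U r} = {..<Suc n}" using U by auto
      moreover have "{j. j < r \<and> V r j} = {..<r}" if "r < Suc n" for r using b[of r] U[OF that] that nl by auto
      ultimately show ?thesis unfolding arr_B_def sh_arr_def by (simp add: mW)
    qed
    ultimately show ?thesis by (intro exI[of _ "sh_poly m (Suc n) 0"]) simp
  next
    case False
    have W: "\<not> W n j" if "j < n" for j using d[OF nl that] False by blast
    let ?fs = "map (\<lambda>j x. x j) (filter (V n) [0..<n]) :: (pt \<Rightarrow> complex) list"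
    have "ind_poly (Suc n) (cyl n ` arr_B n U V W \<union> graph n ` set ?fs) ([:- int (length ?fs), 1:] * p)"
    proof (rule ind_poly_peel[OF p])
      show "\<forall>f\<in>set ?fs. mon n f" using mon_coord by auto
      have "sorted_wrt (<) (filter (V n) [0..<n])" by (rule sorted_wrt_filter) simp
      then show "sorted_wrt (compat n (arr_B n U V W)) ?fs"
        unfolding sorted_wrt_map
      proof (rule sorted_wrt_mono_rel[rotated])
        fix i j assume ij: "i \<in> set (filter (V n) [0..<n])" "j \<in> set (filter (V n) [0..<n])" "i < j"
        then have "V j i" using c[OF nl, of i i j] by simp
        then have "hyp_eq n j i \<in> arr_B n U V W" using ij unfolding arr_B_def by (intro UnI1[of _ _ "\<Union>r<n. _ r"] UnI2 UN_I[of j]) auto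
        then show "compat n (arr_B n U V W) (\<lambda>x. x i) (\<lambda>x. x j)"
          unfolding hyp_eq_commute[of n j i] unfolding hyp_eq_def by (rule compat_mem[OF p])
      qed
    qed
    moreover have "cyl n ` arr_B n U V W \<union> graph n ` set ?fs = arr_B (Suc n) U V W"
    proof -
      have 1: "cyl n ` (hyp_c n 1 ` {r. r < n \<and> U r}) = hyp_c (Suc n) 1 ` {r. r < Suc n \<and> U r}"
        unfolding image_image using False by (intro image_cong) (auto simp: cyl_hyp_c less_Suc_eq)
      have 2: "cyl n ` (\<Union>r<n. hyp_eq n r ` {j. j < r \<and> V r j}) = (\<Union>r<n. hyp_eq (Suc n) r ` {j. j < r \<and> V r j})"
        unfolding image_UN image_image by (intro SUP_cong image_cong refl cyl_hyp_eq) auto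
      have 3: "cyl n ` (\<Union>r<n. hyp_inv n r ` {j. j < r \<and> W r j}) = (\<Union>r<n. hyp_inv (Suc n) r ` {j. j < r \<and> W r j})"
        unfolding image_UN image_image by (intro SUP_cong image_cong refl cyl_hyp_inv) auto
      have 4: "graph n ` set ?fs = hyp_eq (Suc n) n ` {j. j < n \<and> V n j}"
        unfolding set_map image_image by (intro image_cong) (auto simp: graph_coord)
      have 5: "{j. j < n \<and> W n j} = {}" using W by auto
      show ?thesis unfolding 4 unfolding arr_B_def image_Un 1 2 3 unfolding lessThan_Suc by (simp add: 5 Un_ac)
    qed
    ultimately show ?thesis by (intro exI[of _ "[:- int (length ?fs), 1:] * p"]) simp
  qed
qed

section \<open>Type C in epsilon coordinates\<close>

text \<open>The root lattice of type C does not contain the \<open>\<epsilon>\<^sub>i\<close>. With vertices numbered from the end of the Dynkin diagram, the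
coordinates of its torus are \<open>2 \<epsilon>\<^sub>0\<close> (index 0) and \<open>\<epsilon>\<^sub>j - \<epsilon>\<^sub>0\<close>, so that \<open>ratio j\<close> is the
character \<open>\<epsilon>\<^sub>j - \<epsilon>\<^sub>0\<close> for every \<open>j\<close>.\<close>

definition ratio :: "nat \<Rightarrow> pt \<Rightarrow> complex" where
  "ratio j x = (if j = 0 then 1 else x j)"

definition ratio_eq :: "nat \<Rightarrow> nat \<Rightarrow> nat \<Rightarrow> pt set" where
  "ratio_eq n i j = {x \<in> torus n. ratio i x = ratio j x}"

text \<open>The root \<open>\<epsilon>\<^sub>i + \<epsilon>\<^sub>j\<close>, written as
  \<open>2 \<epsilon>\<^sub>0\<close> plus the two differences with
  \<open>\<epsilon>\<^sub>0\<close>. The case \<open>i = j\<close> is meant: it is the long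
  root.\<close>

definition ratio_inv :: "nat \<Rightarrow> nat \<Rightarrow> nat \<Rightarrow> pt set" where
  "ratio_inv n i j = {x \<in> torus n. x 0 * ratio i x * ratio j x = 1}"

lemma ratio_eq_commute: "ratio_eq n i j = ratio_eq n j i" by (auto simp: ratio_eq_def)
lemma ratio_inv_commute: "ratio_inv n i j = ratio_inv n j i" by (auto simp: ratio_inv_def mult_ac)

lemma ratio_upd: "j < n \<Longrightarrow> ratio j (x(n := z)) = ratio j x" by (simp add: ratio_def)
lemma ratio_nonzero: "x \<in> torus n \<Longrightarrow> ratio j x \<noteq> 0" by (simp add: ratio_def torus_nonzero)
lemma mon_ratio: "mon n (ratio j)" unfolding ratio_def using mon_coord by (cases "j = 0") auto

text \<open>The last coordinate solved for on the hypertorus of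
  \<open>\<epsilon>\<^sub>n + \<epsilon>\<^sub>j\<close>, \<open>j < n\<close>.\<close>

definition ratio_sec :: "nat \<Rightarrow> pt \<Rightarrow> complex" where
  "ratio_sec j x = inverse (x 0 * ratio j x)"

lemma mon_ratio_sec: "mon n (ratio_sec j)" unfolding ratio_sec_def by (intro mon_inverse mon_mult mon_coord mon_ratio)

lemma cyl_ratio_eq: "i < n \<Longrightarrow> j < n \<Longrightarrow> cyl n (ratio_eq n i j) = ratio_eq (Suc n) i j"
  using torus_Suc_forget by (auto simp: cyl_def ratio_eq_def ratio_upd)
lemma cyl_ratio_inv: "i < n \<Longrightarrow> j < n \<Longrightarrow> cyl n (ratio_inv n i j) = ratio_inv (Suc n) i j"
  using torus_Suc_forget by (auto simp: cyl_def ratio_inv_def ratio_upd)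
lemma graph_ratio: "j < n \<Longrightarrow> graph n (ratio j) = ratio_eq (Suc n) n j"
  by (auto simp: graph_def ratio_eq_def ratio_upd) (auto simp: ratio_def)
lemma graph_ratio_sec: assumes "j < n" shows "graph n (ratio_sec j) = ratio_inv (Suc n) n j"
proof -
  have "x n = ratio_sec j (x(n := 1)) \<longleftrightarrow> x 0 * ratio n x * ratio j x = 1" if x: "x \<in> torus (Suc n)" for x
  proof -
    have n: "ratio n x = x n" using assms by (simp add: ratio_def)
    have "x 0 * ratio j x \<noteq> 0" using torus_nonzero[OF x] ratio_nonzero[OF x] by simp
    then have "x n = inverse (x 0 * ratio j x) \<longleftrightarrow> x n * (x 0 * ratio j x) = 1" by (rule inverse_eq_iff_mult)
    moreover have "ratio_sec j (x(n := 1)) = inverse (x 0 * ratio j x)" using assms by (simp add: ratio_sec_def ratio_upd)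
    ultimately show ?thesis unfolding n by (simp add: mult_ac)
  qed
  then show ?thesis by (auto simp: graph_def ratio_inv_def)
qed
lemma set_ratio_ratio_sec: "{u \<in> torus n. ratio i u = ratio_sec j u} = ratio_inv n i j"
proof -
  have "ratio i x = ratio_sec j x \<longleftrightarrow> x 0 * ratio i x * ratio j x = 1" if x: "x \<in> torus n" for x
  proof -
    have "x 0 * ratio j x \<noteq> 0" using torus_nonzero[OF x] ratio_nonzero[OF x] by simp
    then have "ratio i x = inverse (x 0 * ratio j x) \<longleftrightarrow> ratio i x * (x 0 * ratio j x) = 1" by (rule inverse_eq_iff_mult)
    then show ?thesis by (simp add: ratio_sec_def mult_ac)
  qed
  then show ?thesis by (auto simp: ratio_inv_def)
qed
lemma set_ratio_sec_XJ: "{u \<in> torus n. ratio_sec i u = ratio_sec j u} = ratio_eq n i j"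
  using torus_nonzero by (auto simp: ratio_eq_def ratio_sec_def)

definition arr_C :: "nat \<Rightarrow> (nat \<Rightarrow> nat \<Rightarrow> bool) \<Rightarrow> (nat \<Rightarrow> nat \<Rightarrow> bool) \<Rightarrow> pt set set" where
  "arr_C n V W = (\<Union>r<n. ratio_eq n r ` {j. j < r \<and> V r j}) \<union> (\<Union>r<n. ratio_inv n r ` {j. j \<le> r \<and> W r j})"

lemma ratio_eq_in: "r < n \<Longrightarrow> j < r \<Longrightarrow> V r j \<Longrightarrow> ratio_eq n r j \<in> arr_C n V W"
  unfolding arr_C_def by (intro UnI1 UN_I[of r]) auto
lemma ratio_inv_in: "r < n \<Longrightarrow> j \<le> r \<Longrightarrow> W r j \<Longrightarrow> ratio_inv n r j \<in> arr_C n V W"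
  unfolding arr_C_def by (intro UnI2 UN_I[of r]) auto

text \<open>\<open>D\<close> omits the hypertorus of \<open>2 \<epsilon>\<^sub>n\<close>, which is
  no section. The sections \<open>ratio i\<close> and \<open>ratio_sec j\<close> meet in
  \<open>ratio_inv n i j\<close> even for \<open>i = j\<close>. Unlike in type B this is a single
  hypertorus, and the ideal conditions already supply it.\<close>

lemma arr_C_peel:
  assumes n: "0 < n" and p: "ind_poly n (arr_C n V W) p"
    and c: "\<And>j r' j'. V n j \<Longrightarrow> j \<le> j' \<Longrightarrow> j' < r' \<Longrightarrow> r' \<le> n \<Longrightarrow> V r' j'"
    and b: "\<And>j j'. j \<le> n \<Longrightarrow> W n j \<Longrightarrow> j' < n \<Longrightarrow> V n j'"
    and e: "\<And>j r' j'. j \<le> n \<Longrightarrow> W n j \<Longrightarrow> r' \<le> n \<Longrightarrow> j' \<le> j \<Longrightarrow> j' \<le> r' \<Longrightarrow> W r' j'"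
    and k: "k = length (filter (V n) [0..<n]) + length (filter (W n) [0..<n])"
    and D: "D = (\<Union>r<Suc n. ratio_eq (Suc n) r ` {j. j < r \<and> V r j}) \<union> (\<Union>r<n. ratio_inv (Suc n) r ` {j. j \<le> r \<and> W r j})
      \<union> ratio_inv (Suc n) n ` {j. j < n \<and> W n j}"
  shows "ind_poly (Suc n) D ([:- int k, 1:] * p)"
proof -
  let ?fs = "map ratio (filter (V n) [0..<n]) @ map ratio_sec (filter (W n) [0..<n])"
  have s: "sorted_wrt (<) (filter P [0..<n])" for P by (rule sorted_wrt_filter) simp
  have "ind_poly (Suc n) (cyl n ` arr_C n V W \<union> graph n ` set ?fs) ([:- int (length ?fs), 1:] * p)"
  proof (rule ind_poly_peel[OF p])
    show "\<forall>f\<in>set ?fs. mon n f" using mon_ratio mon_ratio_sec by auto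
    show "sorted_wrt (compat n (arr_C n V W)) ?fs"
      unfolding sorted_wrt_append
    proof (intro conjI ballI)
      show "sorted_wrt (compat n (arr_C n V W)) (map ratio (filter (V n) [0..<n]))"
        unfolding sorted_wrt_map
      proof (rule sorted_wrt_mono_rel[OF _ s])
        fix i j assume ij: "i \<in> set (filter (V n) [0..<n])" "j \<in> set (filter (V n) [0..<n])" "i < j"
        then have "ratio_eq n j i \<in> arr_C n V W" using c[of i i j] by (intro ratio_eq_in) auto
        then show "compat n (arr_C n V W) (ratio i) (ratio j)"
          unfolding ratio_eq_commute[of n j i] unfolding ratio_eq_def by (rule compat_mem[OF p])
      qed
      show "sorted_wrt (compat n (arr_C n V W)) (map ratio_sec (filter (W n) [0..<n]))"
        unfolding sorted_wrt_map
      proof (rule sorted_wrt_mono_rel[OF _ s])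
        fix i j assume ij: "i \<in> set (filter (W n) [0..<n])" "j \<in> set (filter (W n) [0..<n])" "i < j"
        then have "V j i" using c[of i i j] b[of i i] by simp
        then have "ratio_eq n j i \<in> arr_C n V W" using ij by (intro ratio_eq_in) auto
        then have "ratio_eq n i j \<in> arr_C n V W" by (simp only: ratio_eq_commute[of n i j])
        then show "compat n (arr_C n V W) (ratio_sec i) (ratio_sec j)"
          unfolding set_ratio_sec_XJ[symmetric] by (rule compat_mem[OF p])
      qed
      fix f g assume fg: "f \<in> set (map ratio (filter (V n) [0..<n]))" "g \<in> set (map ratio_sec (filter (W n) [0..<n]))"
      then obtain i j where ij: "i < n" "j < n" "W n j" "f = ratio i" "g = ratio_sec j" by auto
      have "ratio_inv n i j \<in> arr_C n V W"
      proof (cases "j \<le> i")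
        case True then show ?thesis using e[of j i j] ij by (intro ratio_inv_in) auto
      next
        case False then show ?thesis using e[of j j i] ij ratio_inv_in[of j n i W V] ratio_inv_commute[of n i j] by simp
      qed
      then show "compat n (arr_C n V W) f g"
        unfolding ij(4,5) set_ratio_ratio_sec[symmetric] by (rule compat_mem[OF p])
    qed
  qed
  moreover have "cyl n ` arr_C n V W \<union> graph n ` set ?fs = D"
  proof -
    have 2: "cyl n ` (\<Union>r<n. ratio_eq n r ` {j. j < r \<and> V r j}) = (\<Union>r<n. ratio_eq (Suc n) r ` {j. j < r \<and> V r j})"
      unfolding image_UN image_image by (intro SUP_cong image_cong refl cyl_ratio_eq) auto
    have 3: "cyl n ` (\<Union>r<n. ratio_inv n r ` {j. j \<le> r \<and> W r j}) = (\<Union>r<n. ratio_inv (Suc n) r ` {j. j \<le> r \<and> W r j})"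
      unfolding image_UN image_image by (intro SUP_cong image_cong refl cyl_ratio_inv) auto
    have 4: "graph n ` set (map ratio (filter (V n) [0..<n])) = ratio_eq (Suc n) n ` {j. j < n \<and> V n j}"
      unfolding set_map image_image by (intro image_cong) (auto simp: graph_ratio)
    have 5: "graph n ` set (map ratio_sec (filter (W n) [0..<n])) = ratio_inv (Suc n) n ` {j. j < n \<and> W n j}"
      unfolding set_map image_image by (intro image_cong) (auto simp: graph_ratio_sec)
    show ?thesis unfolding D set_append image_Un 4 5 unfolding arr_C_def image_Un 2 3 unfolding lessThan_Suc by (simp add: Un_ac)
  qed
  moreover have "length ?fs = k" by (simp add: k)
  ultimately show ?thesis by (simp only:)
qed


text \<open>On the hypertorus of \<open>2 \<epsilon>\<^sub>n\<close> one may normalise \<open>\<epsilon>\<^sub>n = 1\<close>, after which all \<open>\<epsilon>\<^sub>j\<close> are coordinates.\<close>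

definition loop_emb :: "nat \<Rightarrow> pt \<Rightarrow> pt" where
  "loop_emb n x = (\<lambda>i. if i = 0 then x 0 ^ 2 else if i < n then x i / x 0 else if i = n then inverse (x 0) else 1)"

text \<open>With \<open>\<epsilon>\<^sub>n = 1\<close> the coordinate \<open>y n\<close> is the
  inverse of \<open>\<epsilon>\<^sub>0\<close>, and dividing by it recovers the remaining
  \<open>\<epsilon>\<^sub>i\<close>.\<close>

definition loop_proj :: "nat \<Rightarrow> pt \<Rightarrow> pt" where
  "loop_proj n y = (\<lambda>i. if i = 0 then inverse (y n) else if i < n then y i / y n else 1)"

lemma ratio_loop_emb: "x \<in> torus n \<Longrightarrow> i < n \<Longrightarrow> ratio i (loop_emb n x) = x i / x 0"
  by (simp add: ratio_def loop_emb_def torus_nonzero)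

lemma ratio_loop_emb_last: "0 < n \<Longrightarrow> ratio n (loop_emb n x) = inverse (x 0)"
  by (simp add: ratio_def loop_emb_def)

lemma mon_power2: "mon n f \<Longrightarrow> mon n (\<lambda>t. (f t)\<^sup>2)"
  unfolding power2_eq_square by (intro mon_mult)

lemma emb_loop_emb: assumes n: "0 < n"
  shows "emb n (Suc n) (loop_emb n)" "loop_emb n ` torus n = ratio_inv (Suc n) n n"
proof -
  have 1: "mmap n (Suc n) (loop_emb n)"
  proof (rule mmapI)
    fix i assume "i < Suc n"
    then consider "i = 0" | "i \<noteq> 0" "i < n" | "i \<noteq> 0" "i = n" by linarith
    then show "mon n (\<lambda>t. loop_emb n t i)"
      by cases (auto simp: loop_emb_def intro: mon_power2 mon_divide mon_inverse mon_coord)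
  qed (auto simp: loop_emb_def)
  have 2: "mmap (Suc n) n (loop_proj n)"
  proof (rule mmapI)
    fix i assume "i < n"
    then consider "i = 0" | "i \<noteq> 0" "i < n" by linarith
    then show "mon (Suc n) (\<lambda>t. loop_proj n t i)"
      by cases (auto simp: loop_proj_def intro: mon_divide mon_inverse mon_coord)
  qed (use n in \<open>auto simp: loop_proj_def\<close>)
  show "emb n (Suc n) (loop_emb n)"
  proof (rule embI[OF 1 2])
    fix t assume t: "t \<in> torus n"
    show "loop_proj n (loop_emb n t) = t"
    proof
      fix i show "loop_proj n (loop_emb n t) i = t i"
        using n torus_nonzero[OF t, of 0] torus_outside[OF t, of i] by (auto simp: loop_emb_def loop_proj_def)
    qed
  qed
  show "loop_emb n ` torus n = ratio_inv (Suc n) n n"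
  proof safe
    fix x assume x: "x \<in> torus n"
    have "loop_emb n x 0 * ratio n (loop_emb n x) * ratio n (loop_emb n x) = 1"
      unfolding ratio_loop_emb_last[OF n] using torus_nonzero[OF x, of 0] by (simp add: loop_emb_def power2_eq_square field_simps)
    then show "loop_emb n x \<in> ratio_inv (Suc n) n n" using mmap_in[OF 1 x] by (simp add: ratio_inv_def)
  next
    fix y assume y: "y \<in> ratio_inv (Suc n) n n"
    then have yt: "y \<in> torus (Suc n)" and "y 0 * ratio n y * ratio n y = 1" by (auto simp: ratio_inv_def)
    then have e: "y 0 * y n * y n = 1" using n by (simp add: ratio_def)
    have nz: "y n \<noteq> 0" using torus_nonzero[OF yt] .
    have y0: "y 0 = (inverse (y n))\<^sup>2" using e nz by (simp add: field_simps power2_eq_square)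
    have "loop_emb n (loop_proj n y) = y"
    proof
      fix i
      consider "i = 0" | "i \<noteq> 0" "i < n" | "i \<noteq> 0" "i = n" | "i > n" by linarith
      then show "loop_emb n (loop_proj n y) i = y i"
      proof cases
        case 1 then show ?thesis using y0 by (simp add: loop_emb_def loop_proj_def)
      next
        case 2 then show ?thesis using nz by (simp add: loop_emb_def loop_proj_def)
      next
        case 3 then show ?thesis by (simp add: loop_emb_def loop_proj_def)
      next
        case 4 then show ?thesis using torus_outside[OF yt, of i] by (simp add: loop_emb_def)
      qed
    qed
    then show "y \<in> loop_emb n ` torus n" using mmap_in[OF 2 yt] by (metis image_eqI)
  qed
qed

text \<open>With \<open>\<epsilon>\<^sub>n = 1\<close> the sum and the difference of
  \<open>\<epsilon>\<^sub>n\<close> and \<open>\<epsilon>\<^sub>j\<close> impose the same condition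
  \<open>x j = 1\<close>; roots away from \<open>n\<close> keep their form.\<close>

lemma loop_emb_pre:
  assumes n: "0 < n"
  shows "i < n \<Longrightarrow> j < n \<Longrightarrow> {u \<in> torus n. loop_emb n u \<in> ratio_eq (Suc n) i j} = hyp_eq n i j"
    and "j < n \<Longrightarrow> {u \<in> torus n. loop_emb n u \<in> ratio_eq (Suc n) n j} = hyp_c n 1 j"
    and "i < n \<Longrightarrow> j < n \<Longrightarrow> {u \<in> torus n. loop_emb n u \<in> ratio_inv (Suc n) i j} = hyp_inv n i j"
    and "j < n \<Longrightarrow> {u \<in> torus n. loop_emb n u \<in> ratio_inv (Suc n) n j} = hyp_c n 1 j"
proof -
  note t = emb_in[OF emb_loop_emb(1)[OF n]]
  note [simp] = ratio_loop_emb ratio_loop_emb_last[OF n] torus_nonzero t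
  have 0: "loop_emb n u 0 = u 0 ^ 2" for u by (simp add: loop_emb_def)
  show "{u \<in> torus n. loop_emb n u \<in> ratio_eq (Suc n) i j} = hyp_eq n i j" if "i < n" "j < n"
    using that unfolding ratio_eq_def hyp_eq_def by auto
  show "{u \<in> torus n. loop_emb n u \<in> ratio_eq (Suc n) n j} = hyp_c n 1 j" if "j < n"
  proof -
    have "inverse (u 0) = u j / u 0 \<longleftrightarrow> u j = 1" if "u \<in> torus n" for u
      using torus_nonzero[OF that, of 0] by (auto simp: field_simps)
    then show ?thesis using that unfolding ratio_eq_def hyp_c_def by (auto simp: inverse_eq_divide)
  qed
  show "{u \<in> torus n. loop_emb n u \<in> ratio_inv (Suc n) i j} = hyp_inv n i j" if "i < n" "j < n"
  proof -
    have "u 0 ^ 2 * (u i / u 0) * (u j / u 0) = u i * u j" if "u \<in> torus n" for u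
      using torus_nonzero[OF that, of 0] by (simp add: field_simps power2_eq_square)
    then show ?thesis using that 0 unfolding ratio_inv_def hyp_inv_def by auto
  qed
  show "{u \<in> torus n. loop_emb n u \<in> ratio_inv (Suc n) n j} = hyp_c n 1 j" if "j < n"
  proof -
    have "loop_emb n u \<in> ratio_inv (Suc n) n j \<longleftrightarrow> u j = 1" if u: "u \<in> torus n" for u
    proof -
      have "loop_emb n u 0 * ratio n (loop_emb n u) * ratio j (loop_emb n u) = u j"
        using torus_nonzero[OF u, of 0] \<open>j < n\<close> u by (simp add: 0 field_simps power2_eq_square)
      then show ?thesis unfolding ratio_inv_def mem_Collect_eq using t[OF u] by (simp only: simp_thms)
    qed
    then show ?thesis unfolding hyp_c_def by auto
  qed
qed

text \<open>On the hypertorus of \<open>2 \<epsilon>\<^sub>n\<close> the root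
  \<open>2 \<epsilon>\<^sub>i\<close> becomes \<open>x i ^ 2 = 1\<close>, whose two components
  supply all \<open>x i = -1\<close>. This makes the restriction the type B arrangement with
  \<open>s = n\<close> and all edges, and \<open>ip0\<close> already displays the deletion as a
  linear multiple of its polynomial.\<close>

lemma arr_C_loop:
  assumes n: "0 < n"
    and D0: "D0 = (\<Union>r<Suc n. ratio_eq (Suc n) r ` {..<r}) \<union> (\<Union>r<n. ratio_inv (Suc n) r ` {..r}) \<union> ratio_inv (Suc n) n ` {..<n}"
    and ip0: "ind_poly (Suc n) D0 ([:- int n, 1:] * sh_poly (\<lambda>i. i) n n)"
  shows "ind_poly (Suc n) (insert (ratio_inv (Suc n) n n) D0) ([:- int (Suc n), 1:] * sh_poly (\<lambda>i. i) n n)"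
proof -
  let ?B = "sh_arr n n (\<lambda>i. i)"
  have "shifted n (\<lambda>i. i)" by (simp add: shifted_def)
  then have B: "ind_poly n ?B (sh_poly (\<lambda>i. i) n n)" by (rule ind_poly_sh_arr) simp
  have wf: "components K = {K} \<and> K \<noteq> torus n" if "K \<in> ?B" for K
    using ind_poly_wf[OF B] that components_tor by blast
  have inv_self: "hyp_inv n i i = {u \<in> torus n. u i = inverse (u i)}" for i using set_coord_inverse by metis
  have tw: "components (hyp_inv n i i) = {hyp_c n 1 i, hyp_c n (-1) i}" if "i < n" for i
    unfolding inv_self by (rule components_two[OF that])
  have two: "components (hyp_inv n i i) \<subseteq> ?B" "hyp_inv n i i \<noteq> torus n" if "i < n" for i
  proof -
    show "components (hyp_inv n i i) \<subseteq> ?B" unfolding tw[OF that] using hyp_c_in[OF that] hyp_c_minus_in[OF that] by simp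
    show "hyp_inv n i i \<noteq> torus n" unfolding inv_self using imaginary_pt[OF that] by blast
  qed
  let ?pre = "\<lambda>K. {u \<in> torus n. loop_emb n u \<in> K}"
  have pre: "components (?pre K) \<subseteq> ?B \<and> ?pre K \<noteq> torus n" if K: "K \<in> D0" for K
  proof -
    have single: "components S \<subseteq> ?B \<and> S \<noteq> torus n" if "S \<in> ?B" for S using wf[OF that] that by simp
    consider r j where "r < n" "j < r" "K = ratio_eq (Suc n) r j" | j where "j < n" "K = ratio_eq (Suc n) n j"
      | r j where "r < n" "j \<le> r" "K = ratio_inv (Suc n) r j" | j where "j < n" "K = ratio_inv (Suc n) n j"
      using K unfolding D0 lessThan_Suc by auto
    then show ?thesis
    proof cases
      case (1 r j)
      have "?pre K = hyp_eq n r j" unfolding 1(3) by (rule loop_emb_pre(1)[OF n]) (use 1 in auto)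
      then show ?thesis using single[OF hyp_eq_in[of r n j]] 1 by simp
    next
      case (2 j)
      have "?pre K = hyp_c n 1 j" unfolding 2(2) by (rule loop_emb_pre(2)[OF n 2(1)])
      then show ?thesis using single[OF hyp_c_in[OF 2(1)]] by simp
    next
      case (3 r j)
      have e: "?pre K = hyp_inv n r j" unfolding 3(3) by (rule loop_emb_pre(3)[OF n]) (use 3 in auto)
      show ?thesis
      proof (cases "j = r")
        case True then show ?thesis using e two[OF 3(1)] by simp
      next
        case False then show ?thesis using e single[OF hyp_inv_in[of r n j "\<lambda>i. i"]] 3 by simp
      qed
    next
      case (4 j)
      have "?pre K = hyp_c n 1 j" unfolding 4(2) by (rule loop_emb_pre(4)[OF n 4(1)])
      then show ?thesis using single[OF hyp_c_in[OF 4(1)]] by simp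
    qed
  qed
  \<comment> \<open>The preimage of this hypertorus under its own parametrisation is everything,
    while members of \<open>D0\<close> have proper preimages.\<close>
  have ni: "ratio_inv (Suc n) n n \<notin> D0"
  proof
    assume "ratio_inv (Suc n) n n \<in> D0"
    from pre[OF this] have "?pre (ratio_inv (Suc n) n n) \<noteq> torus n" by simp
    then show False using emb_loop_emb(2)[OF n] by blast
  qed
  then have D': "insert (ratio_inv (Suc n) n n) D0 - {ratio_inv (Suc n) n n} = D0" by simp
  have sup: "?B \<subseteq> (\<Union>K\<in>D0. components (?pre K))"
  proof
    fix S assume S: "S \<in> ?B"
    have in1: "ratio_eq (Suc n) r j \<in> D0" if "r \<le> n" "j < r" for r j
      using that unfolding D0 by (intro UnI1 UN_I[of r]) auto
    have in2: "ratio_inv (Suc n) r j \<in> D0" if "r < n" "j \<le> r" for r j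
      using that unfolding D0 by (intro UnI1[of _ _ "ratio_inv (Suc n) n ` {..<n}"] UnI2 UN_I[of r]) auto
    from S show "S \<in> (\<Union>K\<in>D0. components (?pre K))"
    proof (cases rule: sh_arr_cases)
      case (1 i)
      show ?thesis using in1[of n i] 1 wf[OF S] by (intro UN_I[of "ratio_eq (Suc n) n i"]) (auto simp: loop_emb_pre(2)[OF n])
    next
      case (2 i)
      show ?thesis using in2[of i i] 2 tw[of i] by (intro UN_I[of "ratio_inv (Suc n) i i"]) (auto simp: loop_emb_pre(3)[OF n])
    next
      case (3 i j)
      show ?thesis using in1[of i j] 3 wf[OF S] by (intro UN_I[of "ratio_eq (Suc n) i j"]) (auto simp: loop_emb_pre(1)[OF n])
    next
      case (4 i j)
      show ?thesis using in2[of i j] 4 wf[OF S] by (intro UN_I[of "ratio_inv (Suc n) i j"]) (auto simp: loop_emb_pre(3)[OF n])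
    qed
  qed
  have "ind_poly (Suc n) (insert (ratio_inv (Suc n) n n) D0) ([:- (int n + 1), 1:] * sh_poly (\<lambda>i. i) n n)"
  proof (rule ind_poly.ind_poly_step[OF _ emb_loop_emb[OF n] _ B])
    show "ind_poly (Suc n) (insert (ratio_inv (Suc n) n n) D0 - {ratio_inv (Suc n) n n}) ([:- int n, 1:] * sh_poly (\<lambda>i. i) n n)"
      unfolding D' by (rule ip0)
    show "?B = (\<Union>K\<in>insert (ratio_inv (Suc n) n n) D0 - {ratio_inv (Suc n) n n}. components (?pre K))"
      unfolding D' using sup pre by (intro subset_antisym UN_least) auto
  qed simp
  then show ?thesis by (simp add: add.commute)
qed

text \<open>If \<open>2 \<epsilon>\<^sub>n\<close> is present, so are all roots on the vertices up
  to \<open>n\<close>, and the exponents are \<open>n + 1\<close> and 2, 4, ...,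
  \<open>2 * n\<close>. The polynomial is recorded in this case because the next long root needs it
  to recognise the restriction's polynomial as a factor of the deletion's.\<close>

lemma ind_poly_arr_C:
  assumes c: "\<And>r j r' j'. r < l \<Longrightarrow> V r j \<Longrightarrow> j \<le> j' \<Longrightarrow> j' < r' \<Longrightarrow> r' \<le> r \<Longrightarrow> V r' j'"
    and b: "\<And>r j j'. r < l \<Longrightarrow> j \<le> r \<Longrightarrow> W r j \<Longrightarrow> j' < r \<Longrightarrow> V r j'"
    and e: "\<And>r j r' j'. r < l \<Longrightarrow> j \<le> r \<Longrightarrow> W r j \<Longrightarrow> r' \<le> r \<Longrightarrow> j' \<le> j \<Longrightarrow> j' \<le> r' \<Longrightarrow> W r' j'"
  shows "Suc n \<le> l \<Longrightarrow> \<exists>p. ind_poly (Suc n) (arr_C (Suc n) V W) p \<and> (W n n \<longrightarrow> p = [:- int (Suc n), 1:] * sh_poly (\<lambda>i. i) n n)"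
proof (induction n)
  case 0
  show ?case
  proof (cases "W 0 0")
    case True
    \<comment> \<open>In rank one the only root is \<open>2 \<epsilon>\<^sub>0\<close>, itself the
      coordinate; so this is the point \<open>x 0 = 1\<close>, as in type B without edges.\<close>
    have "ind_poly 1 (sh_arr 1 0 (\<lambda>_. 0)) (sh_poly (\<lambda>_. 0) 1 0)" by (rule ind_poly_sh_arr) (auto simp: shifted_def)
    moreover have "sh_arr 1 0 (\<lambda>_. 0) = arr_C 1 V W"
    proof -
      have "{j. j = 0 \<and> W 0 j} = {0}" using True by auto
      moreover have "hyp_c (Suc 0) 1 0 = ratio_inv (Suc 0) 0 0" by (auto simp: hyp_c_def ratio_inv_def ratio_def)
      ultimately show ?thesis unfolding sh_arr_def arr_C_def by (simp add: lessThan_Suc)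
    qed
    ultimately show ?thesis by (intro exI[of _ "sh_poly (\<lambda>_. 0) 1 0"]) simp
  next
    case False
    then have "arr_C (Suc 0) V W = {}" by (auto simp: arr_C_def)
    then show ?thesis using ind_poly.ind_poly_empty[of "Suc 0"] False by auto
  qed
next
  case (Suc k)
  define n where "n = Suc k"
  have n: "0 < n" and nl: "n < l" using Suc.prems by (auto simp: n_def)
  obtain p where p: "ind_poly n (arr_C n V W) p" "W k k \<Longrightarrow> p = [:- int n, 1:] * sh_poly (\<lambda>i. i) k k"
    using Suc unfolding n_def by auto
  define D where "D = (\<Union>r<Suc n. ratio_eq (Suc n) r ` {j. j < r \<and> V r j}) \<union> (\<Union>r<n. ratio_inv (Suc n) r ` {j. j \<le> r \<and> W r j})
      \<union> ratio_inv (Suc n) n ` {j. j < n \<and> W n j}"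
  define q where "q = length (filter (V n) [0..<n]) + length (filter (W n) [0..<n])"
  have ipD: "ind_poly (Suc n) D ([:- int q, 1:] * p)"
    by (rule arr_C_peel[OF n p(1) c[OF nl] b[OF nl] e[OF nl] q_def D_def])
  show ?case
  proof (cases "W n n")
    case False
    have "{j. j \<le> n \<and> W n j} = {j. j < n \<and> W n j}" using False by (auto simp: le_less)
    then have "arr_C (Suc n) V W = D" unfolding arr_C_def D_def lessThan_Suc by (simp add: Un_ac)
    then show ?thesis using ipD False unfolding n_def by auto
  next
    case True
    have W: "W r j" if "r \<le> n" "j \<le> r" for r j using e[OF nl order_refl True] that by simp
    have V: "V r j" if "r \<le> n" "j < r" for r j using b[of r r j] W[of r r] that nl by simp
    have "filter (V n) [0..<n] = [0..<n]" "filter (W n) [0..<n] = [0..<n]" using V W by (auto simp: filter_id_conv)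
    then have q: "q = 2 * n" unfolding q_def by simp
    have pk: "p = [:- int n, 1:] * sh_poly (\<lambda>i. i) k k" using p(2) W[of k k] by (simp add: n_def)
    \<comment> \<open>Splitting off contributes the exponent \<open>2 * n\<close> to the old ones
      \<open>n\<close> and 2, ..., \<open>2 * k\<close>. The even ones together form the polynomial
      of the restriction, leaving the factor t - n.\<close>
    have "sh_poly (\<lambda>i. i) n n = [:- int (k + 2 + k), 1:] * sh_poly (\<lambda>i. i) k k" unfolding n_def by simp
    moreover have "k + 2 + k = q" using q n_def by simp
    ultimately have "[:- int q, 1:] * p = [:- int n, 1:] * sh_poly (\<lambda>i. i) n n"
      unfolding pk by (simp only: mult.left_commute)
    then have ipD': "ind_poly (Suc n) D ([:- int n, 1:] * sh_poly (\<lambda>i. i) n n)" using ipD by simp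
    have "{j. j < r \<and> V r j} = {..<r}" if "r \<in> {..<Suc n}" for r using V that by auto
    moreover have W1: "{j. j \<le> r \<and> W r j} = {..r}" if "r \<in> {..<n}" for r using W that by auto
    moreover have "{j. j < n \<and> W n j} = {..<n}" using W by auto
    ultimately have D0: "D = (\<Union>r<Suc n. ratio_eq (Suc n) r ` {..<r}) \<union> (\<Union>r<n. ratio_inv (Suc n) r ` {..r}) \<union> ratio_inv (Suc n) n ` {..<n}"
      unfolding D_def by simp
    have "{j. j \<le> n \<and> W n j} = insert n {j. j < n \<and> W n j}" using True by auto
    then have "arr_C (Suc n) V W = insert (ratio_inv (Suc n) n n) D" unfolding arr_C_def D_def lessThan_Suc by (simp add: Un_ac)
    then show ?thesis using arr_C_loop[OF n D0 ipD'] unfolding n_def by auto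
  qed
qed

section \<open>From epsilon coordinates to root coordinates\<close>

text \<open>Each hypertorus of the ideal is the image of a member of \<open>D\<close>, hence
  connected, so passing to components changes nothing.\<close>

lemma inductive_toric_arr:
  assumes ind_poly: "ind_poly l D p" and \<phi>: "emb l l \<phi>" "\<phi> ` torus l = torus l"
    and I: "(\<lambda>b. hyp l b 1) ` I = (`) \<phi> ` D"
  shows "inductive_arr l (torus l) (toric_arr l I)"
proof -
  have "components (hyp l b 1) = {hyp l b 1}" if "b \<in> I" for b
  proof -
    have "hyp l b 1 \<in> (`) \<phi> ` D" unfolding I[symmetric] using that by (rule imageI)
    then obtain K where K: "hyp l b 1 = \<phi> ` K" "K \<in> D" by auto
    then have "tor l (hyp l b 1)" using tor_image[OF \<phi>(1)] ind_poly_wf[OF ind_poly] by simp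
    then show ?thesis by (rule components_tor)
  qed
  then have "toric_arr l I = (\<lambda>b. hyp l b 1) ` I" unfolding toric_arr_def by auto
  then show ?thesis using ind_poly_inductive_arr[OF ind_poly \<phi>(1)] \<phi>(2) I by simp
qed

lemma prod_seg_powi:
  assumes "j \<le> l"
  shows "(\<Prod>k<l. (t k :: complex) powi (c * seg i j k)) = (\<Prod>k=i..<j. t k) powi c"
proof -
  have "(\<Prod>k<l. t k powi (c * seg i j k)) = (\<Prod>k\<in>{..<l} \<inter> {k. i \<le> k \<and> k < j}. t k powi c)"
    by (simp add: prod.inter_restrict seg_def) (rule prod.cong, auto)
  also have "{..<l} \<inter> {k. i \<le> k \<and> k < j} = {i..<j}" using assms by auto
  finally show ?thesis by (simp add: prod_powi)
qed

lemma chr_seg: "j \<le> l \<Longrightarrow> chr l (seg i j) t = (\<Prod>k=i..<j. t k)"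
  using prod_seg_powi[of j l t 1 i] by (simp add: chr_def)

lemma chr_cseg: "j \<le> l \<Longrightarrow> chr l (\<lambda>k. 2 * seg i j k) t = (\<Prod>k=i..<j. t k)\<^sup>2"
  using prod_seg_powi[of j l t 2 i] by (simp add: chr_def)

lemma prod_telescope:
  fixes e :: "nat \<Rightarrow> complex"
  assumes "\<And>k. e k \<noteq> 0" "i \<le> j"
  shows "(\<Prod>k=i..<j. e k / e (Suc k)) = e i / e j"
  using assms(2) by (induction j rule: dec_induct) (auto simp: assms(1))

lemma chr_permute:
  assumes "s permutes {..<l}" shows "chr l (b \<circ> s) (t \<circ> s) = chr l b t"
  unfolding chr_def using prod.permute[OF assms, of "\<lambda>i. t i powi b i"] by (simp add: o_def)

lemma hyp_permute:
  assumes s: "s permutes {..<l}"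
  shows "emb l l (\<lambda>t. t \<circ> s)" "(\<lambda>t. t \<circ> s) ` torus l = torus l"
    "(\<lambda>t. t \<circ> s) ` hyp l b 1 = hyp l (b \<circ> s) 1"
proof -
  have o: "s j \<ge> l" "inv s j \<ge> l" if "j \<ge> l" for j
    using permutes_not_in[OF s, of j] permutes_not_in[OF permutes_inv[OF s], of j] that by auto
  have m: "mmap l l (\<lambda>t. t \<circ> s)" by (rule mmap_reindex) (rule o)
  have m': "mmap l l (\<lambda>t. t \<circ> inv s)" by (rule mmap_reindex) (rule o)
  have c: "(t \<circ> s) \<circ> inv s = t" "(t \<circ> inv s) \<circ> s = t" for t :: pt
    using permutes_inv_o[OF s] by (simp_all add: o_assoc[symmetric])
  show "emb l l (\<lambda>t. t \<circ> s)" by (rule embI[OF m m']) (rule c)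
  show "(\<lambda>t. t \<circ> s) ` torus l = torus l"
  proof safe
    fix t assume "t \<in> torus l"
    then show "t \<circ> s \<in> torus l" using mmap_in[OF m] by simp
    show "t \<in> (\<lambda>t. t \<circ> s) ` torus l"
      by (rule image_eqI[of _ _ "t \<circ> inv s"]) (use c mmap_in[OF m' \<open>t \<in> torus l\<close>] in auto)
  qed
  show "(\<lambda>t. t \<circ> s) ` hyp l b 1 = hyp l (b \<circ> s) 1"
  proof safe
    fix t assume "t \<in> hyp l b 1"
    then show "t \<circ> s \<in> hyp l (b \<circ> s) 1" using mmap_in[OF m] chr_permute[OF s] by (simp add: hyp_def)
  next
    fix t assume t: "t \<in> hyp l (b \<circ> s) 1"
    then have "t \<circ> inv s \<in> hyp l b 1"
      using mmap_in[OF m'] chr_permute[OF s, of b "t \<circ> inv s"] c by (simp add: hyp_def)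
    then show "t \<in> (\<lambda>t. t \<circ> s) ` hyp l b 1" by (rule image_eqI[rotated]) (simp add: c)
  qed
qed

lemma hyp_image:
  assumes "emb l l \<phi>" "\<phi> ` torus l = torus l" "\<And>x. x \<in> torus l \<Longrightarrow> chr l b (\<phi> x) = 1 \<longleftrightarrow> P x"
  shows "hyp l b 1 = \<phi> ` {x \<in> torus l. P x}"
proof safe
  fix t assume t: "t \<in> hyp l b 1"
  then have "t \<in> \<phi> ` torus l" using assms(2) by (simp add: hyp_def)
  then obtain x where "x \<in> torus l" "t = \<phi> x" by auto
  then show "t \<in> \<phi> ` {x \<in> torus l. P x}" using t assms(3)[of x] by (simp add: hyp_def)
next
  fix x assume "x \<in> torus l" "P x"
  then show "\<phi> x \<in> hyp l b 1" using assms(3)[of x] emb_in[OF assms(1)] by (simp add: hyp_def)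
qed

lemma emb_bij:
  assumes "mmap l l \<phi>" "mmap l l \<psi>" "\<And>x. x \<in> torus l \<Longrightarrow> \<psi> (\<phi> x) = x" "\<And>x. x \<in> torus l \<Longrightarrow> \<phi> (\<psi> x) = x"
  shows "emb l l \<phi>" "\<phi> ` torus l = torus l"
proof -
  show "emb l l \<phi>" by (rule embI[OF assms(1,2,3)])
  show "\<phi> ` torus l = torus l"
  proof safe
    fix x assume x: "x \<in> torus l"
    then show "\<phi> x \<in> torus l" by (rule mmap_in[OF assms(1)])
    show "x \<in> \<phi> ` torus l" by (rule image_eqI[of _ _ "\<psi> x"]) (use assms(4)[OF x] mmap_in[OF assms(2) x] in auto)
  qed
qed

section \<open>Roots of type B in simple-root coordinates\<close>

context
  fixes l :: nat
begin

text \<open>In both types \<open>\<epsilon>\<^bsub>i+1\<^esub>\<close> in Bourbaki's numbering becomes the vertex \<open>l - 1 - i\<close>.\<close>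

definition eB :: "pt \<Rightarrow> nat \<Rightarrow> complex" where
  "eB x i = (if i < l then x (l - 1 - i) else 1)"

text \<open>Each simple root is a difference of consecutive epsilons; the value 1 of
  \<open>eB\<close> at \<open>l\<close> makes the last one the short root.\<close>

definition phiB :: "pt \<Rightarrow> pt" where
  "phiB x = (\<lambda>i. if i < l then eB x i / eB x (Suc i) else 1)"

text \<open>Every epsilon is the sum of a tail of the simple roots.\<close>

definition psiB :: "pt \<Rightarrow> pt" where
  "psiB t = (\<lambda>r. if r < l then (\<Prod>k=l-1-r..<l. t k) else 1)"

lemma eB_nonzero: "x \<in> torus l \<Longrightarrow> eB x i \<noteq> 0"
  by (simp add: eB_def torus_nonzero)

lemma phiB_prod: assumes "x \<in> torus l" "i \<le> j" "j \<le> l" shows "(\<Prod>k=i..<j. phiB x k) = eB x i / eB x j"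
proof -
  have "(\<Prod>k=i..<j. phiB x k) = (\<Prod>k=i..<j. eB x k / eB x (Suc k))"
    by (rule prod.cong) (use assms in \<open>auto simp: phiB_def\<close>)
  then show ?thesis using prod_telescope[of "eB x", OF eB_nonzero[OF assms(1)] assms(2)] by simp
qed

lemma phiB: "emb l l phiB" "phiB ` torus l = torus l"
proof -
  have e: "mon l (\<lambda>x. eB x i)" for i by (cases "i < l") (auto simp: eB_def mon_coord)
  have 1: "mmap l l phiB"
  proof (rule mmapI)
    fix i assume "i < l" then show "mon l (\<lambda>t. phiB t i)" using mon_divide[OF e e] by (simp add: phiB_def)
  qed (auto simp: phiB_def)
  have 2: "mmap l l psiB"
  proof (rule mmapI)
    fix i assume "i < l"
    then show "mon l (\<lambda>t. psiB t i)" unfolding psiB_def by (simp, intro mon_prod mon_coord) auto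
  qed (auto simp: psiB_def)
  have 3: "psiB (phiB x) = x" if x: "x \<in> torus l" for x
  proof
    fix r show "psiB (phiB x) r = x r"
    proof (cases "r < l")
      case True
      then show ?thesis using phiB_prod[OF x, of "l-1-r" l] by (simp add: psiB_def eB_def)
    qed (use torus_outside[OF x, of r] in \<open>simp add: psiB_def\<close>)
  qed
  have 4: "phiB (psiB t) = t" if t: "t \<in> torus l" for t
  proof
    fix i
    show "phiB (psiB t) i = t i"
    proof (cases "i < l")
      case True
      have e: "eB (psiB t) k = (\<Prod>k=k..<l. t k)" if "k \<le> l" for k
        using that by (auto simp: eB_def psiB_def)
      have "(\<Prod>k=i..<l. t k) = t i * (\<Prod>k=Suc i..<l. t k)" using True by (rule prod.atLeast_Suc_lessThan)
      moreover have "(\<Prod>k=Suc i..<l. t k) \<noteq> 0" using torus_nonzero[OF t] by simp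
      ultimately show ?thesis using True by (simp add: phiB_def e)
    qed (use torus_outside[OF t, of i] in \<open>simp add: phiB_def\<close>)
  qed
  show "emb l l phiB" "phiB ` torus l = torus l" using emb_bij[OF 1 2 3 4] by auto
qed

text \<open>\<open>rB1 r\<close>, \<open>rB2 r j\<close>, \<open>rB3 r j\<close> are
  \<open>\<epsilon>\<^sub>r\<close>, \<open>\<epsilon>\<^sub>r - \<epsilon>\<^sub>j\<close>,
  \<open>\<epsilon>\<^sub>r + \<epsilon>\<^sub>j\<close> in the reversed numbering.\<close>

definition rB1 :: "nat \<Rightarrow> lat" where "rB1 r = seg (l - 1 - r) l"
definition rB2 :: "nat \<Rightarrow> nat \<Rightarrow> lat" where "rB2 r j = seg (l - 1 - r) (l - 1 - j)"
definition rB3 :: "nat \<Rightarrow> nat \<Rightarrow> lat" where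
  "rB3 r j = (\<lambda>k. seg (l - 1 - r) (l - 1 - j) k + 2 * seg (l - 1 - j) l k)"

lemma hyp_rB1: assumes "r < l" shows "hyp l (rB1 r) 1 = phiB ` hyp_c l 1 r"
  unfolding hyp_c_def
proof (rule hyp_image[OF phiB])
  fix x assume x: "x \<in> torus l"
  have "chr l (rB1 r) (phiB x) = x r"
    using phiB_prod[OF x, of "l-1-r" l] assms by (simp add: rB1_def chr_seg eB_def)
  then show "chr l (rB1 r) (phiB x) = 1 \<longleftrightarrow> x r = 1" by simp
qed

lemma eB_rev: "r < l \<Longrightarrow> eB x (l - 1 - r) = x r" by (simp add: eB_def)

lemma hyp_rB2: assumes "r < l" "j < r" shows "hyp l (rB2 r j) 1 = phiB ` hyp_eq l r j"
  unfolding hyp_eq_def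
proof (rule hyp_image[OF phiB])
  fix x assume x: "x \<in> torus l"
  have "chr l (rB2 r j) (phiB x) = x r / x j"
    using phiB_prod[OF x, of "l-1-r" "l-1-j"] assms eB_rev[of r x] eB_rev[of j x] by (simp add: rB2_def chr_seg)
  then show "chr l (rB2 r j) (phiB x) = 1 \<longleftrightarrow> x r = x j" using torus_nonzero[OF x] by simp
qed

lemma hyp_rB3: assumes "r < l" "j < r" shows "hyp l (rB3 r j) 1 = phiB ` hyp_inv l r j"
  unfolding hyp_inv_def
proof (rule hyp_image[OF phiB])
  fix x assume x: "x \<in> torus l"
  have t: "phiB x \<in> torus l" using emb_in[OF phiB(1) x] .
  have "eB x l = 1" by (simp add: eB_def)
  then have "chr l (rB3 r j) (phiB x) = x r / x j * (x j)\<^sup>2"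
    using phiB_prod[OF x, of "l-1-r" "l-1-j"] phiB_prod[OF x, of "l-1-j" l] assms eB_rev[of r x] eB_rev[of j x]
    unfolding rB3_def chr_add[OF t] by (simp add: chr_seg chr_cseg)
  also have "\<dots> = x r * x j" using torus_nonzero[OF x, of j] by (simp add: power2_eq_square)
  finally show "chr l (rB3 r j) (phiB x) = 1 \<longleftrightarrow> x r * x j = 1" by simp
qed

lemma rB_pos:
  "r < l \<Longrightarrow> rB1 r \<in> pos_roots TB l" "r < l \<Longrightarrow> j < r \<Longrightarrow> rB2 r j \<in> pos_roots TB l"
  "r < l \<Longrightarrow> j < r \<Longrightarrow> rB3 r j \<in> pos_roots TB l"
proof -
  show "rB1 r \<in> pos_roots TB l" if "r < l"
    using that unfolding pos_roots.simps rB1_def by (intro UnI1 CollectI exI[of _ "l-1-r"] exI[of _ l]) auto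
  show "rB2 r j \<in> pos_roots TB l" if "r < l" "j < r"
    using that unfolding pos_roots.simps rB2_def by (intro UnI1 CollectI exI[of _ "l-1-r"] exI[of _ "l-1-j"]) auto
  show "rB3 r j \<in> pos_roots TB l" if "r < l" "j < r"
    using that unfolding pos_roots.simps rB3_def by (intro UnI2 CollectI exI[of _ "l-1-r"] exI[of _ "l-1-j"]) auto
qed

lemma pos_roots_B_cases:
  assumes "b \<in> pos_roots TB l"
  obtains r where "r < l" "b = rB1 r" | r j where "r < l" "j < r" "b = rB2 r j" | r j where "r < l" "j < r" "b = rB3 r j"
proof -
  from assms consider i j where "i < j" "j \<le> l" "b = seg i j" | i j where "i < j" "j < l" "b = (\<lambda>k. seg i j k + 2 * seg j l k)"
    unfolding pos_roots.simps by blast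
  then show ?thesis
  proof cases
    case (1 i j)
    show ?thesis
    proof (cases "j = l")
      case True
      then show ?thesis using that(1)[of "l - 1 - i"] 1 by (simp add: rB1_def)
    next
      case False
      then show ?thesis using that(2)[of "l - 1 - i" "l - 1 - j"] 1 by (simp add: rB2_def)
    qed
  next
    case (2 i j)
    then show ?thesis using that(3)[of "l - 1 - i" "l - 1 - j"] by (simp add: rB3_def)
  qed
qed

lemma ideal_B:
  assumes J: "is_ideal (pos_roots TB l) J"
  shows "\<exists>D p. ind_poly l D p \<and> (\<lambda>b. hyp l b 1) ` J = (`) phiB ` D"
proof -
  define U where "U r \<longleftrightarrow> rB1 r \<in> J" for r
  define V where "V r j \<longleftrightarrow> j < r \<and> rB2 r j \<in> J" for r j
  define W where "W r j \<longleftrightarrow> rB3 r j \<in> J" for r j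
  have dn: "b2 \<in> J" if "b1 \<in> J" "b2 \<in> pos_roots TB l" "root_le b2 b1" for b1 b2
    using J that unfolding is_ideal_def by blast
  have "\<exists>p. ind_poly l (arr_B l U V W) p"
  proof (rule ind_poly_arr_B[of l])
    show "U r'" if "r < l" "U r" "r' \<le> r" for r r'
      using that(2) unfolding U_def by (rule dn[OF _ rB_pos(1)]) (use that in \<open>auto simp: root_le_def rB1_def seg_def\<close>)
    show "V r j" if "r < l" "U r" "j < r" for r j
    proof -
      have "rB2 r j \<in> J" using that(2) unfolding U_def
        by (rule dn[OF _ rB_pos(2)]) (use that in \<open>auto simp: root_le_def rB1_def rB2_def seg_def\<close>)
      then show ?thesis using that(3) by (simp add: V_def)
    qed
    show "V r' j'" if "r < l" "V r j" "j \<le> j'" "j' < r'" "r' \<le> r" for r j r' j'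
    proof -
      have "rB2 r j \<in> J" using that(2) by (simp add: V_def)
      then have "rB2 r' j' \<in> J" by (rule dn[OF _ rB_pos(2)]) (use that in \<open>auto simp: root_le_def rB2_def seg_def\<close>)
      then show ?thesis using that(4) by (simp add: V_def)
    qed
    show "U r" if "r < l" "j < r" "W r j" for r j
      using that(3) unfolding U_def W_def by (rule dn[OF _ rB_pos(1)]) (use that in \<open>auto simp: root_le_def rB1_def rB3_def seg_def\<close>)
    show "W r' j'" if "r < l" "j < r" "W r j" "r' \<le> r" "j' \<le> j" "j' < r'" for r j r' j'
      using that(3) unfolding W_def by (rule dn[OF _ rB_pos(3)]) (use that in \<open>auto simp: root_le_def rB3_def seg_def\<close>)
  qed simp
  then obtain p where p: "ind_poly l (arr_B l U V W) p" by blast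
  moreover have "(\<lambda>b. hyp l b 1) ` J = (`) phiB ` arr_B l U V W"
  proof (intro subset_antisym image_subsetI)
    fix b assume b: "b \<in> J"
    then have "b \<in> pos_roots TB l" using J unfolding is_ideal_def by blast
    then show "hyp l b 1 \<in> (`) phiB ` arr_B l U V W"
    proof (cases rule: pos_roots_B_cases)
      case (1 r)
      then have "hyp_c l 1 r \<in> arr_B l U V W" using b by (auto simp: arr_B_def U_def)
      then show ?thesis unfolding 1(2) hyp_rB1[OF 1(1)] by (rule imageI)
    next
      case (2 r j)
      then have "V r j" using b by (simp add: V_def)
      then have "hyp_eq l r j \<in> arr_B l U V W" unfolding arr_B_def using 2 by (intro UnI1[of _ _ "\<Union>r<l. _ r"] UnI2 UN_I[of r]) auto
      then show ?thesis unfolding 2(3) hyp_rB2[OF 2(1,2)] by (rule imageI)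
    next
      case (3 r j)
      then have "W r j" using b by (simp add: W_def)
      then have "hyp_inv l r j \<in> arr_B l U V W" unfolding arr_B_def using 3 by (intro UnI2 UN_I[of r]) auto
      then show ?thesis unfolding 3(3) hyp_rB3[OF 3(1,2)] by (rule imageI)
    qed
  next
    fix K assume "K \<in> arr_B l U V W"
    then consider r where "r < l" "U r" "K = hyp_c l 1 r" | r j where "r < l" "j < r" "V r j" "K = hyp_eq l r j"
      | r j where "r < l" "j < r" "W r j" "K = hyp_inv l r j" unfolding arr_B_def by blast
    then show "phiB ` K \<in> (\<lambda>b. hyp l b 1) ` J"
    proof cases
      case (1 r) then show ?thesis using hyp_rB1[OF 1(1)] by (auto simp: U_def)
    next
      case (2 r j) then show ?thesis using hyp_rB2[OF 2(1,2)] by (auto simp: V_def)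
    next
      case (3 r j) then show ?thesis using hyp_rB3[OF 3(1,2)] by (auto simp: W_def)
    qed
  qed
  ultimately show ?thesis by blast
qed

section \<open>Roots of type C in simple-root coordinates\<close>

definition eC :: "pt \<Rightarrow> nat \<Rightarrow> complex" where
  "eC x i = ratio (l - 1 - i) x"

text \<open>The last simple root is long and equals the coordinate
  \<open>2 \<epsilon>\<^sub>0\<close>; in all others \<open>\<epsilon>\<^sub>0\<close> cancels, so
  \<open>ratio\<close> may stand for the epsilons.\<close>

definition phiC :: "pt \<Rightarrow> pt" where
  "phiC x = (\<lambda>i. if i < l - 1 then eC x i / eC x (Suc i) else if i < l then x 0 else 1)"

definition psiC :: "pt \<Rightarrow> pt" where
  "psiC t = (\<lambda>r. if r = 0 then t (l - 1) else if r < l then (\<Prod>k=l-1-r..<l-1. t k) else 1)"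

lemma phiC_prod: assumes "x \<in> torus l" "i \<le> j" "j \<le> l - 1" shows "(\<Prod>k=i..<j. phiC x k) = eC x i / eC x j"
proof -
  have "(\<Prod>k=i..<j. phiC x k) = (\<Prod>k=i..<j. eC x k / eC x (Suc k))"
    by (rule prod.cong) (use assms in \<open>auto simp: phiC_def\<close>)
  moreover have "eC x k \<noteq> 0" for k using ratio_nonzero[OF assms(1)] by (simp add: eC_def)
  ultimately show ?thesis using prod_telescope[of "eC x", OF _ assms(2)] by simp
qed

lemma phiC: assumes l: "1 \<le> l" shows "emb l l phiC" "phiC ` torus l = torus l"
proof -
  have e: "mon l (\<lambda>x. eC x i)" for i unfolding eC_def by (rule mon_ratio)
  have 1: "mmap l l phiC"
  proof (rule mmapI)
    fix i assume "i < l" then show "mon l (\<lambda>t. phiC t i)" using mon_divide[OF e e] mon_coord by (cases "i < l - 1") (simp_all add: phiC_def)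
  qed (auto simp: phiC_def)
  have 2: "mmap l l psiC"
  proof (rule mmapI)
    fix i assume "i < l"
    moreover have "mon l (\<lambda>t. \<Prod>k=a..<b. t k)" for a b by (intro mon_prod mon_coord) auto
    ultimately show "mon l (\<lambda>t. psiC t i)" using mon_coord by (cases "i = 0") (simp_all add: psiC_def)
  qed (use l in \<open>auto simp: psiC_def\<close>)
  have 3: "psiC (phiC x) = x" if x: "x \<in> torus l" for x
  proof
    fix r
    consider "r = 0" | "r \<noteq> 0" "r < l" | "r \<ge> l" by linarith
    then show "psiC (phiC x) r = x r"
    proof cases
      case 1 then show ?thesis using l by (simp add: psiC_def phiC_def)
    next
      case 2
      then show ?thesis using phiC_prod[OF x, of "l-1-r" "l-1"] by (simp add: psiC_def eC_def ratio_def)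
    next
      case 3 then show ?thesis using torus_outside[OF x, of r] l by (simp add: psiC_def)
    qed
  qed
  have 4: "phiC (psiC t) = t" if t: "t \<in> torus l" for t
  proof
    fix i
    consider "i < l - 1" | "i = l - 1" | "i \<ge> l" using l by linarith
    then show "phiC (psiC t) i = t i"
    proof cases
      case 1
      have e: "eC (psiC t) k = (\<Prod>k=k..<l-1. t k)" if "k \<le> l - 1" for k
      proof (cases "k = l - 1")
        case False
        then show ?thesis using that by (simp add: eC_def psiC_def ratio_def)
      qed (simp add: eC_def ratio_def)
      have "(\<Prod>k=i..<l-1. t k) = t i * (\<Prod>k=Suc i..<l-1. t k)" using 1 by (rule prod.atLeast_Suc_lessThan)
      moreover have "(\<Prod>k=Suc i..<l-1. t k) \<noteq> 0" using torus_nonzero[OF t] by simp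
      ultimately show ?thesis using 1 e[of i] e[of "Suc i"] by (simp add: phiC_def)
    next
      case 2 then show ?thesis using l by (simp add: phiC_def psiC_def)
    next
      case 3
      then have "\<not> i < l - 1" by linarith
      then show ?thesis using 3 torus_outside[OF t, of i] by (simp add: phiC_def)
    qed
  qed
  show "emb l l phiC" "phiC ` torus l = torus l" using emb_bij[OF 1 2 3 4] by auto
qed

definition rC1 :: "nat \<Rightarrow> nat \<Rightarrow> lat" where "rC1 r j = seg (l - 1 - r) (l - 1 - j)"
text \<open>The sum \<open>\<epsilon>\<^sub>r + \<epsilon>\<^sub>j\<close>. For \<open>j = r\<close>
  the first segment is empty and the long root \<open>2 \<epsilon>\<^sub>r\<close> results, so one
  family covers two kinds of roots.\<close>

definition rC2 :: "nat \<Rightarrow> nat \<Rightarrow> lat" where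
  "rC2 r j = (\<lambda>k. seg (l - 1 - r) (l - 1 - j) k + 2 * seg (l - 1 - j) (l - 1) k + seg (l - 1) l k)"

lemma eC_rev: "r < l \<Longrightarrow> eC x (l - 1 - r) = ratio r x" by (simp add: eC_def)

lemma hyp_rC1: assumes "r < l" "j < r" shows "hyp l (rC1 r j) 1 = phiC ` ratio_eq l r j"
  unfolding ratio_eq_def
proof (rule hyp_image[OF phiC])
  fix x assume x: "x \<in> torus l"
  have "chr l (rC1 r j) (phiC x) = ratio r x / ratio j x"
    using phiC_prod[OF x, of "l-1-r" "l-1-j"] assms eC_rev[of r x] eC_rev[of j x] by (simp add: rC1_def chr_seg)
  then show "chr l (rC1 r j) (phiC x) = 1 \<longleftrightarrow> ratio r x = ratio j x" using ratio_nonzero[OF x] by simp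
qed (use assms in auto)

lemma hyp_rC2: assumes "r < l" "j \<le> r" shows "hyp l (rC2 r j) 1 = phiC ` ratio_inv l r j"
  unfolding ratio_inv_def
proof (rule hyp_image[OF phiC])
  fix x assume x: "x \<in> torus l"
  have l: "1 \<le> l" using assms by simp
  have t: "phiC x \<in> torus l" using emb_in[OF phiC(1)[OF l] x] .
  have e: "eC x (l - 1) = 1" by (simp add: eC_def ratio_def)
  have "{l - 1..<l} = {l - 1}" using l by auto
  then have c0: "chr l (seg (l - 1) l) (phiC x) = x 0" using l by (simp add: chr_seg phiC_def)
  have "(\<Prod>k=l-1-r..<l-1-j. phiC x k) = ratio r x / ratio j x"
    using phiC_prod[OF x, of "l-1-r" "l-1-j"] assms eC_rev[of r x] eC_rev[of j x] by simp
  then have c1: "chr l (seg (l - 1 - r) (l - 1 - j)) (phiC x) = ratio r x / ratio j x" by (simp add: chr_seg)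
  have "(\<Prod>k=l-1-j..<l-1. phiC x k) = ratio j x"
    using phiC_prod[OF x, of "l-1-j" "l-1"] assms eC_rev[of j x] e by simp
  then have c2: "chr l (\<lambda>k. 2 * seg (l - 1 - j) (l - 1) k) (phiC x) = (ratio j x)\<^sup>2" by (simp add: chr_cseg)
  have "chr l (rC2 r j) (phiC x) = ratio r x / ratio j x * (ratio j x)\<^sup>2 * x 0"
    unfolding rC2_def chr_add[OF t] c0 c1 c2 ..
  also have "\<dots> = x 0 * ratio r x * ratio j x" using ratio_nonzero[OF x, of j] by (simp add: power2_eq_square)
  finally show "chr l (rC2 r j) (phiC x) = 1 \<longleftrightarrow> x 0 * ratio r x * ratio j x = 1" by simp
qed (use assms in auto)

lemma seg_empty: "seg i i k = 0" by (simp add: seg_def)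

lemma rC_pos:
  "r < l \<Longrightarrow> j < r \<Longrightarrow> rC1 r j \<in> pos_roots TC l"
  "r < l \<Longrightarrow> j \<le> r \<Longrightarrow> rC2 r j \<in> pos_roots TC l"
proof -
  show "rC1 r j \<in> pos_roots TC l" if "r < l" "j < r"
    using that unfolding pos_roots.simps rC1_def by (intro UnI1 CollectI exI[of _ "l-1-r"] exI[of _ "l-1-j"]) auto
  show "rC2 r j \<in> pos_roots TC l" if "r < l" "j \<le> r"
  proof (cases "j = r")
    case True
    then show ?thesis using that unfolding pos_roots.simps rC2_def
      by (intro UnI1 UnI2 CollectI exI[of _ "l-1-r"]) (auto simp: seg_empty)
  next
    case False
    then show ?thesis using that unfolding pos_roots.simps rC2_def
      by (intro UnI2 CollectI exI[of _ "l-1-r"] exI[of _ "l-1-j"]) auto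
  qed
qed

lemma pos_roots_C_cases:
  assumes "b \<in> pos_roots TC l"
  obtains r j where "r < l" "j < r" "b = rC1 r j" | r j where "r < l" "j \<le> r" "b = rC2 r j"
proof -
  from assms consider i j where "i < j" "j < l" "b = seg i j"
    | i where "i < l" "b = (\<lambda>k. 2 * seg i (l - 1) k + seg (l - 1) l k)"
    | i j where "i < j" "j < l" "b = (\<lambda>k. seg i j k + 2 * seg j (l - 1) k + seg (l - 1) l k)"
    unfolding pos_roots.simps by blast
  then show ?thesis
  proof cases
    case (1 i j)
    then show ?thesis using that(1)[of "l - 1 - i" "l - 1 - j"] by (simp add: rC1_def)
  next
    case (2 i)
    then show ?thesis using that(2)[of "l - 1 - i" "l - 1 - i"] by (simp add: rC2_def seg_empty)
  next
    case (3 i j)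
    then show ?thesis using that(2)[of "l - 1 - i" "l - 1 - j"] by (simp add: rC2_def)
  qed
qed

lemma ideal_C:
  assumes J: "is_ideal (pos_roots TC l) J" and l: "1 \<le> l"
  shows "\<exists>D p. ind_poly l D p \<and> (\<lambda>b. hyp l b 1) ` J = (`) phiC ` D"
proof -
  define V where "V r j \<longleftrightarrow> j < r \<and> rC1 r j \<in> J" for r j
  define W where "W r j \<longleftrightarrow> rC2 r j \<in> J" for r j
  have dn: "b2 \<in> J" if "b1 \<in> J" "b2 \<in> pos_roots TC l" "root_le b2 b1" for b1 b2
    using J that unfolding is_ideal_def by blast
  have "\<exists>p. ind_poly (Suc (l - 1)) (arr_C (Suc (l - 1)) V W) p"
  proof -
    have "\<exists>p. ind_poly (Suc (l - 1)) (arr_C (Suc (l - 1)) V W) p \<and> (W (l - 1) (l - 1) \<longrightarrow> p = [:- int (Suc (l - 1)), 1:] * sh_poly (\<lambda>i. i) (l - 1) (l - 1))"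
    proof (rule ind_poly_arr_C[of l V W])
      show "V r' j'" if "r < l" "V r j" "j \<le> j'" "j' < r'" "r' \<le> r" for r j r' j'
      proof -
        have "rC1 r j \<in> J" using that(2) by (simp add: V_def)
        then have "rC1 r' j' \<in> J" by (rule dn[OF _ rC_pos(1)]) (use that in \<open>auto simp: root_le_def rC1_def seg_def\<close>)
        then show ?thesis using that(4) by (simp add: V_def)
      qed
      show "V r j'" if "r < l" "j \<le> r" "W r j" "j' < r" for r j j'
      proof -
        have "rC1 r j' \<in> J" using that(3) unfolding W_def
          by (rule dn[OF _ rC_pos(1)]) (use that in \<open>auto simp: root_le_def rC1_def rC2_def seg_def\<close>)
        then show ?thesis using that(4) by (simp add: V_def)
      qed
      show "W r' j'" if "r < l" "j \<le> r" "W r j" "r' \<le> r" "j' \<le> j" "j' \<le> r'" for r j r' j'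
        using that(3) unfolding W_def by (rule dn[OF _ rC_pos(2)]) (use that in \<open>auto simp: root_le_def rC2_def seg_def\<close>)
    qed (use l in simp)
    then show ?thesis by blast
  qed
  moreover have "Suc (l - 1) = l" using l by simp
  ultimately obtain p where p: "ind_poly l (arr_C l V W) p" by (simp only:) blast
  moreover have "(\<lambda>b. hyp l b 1) ` J = (`) phiC ` arr_C l V W"
  proof (intro subset_antisym image_subsetI)
    fix b assume b: "b \<in> J"
    then have "b \<in> pos_roots TC l" using J unfolding is_ideal_def by blast
    then show "hyp l b 1 \<in> (`) phiC ` arr_C l V W"
    proof (cases rule: pos_roots_C_cases)
      case (1 r j)
      then have "ratio_eq l r j \<in> arr_C l V W" using b by (intro ratio_eq_in) (auto simp: V_def)
      then show ?thesis unfolding 1(3) hyp_rC1[OF 1(1,2)] by (rule imageI)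
    next
      case (2 r j)
      then have "ratio_inv l r j \<in> arr_C l V W" using b by (intro ratio_inv_in) (auto simp: W_def)
      then show ?thesis unfolding 2(3) hyp_rC2[OF 2(1,2)] by (rule imageI)
    qed
  next
    fix K assume "K \<in> arr_C l V W"
    then consider r j where "r < l" "j < r" "V r j" "K = ratio_eq l r j"
      | r j where "r < l" "j \<le> r" "W r j" "K = ratio_inv l r j" unfolding arr_C_def by blast
    then show "phiC ` K \<in> (\<lambda>b. hyp l b 1) ` J"
    proof cases
      case (1 r j) then show ?thesis using hyp_rC1[OF 1(1,2)] by (auto simp: V_def)
    next
      case (2 r j) then show ?thesis using hyp_rC2[OF 2(1,2)] by (auto simp: W_def)
    qed
  qed
  ultimately show ?thesis by blast
qed

end

text \<open>In simple-root coordinates the positive roots of type A are those of type B without a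
  coefficient 2, and nothing with a coefficient 2 lies below them.\<close>

lemma ideal_A_B:
  assumes "is_ideal (pos_roots TA l) J" shows "is_ideal (pos_roots TB l) J"
  unfolding is_ideal_def
proof (intro conjI ballI impI)
  have "pos_roots TA l \<subseteq> pos_roots TB l" by auto
  then show "J \<subseteq> pos_roots TB l" using assms unfolding is_ideal_def by (blast intro: order_trans)
  fix b1 b2 assume b: "b1 \<in> J" "b2 \<in> pos_roots TB l" "root_le b2 b1"
  have "b1 \<in> pos_roots TA l" using assms b(1) unfolding is_ideal_def by blast
  then obtain i j where b1: "b1 = seg i j" by auto
  have "b2 \<in> pos_roots TA l"
  proof (rule ccontr)
    assume "b2 \<notin> pos_roots TA l"
    then obtain i' j' where "i' < j'" "j' < l" "b2 = (\<lambda>k. seg i' j' k + 2 * seg j' l k)"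
      using b(2) unfolding pos_roots.simps by blast
    then have "b2 j' = 2" by (simp add: seg_def)
    moreover have "b2 j' \<le> b1 j'" using b(3) by (simp add: root_le_def)
    ultimately show False unfolding b1 by (simp add: seg_def split: if_splits)
  qed
  then show "b2 \<in> J" using assms b unfolding is_ideal_def by blast
qed

lemma ideal_ind_poly:
  assumes "is_ideal (pos_roots T l) J" "1 \<le> l"
  shows "\<exists>\<phi> D p. emb l l \<phi> \<and> \<phi> ` torus l = torus l \<and> ind_poly l D p \<and> (\<lambda>b. hyp l b 1) ` J = (`) \<phi> ` D"
proof (cases T)
  case TA
  then have "is_ideal (pos_roots TB l) J" using assms(1) ideal_A_B by simp
  from ideal_B[OF this] phiB[of l] show ?thesis by (metis (no_types))
next
  case TB
  then have "is_ideal (pos_roots TB l) J" using assms(1) by simp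
  from ideal_B[OF this] phiB[of l] show ?thesis by (metis (no_types))
next
  case TC
  then have "is_ideal (pos_roots TC l) J" using assms(1) by simp
  from ideal_C[OF this assms(2)] phiC[OF assms(2)] show ?thesis by (metis (no_types))
qed

theorem theorem1p4:
  fixes T :: rtype and l :: nat and s :: "nat \<Rightarrow> nat" and I :: "lat set"
  assumes "l \<ge> 1"
    and "s permutes {..<l}"
    and "is_ideal (pos_roots_lab T l s) I"
  shows "inductive_arr l (torus l) (toric_arr l I)"
proof -
  \<comment> \<open>Relabelling the simple roots merely permutes the coordinates of the torus and
    respects the root order, so the ideal is first brought back to the standard labelling.\<close>
  define J where "J = {b \<in> pos_roots T l. b \<circ> s \<in> I}"
  have sub: "I \<subseteq> (\<lambda>b. b \<circ> s) ` pos_roots T l"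
    using assms(3) unfolding is_ideal_def pos_roots_lab_def by (rule conjunct1)
  have I: "I = (\<lambda>b. b \<circ> s) ` J"
  proof
    show "I \<subseteq> (\<lambda>b. b \<circ> s) ` J"
    proof
      fix a assume a: "a \<in> I"
      then obtain b where "b \<in> pos_roots T l" "a = b \<circ> s" using sub by blast
      then show "a \<in> (\<lambda>b. b \<circ> s) ` J" using a by (simp add: J_def)
    qed
    show "(\<lambda>b. b \<circ> s) ` J \<subseteq> I" by (rule image_subsetI) (simp add: J_def)
  qed
  have "is_ideal (pos_roots T l) J"
    unfolding is_ideal_def
  proof (intro conjI ballI impI)
    show "J \<subseteq> pos_roots T l" by (auto simp: J_def)
    fix b1 b2 assume b: "b1 \<in> J" "b2 \<in> pos_roots T l" "root_le b2 b1"
    have "root_le (b2 \<circ> s) (b1 \<circ> s)" using b(3) by (simp add: root_le_def)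
    moreover have "b1 \<circ> s \<in> I" "b2 \<circ> s \<in> pos_roots_lab T l s"
      using b by (simp_all add: J_def pos_roots_lab_def)
    ultimately have "b2 \<circ> s \<in> I" using assms(3)[unfolded is_ideal_def, THEN conjunct2] by simp
    then show "b2 \<in> J" using b(2) by (simp add: J_def)
  qed
  from ideal_ind_poly[OF this assms(1)] obtain \<phi> D p where
    \<phi>: "emb l l \<phi>" "\<phi> ` torus l = torus l" and ind_poly: "ind_poly l D p" and h: "(\<lambda>b. hyp l b 1) ` J = (`) \<phi> ` D"
    by (elim exE conjE) (rule that)
  let ?\<sigma> = "\<lambda>t::pt. t \<circ> s"
  note \<sigma> = hyp_permute[OF assms(2)]
  show ?thesis
  proof (rule inductive_toric_arr[OF ind_poly emb_comp[OF \<phi>(1) \<sigma>(1)]])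
    show "(?\<sigma> \<circ> \<phi>) ` torus l = torus l" unfolding image_comp[symmetric] \<phi>(2) \<sigma>(2) ..
    have "(\<lambda>b. hyp l b 1) ` I = (`) ?\<sigma> ` (\<lambda>b. hyp l b 1) ` J"
      unfolding I image_image \<sigma>(3) ..
    moreover have "(`) ?\<sigma> \<circ> (`) \<phi> = (`) (?\<sigma> \<circ> \<phi>)" by (rule ext) (simp only: o_apply image_comp)
    ultimately show "(\<lambda>b. hyp l b 1) ` I = (`) (?\<sigma> \<circ> \<phi>) ` D"
      unfolding h by (simp only: image_comp)
  qed
qed

end
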